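(* Let $t\ge2$ be a fixed integer and let $\hat m^{ens}_{k_n,boost}$ be the truncated ensemble of $B\ge 1$ ODT-based boosting trees (each with $k_n$ random ODTs of $t$ leaves, truncation level $\beta_n$), as defined in the context. Assume $\mathbf E(e^{cY^2})<\infty$ for some $c>0$ and that $m(X)$ is $L^2$ integrable. If $\beta_n\asymp\ln n$, $k_n\to\infty$ and $k_n=o\left(\frac n{\ln^4n}\right)$, then $$\mathbf E\left(\int|\hat m^{ens}_{k_n,boost}(x)-m(x)|^2\,d\mu(x)\right)\to0\quad\text{as }n\to\infty .$$
   Context: **Setting.** $p\ge1$ is fixed, $X$ is a random vector in $[0,1]^p$ with distribution $\mu$, $Y$ is a real random variable, $m(x)=\mathbf E(Y\mid X=x)$, and $\mathcal D_n=\{(X_i,Y_i)\}_{i=1}^n$ are i.i.d. copies of $(X,Y)$. "$m(X)$ is $L^2$ integrable" means $\mathbf E(m(X)^2)<\infty$. $\Theta^q=\{\theta\in\mathbb R^q:\|\theta\|_2=1\}$. For $\mathcal S\subseteq\{1,\dots,p\}$, $x_{\mathcal S}$ is the subvector of $x$ with coordinates in $\mathcal S$. **Random ODT with $t$ leaves on data $\{(X_i,R_i)\}_{i=1}^n$.** For $A\subseteq[0,1]^p$, $N(A)=\#\{i:X_i\in A\}$ and $\bar R_A$ is the mean of $R_i$ over $X_i\in A$ ($0$ if there are none). Let $\mathcal S_1,\dots,\mathcal S_{t-1}$ be i.i.d. random nonempty subsets of $\{1,\dots,p\}$, independent of the data, with $\mathbf P(\mathcal S)=\frac1p\binom p{\mathrm{Card}(\mathcal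 S)}^{-1}$. For a nonempty $\mathcal S$ of size $q$, $\theta\in\Theta^q$, $s\in\mathbb R$, let $A^+=\{x\in A:\theta^Tx_{\mathcal S}\le s\}$, $A^-=\{x\in A:\theta^Tx_{\mathcal S}>s\}$ and $$\Delta_{A,q}(\theta,s)=\frac1{N(A)}\Big[\sum_{X_i\in A}(R_i-\bar R_A)^2-\sum_{X_i\in A^+}(R_i-\bar R_{A^+})^2-\sum_{X_i\in A^-}(R_i-\bar R_{A^-})^2\Big].$$ Starting from layer $0$ consisting of the node $[0,1]^p$, nodes of the current layer are processed one after another: a node with at most one data point is passed unchanged to the next layer; a node $A$ with at least two data points is split, and if this is the $\tau$-th split it is split into $A^+,A^-$ using $\mathcal S=\mathcal S_\tau$ and a maximizer of $\Delta_{A,q}$ over $\Theta^q\times\mathbb R$, $q=\mathrm{Card}(\mathcal S_\tau)$; daughters go to the next layer. One stops as soon as there are $t$ leaves. The tree estimator at $x$ equals $\bar R_A$ with $A$ the leaf containing $x$. **Boosting tree with $k$ random ODTs.** Put $\mathcal D_n^1=\mathcal D_n$. For $j=1,\dots,k$: let $m_{n,t,\mathcal L_j}$ be the random ODT estimator with $t$ leaves built on $\mathcal D_n^j$ (with fresh independent random seeds for every tree); let $$m_{j,boost}(x)=\sum_{\ell=1}^ja^*_{j,\ell}m_{n,t,\mathcal L_\ell}(x),\qquad (a^*_{j,1},\dots,a^*_{j,j})\in\arg\min_{a_{j,1},\dots,a_{j,j}\in\mathbb R}\sum_{i=1}^n\Big(Y_i-\sum_{\ell=1}^ja_{j,\ell}m_{n,t,\mathcal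 L_\ell}(X_i)\Big)^2;$$ and put $\mathcal D_n^{j+1}=\{(X_i,Y_i-m_{j,boost}(X_i))\}_{i=1}^n$. The output is $m_{k,boost}$. **Ensemble.** Running this $B$ times with independent seeds on the same data gives $m^1_{k_n,boost},\dots,m^B_{k_n,boost}$, and $$\hat m^{ens}_{k_n,boost}(x)=\frac1B\sum_{b=1}^B\max\{\min\{m^b_{k_n,boost}(x),\beta_n\},-\beta_n\}.$$ $a_n\asymp b_n$ means that $a_n/b_n$ is bounded above and below by positive constants. The expectation is over the data and all random seeds. *)

theory Defs
  imports "HOL-Probability.Probability" "HOL-Library.Landau_Symbols"
begin

section \<open>Random oblique decision trees\<close>

text \<open>
  The dimension is \<open>p = CARD('p)\<close>, and the unit cube is \<open>cbox 0 1\<close>. A data set of size \<open>n\<close> is a function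
  \<open>D\<close> of which only the values \<open>D i = (X\<^sub>i, R\<^sub>i)\<close> with \<open>i < n\<close> matter.
\<close>

type_synonym 'p dataset = "nat \<Rightarrow> (real, 'p) vec \<times> real"

type_synonym 'p node = "(real, 'p) vec set"

text \<open>A split direction \<open>\<theta> \<in> \<real>\<^sup>q\<close>, \<open>q = card S\<close>, has its coordinates indexed by \<open>S\<close> itself.\<close>

type_synonym 'p split = "('p \<Rightarrow> real) \<times> real"

definition node_idx :: "nat \<Rightarrow> ('p::finite) dataset \<Rightarrow> 'p node \<Rightarrow> nat set" where
  "node_idx n D A = {i. i < n \<and> fst (D i) \<in> A}"

definition node_count :: "nat \<Rightarrow> ('p::finite) dataset \<Rightarrow> 'p node \<Rightarrow> nat" where
  "node_count n D A = card (node_idx n D A)"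

text \<open>On a node without data this is \<open>0 / 0 = 0\<close>, as required.\<close>

definition node_mean :: "nat \<Rightarrow> ('p::finite) dataset \<Rightarrow> 'p node \<Rightarrow> real" where
  "node_mean n D A = (\<Sum>i\<in>node_idx n D A. snd (D i)) / real (node_count n D A)"

definition node_sse :: "nat \<Rightarrow> ('p::finite) dataset \<Rightarrow> 'p node \<Rightarrow> real" where
  "node_sse n D A = (\<Sum>i\<in>node_idx n D A. (snd (D i) - node_mean n D A)\<^sup>2)"

definition unit_directions :: "'p set \<Rightarrow> ('p \<Rightarrow> real) set" where
  "unit_directions S = {\<theta> \<in> S \<rightarrow>\<^sub>E UNIV. L2_set \<theta> S = 1}"

definition daughter_le :: "('p::finite) node \<Rightarrow> 'p set \<Rightarrow> 'p split \<Rightarrow> 'p node" where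
  "daughter_le A S = (\<lambda>(\<theta>, s). {x \<in> A. (\<Sum>i\<in>S. \<theta> i * x $ i) \<le> s})"

definition daughter_gt :: "('p::finite) node \<Rightarrow> 'p set \<Rightarrow> 'p split \<Rightarrow> 'p node" where
  "daughter_gt A S = (\<lambda>(\<theta>, s). {x \<in> A. (\<Sum>i\<in>S. \<theta> i * x $ i) > s})"

definition impurity_gain ::
  "nat \<Rightarrow> ('p::finite) dataset \<Rightarrow> 'p node \<Rightarrow> 'p set \<Rightarrow> 'p split \<Rightarrow> real" where
  "impurity_gain n D A S z =
     (node_sse n D A - node_sse n D (daughter_le A S z) - node_sse n D (daughter_gt A S z))
       / real (node_count n D A)"

text \<open>
  Maximizers of the impurity gain are never unique, so the algorithm involves a rule that selects one of
  them from the data, the node and the coordinate set.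
\<close>

type_synonym 'p split_rule = "nat \<Rightarrow> 'p dataset \<Rightarrow> 'p node \<Rightarrow> 'p set \<Rightarrow> 'p split"

definition optimal_split_rule :: "('p::finite) split_rule \<Rightarrow> bool" where
  "optimal_split_rule sel \<longleftrightarrow>
     (\<forall>n D A S. A \<subseteq> cbox 0 1 \<and> S \<noteq> {} \<and> node_count n D A \<ge> 2 \<longrightarrow>
        is_arg_max (impurity_gain n D A S) (\<lambda>z. z \<in> unit_directions S \<times> UNIV) (sel n D A S))"

text \<open>
  \<open>split_layer sel t n D \<S> cur next_layer\<close> processes the nodes \<open>cur\<close> remaining in the current layer, where
  \<open>next_layer\<close> is the part of the next layer obtained so far; the current leaves are \<open>next_layer @ cur\<close>. Every split adds
  exactly one leaf, so with \<open>\<tau>\<close> leaves the next split is the \<open>\<tau>\<close>-th one and uses the set \<open>\<S> \<tau>\<close>.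
\<close>

fun split_layer ::
  "('p::finite) split_rule \<Rightarrow> nat \<Rightarrow> nat \<Rightarrow> 'p dataset \<Rightarrow> (nat \<Rightarrow> 'p set) \<Rightarrow>
     'p node list \<Rightarrow> 'p node list \<Rightarrow> 'p node list" where
  "split_layer sel t n D \<S> [] next_layer = next_layer"
| "split_layer sel t n D \<S> (A # cur) next_layer =
     (let \<tau> = length next_layer + length (A # cur) in
      if \<tau> \<ge> t \<or> node_count n D A \<le> 1
      then split_layer sel t n D \<S> cur (next_layer @ [A])
      else let z = sel n D A (\<S> \<tau>) in
        split_layer sel t n D \<S> cur (next_layer @ [daughter_le A (\<S> \<tau>) z, daughter_gt A (\<S> \<tau>) z]))"

text \<open>
  Processing \<open>t - 1\<close> layers suffices: afterwards there are \<open>t\<close> leaves or, which can only happen for \<open>n < t\<close>,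
  no node can be split any more; see \<open>odt_leaves_complete\<close> below.
\<close>

definition odt_leaves ::
  "('p::finite) split_rule \<Rightarrow> nat \<Rightarrow> nat \<Rightarrow> 'p dataset \<Rightarrow> (nat \<Rightarrow> 'p set) \<Rightarrow> 'p node list" where
  "odt_leaves sel t n D \<S> = ((\<lambda>layer. split_layer sel t n D \<S> layer []) ^^ (t - 1)) [cbox 0 1]"

text \<open>The leaves partition the unit cube; off the cube the estimator is set to \<open>0\<close>.\<close>

definition odt_estimator ::
  "('p::finite) split_rule \<Rightarrow> nat \<Rightarrow> nat \<Rightarrow> 'p dataset \<Rightarrow> (nat \<Rightarrow> 'p set) \<Rightarrow> (real, 'p) vec \<Rightarrow> real" where
  "odt_estimator sel t n D \<S> x =
     (case find (\<lambda>A. x \<in> A) (odt_leaves sel t n D \<S>) of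
        Some A \<Rightarrow> node_mean n D A
      | None \<Rightarrow> 0)"

lemma length_split_layer_le:
  "length cur + length next_layer \<le> t \<Longrightarrow> length (split_layer sel t n D \<S> cur next_layer) \<le> t"
  by (induction cur arbitrary: next_layer) (auto simp: Let_def)

lemma length_split_layer_ge:
  "length cur + length next_layer \<le> length (split_layer sel t n D \<S> cur next_layer)"
proof (induction cur arbitrary: next_layer)
  case (Cons A cur)
  have "length (A # cur) + length next_layer \<le> length cur + length (next_layer @ [A, B])" for B :: "'a node"
    by simp
  with Cons show ?case
    by (auto simp: Let_def intro: order_trans[OF _ Cons.IH])
qed simp

lemma split_layer_progress:
  "length cur + length next_layer < t \<Longrightarrow> \<exists>A\<in>set cur. node_count n D A \<ge> 2 \<Longrightarrow>
     length cur + length next_layer < length (split_layer sel t n D \<S> cur next_layer)"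
proof (induction cur arbitrary: next_layer)
  case (Cons A cur)
  show ?case
  proof (cases "node_count n D A \<le> 1")
    case True
    with Cons.prems Cons.IH[of "next_layer @ [A]"] show ?thesis
      by auto
  next
    case False
    with Cons.prems show ?thesis
      by (auto simp: Let_def intro: order.strict_trans2[OF _ length_split_layer_ge])
  qed
qed simp

lemma split_layer_stuck:
  "\<forall>A\<in>set cur. node_count n D A \<le> 1 \<Longrightarrow> split_layer sel t n D \<S> cur next_layer = next_layer @ cur"
  by (induction cur arbitrary: next_layer) auto

lemma odt_leaves_complete:
  assumes "t \<ge> 1"
  shows "length (odt_leaves sel t n D \<S>) = t \<or>
    length (odt_leaves sel t n D \<S>) < t \<and> (\<forall>A\<in>set (odt_leaves sel t n D \<S>). node_count n D A \<le> 1)"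
proof -
  define L where "L i = ((\<lambda>layer. split_layer sel t n D \<S> layer []) ^^ i) [cbox 0 1]" for i
  have L_Suc: "L (Suc i) = split_layer sel t n D \<S> (L i) []" for i
    by (simp add: L_def)
  have le: "length (L i) \<le> t" for i
  proof (induction i)
    case 0
    show ?case using assms by (simp add: L_def)
  next
    case (Suc i)
    show ?case
      unfolding L_Suc by (rule length_split_layer_le) (use Suc in simp)
  qed
  have "i < length (L i) \<or> length (L i) = t \<or> (\<forall>A\<in>set (L i). node_count n D A \<le> 1)" for i
  proof (induction i)
    case (Suc i)
    consider "length (L i) = t" | "\<forall>A\<in>set (L i). node_count n D A \<le> 1"
      | "i < length (L i)" "length (L i) < t" "\<exists>A\<in>set (L i). node_count n D A \<ge> 2"
      using Suc le[of i] by (force simp: not_le)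
    then show ?case
    proof cases
      case 1
      then show ?thesis
        using length_split_layer_ge[of "L i" "[]" sel t n D \<S>] le[of "Suc i"] L_Suc[of i] by simp
    next
      case 2
      then show ?thesis
        using split_layer_stuck[of "L i" n D sel t \<S> "[]"] L_Suc[of i] by simp
    next
      case 3
      then show ?thesis
        using split_layer_progress[of "L i" "[]" t n D sel \<S>] L_Suc[of i] by simp
    qed
  qed (simp add: L_def)
  from this[of "t - 1"] le[of "t - 1"] show ?thesis
    using assms unfolding odt_leaves_def L_def by force
qed


section \<open>Boosting and the truncated ensemble\<close>

text \<open>
  Least squares coefficients need not be unique either. A coefficient rule selects them from the data and
  the list of the trees built so far; only the coefficients with index below the length of that list matter.
\<close>

type_synonym 'p coeff_rule = "nat \<Rightarrow> 'p dataset \<Rightarrow> ((real, 'p) vec \<Rightarrow> real) list \<Rightarrow> nat \<Rightarrow> real"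

definition linear_combination :: "(nat \<Rightarrow> real) \<Rightarrow> ('x \<Rightarrow> real) list \<Rightarrow> 'x \<Rightarrow> real" where
  "linear_combination a fs x = (\<Sum>l<length fs. a l * (fs ! l) x)"

definition least_squares_rule :: "('p::finite) coeff_rule \<Rightarrow> bool" where
  "least_squares_rule coef \<longleftrightarrow>
     (\<forall>n D fs. is_arg_min (\<lambda>a. \<Sum>i<n. (snd (D i) - linear_combination a fs (fst (D i)))\<^sup>2)
        (\<lambda>_. True) (coef n D fs))"

definition boost_fit ::
  "('p::finite) coeff_rule \<Rightarrow> nat \<Rightarrow> 'p dataset \<Rightarrow> ((real, 'p) vec \<Rightarrow> real) list \<Rightarrow> (real, 'p) vec \<Rightarrow> real" where
  "boost_fit coef n D fs = linear_combination (coef n D fs) fs"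

definition residual_data ::
  "('p::finite) coeff_rule \<Rightarrow> nat \<Rightarrow> 'p dataset \<Rightarrow> ((real, 'p) vec \<Rightarrow> real) list \<Rightarrow> 'p dataset" where
  "residual_data coef n D fs =
     (\<lambda>i\<in>{..<n}. (fst (D i), snd (D i) - boost_fit coef n D fs (fst (D i))))"

text \<open>
  The trees are built from the seeds \<open>\<S> j \<tau>\<close> (\<open>j\<close>-th tree, \<open>\<tau>\<close>-th split). For \<open>j = 0\<close> the fit is the empty sum,
  so the first tree is built on \<open>D\<close> itself. The rule for selecting maximizers may vary with the tree.
\<close>

primrec boost_trees ::
  "(nat \<Rightarrow> ('p::finite) split_rule) \<Rightarrow> 'p coeff_rule \<Rightarrow> nat \<Rightarrow> nat \<Rightarrow> 'p dataset \<Rightarrow> (nat \<Rightarrow> nat \<Rightarrow> 'p set) \<Rightarrow>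
     nat \<Rightarrow> ((real, 'p) vec \<Rightarrow> real) list" where
  "boost_trees sel coef t n D \<S> 0 = []"
| "boost_trees sel coef t n D \<S> (Suc j) =
     (let fs = boost_trees sel coef t n D \<S> j in
      fs @ [odt_estimator (sel (Suc j)) t n (residual_data coef n D fs) (\<S> (Suc j))])"

definition boost_estimator ::
  "(nat \<Rightarrow> ('p::finite) split_rule) \<Rightarrow> 'p coeff_rule \<Rightarrow> nat \<Rightarrow> nat \<Rightarrow> 'p dataset \<Rightarrow> (nat \<Rightarrow> nat \<Rightarrow> 'p set) \<Rightarrow>
     nat \<Rightarrow> (real, 'p) vec \<Rightarrow> real" where
  "boost_estimator sel coef t n D \<S> k = boost_fit coef n D (boost_trees sel coef t n D \<S> k)"

definition truncate_at :: "real \<Rightarrow> real \<Rightarrow> real" where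
  "truncate_at \<beta> y = max (min y \<beta>) (- \<beta>)"

definition ensemble_estimator ::
  "(nat \<Rightarrow> nat \<Rightarrow> ('p::finite) split_rule) \<Rightarrow> (nat \<Rightarrow> 'p coeff_rule) \<Rightarrow> nat \<Rightarrow> nat \<Rightarrow> 'p dataset \<Rightarrow>
     (nat \<Rightarrow> nat \<Rightarrow> nat \<Rightarrow> 'p set) \<Rightarrow> nat \<Rightarrow> nat \<Rightarrow> real \<Rightarrow> (real, 'p) vec \<Rightarrow> real" where
  "ensemble_estimator sel coef t n D \<S> k B \<beta> x =
     (\<Sum>b=1..B. truncate_at \<beta> (boost_estimator (sel b) (coef b) t n D (\<S> b) k x)) / real B"


section \<open>Probabilistic setting\<close>

definition regression_function ::
  "'w measure \<Rightarrow> ('w \<Rightarrow> 'x::topological_space) \<Rightarrow> ('w \<Rightarrow> real) \<Rightarrow> ('x \<Rightarrow> real) \<Rightarrow> bool" where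
  "regression_function M X Y m \<longleftrightarrow> m \<in> borel_measurable borel \<and>
     (AE w in M. real_cond_exp M (vimage_algebra (space M) X borel) Y w = m (X w))"

definition iid_copies ::
  "'w measure \<Rightarrow> ('i \<Rightarrow> 'w \<Rightarrow> 'a::topological_space) \<Rightarrow> ('w \<Rightarrow> 'a) \<Rightarrow> bool" where
  "iid_copies M Z Z0 \<longleftrightarrow> prob_space.indep_vars M (\<lambda>_. borel) Z UNIV \<and>
     (\<forall>i. distr M borel (Z i) = distr M borel Z0)"

definition iid_seeds :: "'w measure \<Rightarrow> ('i \<Rightarrow> 'w \<Rightarrow> ('p::finite) set) \<Rightarrow> bool" where
  "iid_seeds M \<S> \<longleftrightarrow> prob_space.indep_vars M (\<lambda>_. count_space UNIV) \<S> UNIV \<and>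
     (\<forall>q S. S \<noteq> {} \<longrightarrow> measure M {w \<in> space M. \<S> q w = S} =
        1 / (real CARD('p) * real (CARD('p) choose card S)))"

text \<open>
  The library's \<open>indep_var\<close> only covers two random elements with values in the same type.
\<close>

definition independent_elements ::
  "'w measure \<Rightarrow> 'a measure \<Rightarrow> ('w \<Rightarrow> 'a) \<Rightarrow> 'b measure \<Rightarrow> ('w \<Rightarrow> 'b) \<Rightarrow> bool" where
  "independent_elements M Na U Nb V \<longleftrightarrow> U \<in> measurable M Na \<and> V \<in> measurable M Nb \<and>
     prob_space.indep_set M (sets (vimage_algebra (space M) U Na)) (sets (vimage_algebra (space M) V Nb))"

definition same_order :: "(nat \<Rightarrow> real) \<Rightarrow> (nat \<Rightarrow> real) \<Rightarrow> bool" where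
  "same_order a b \<longleftrightarrow>
     (\<exists>c1>0. \<exists>c2>0. \<forall>\<^sub>F n in sequentially. c1 \<le> a n / b n \<and> a n / b n \<le> c2)"

end

theory Submission
  imports Defs
begin

text \<open>
  Why the theorem holds. Write \<open>E\<close> for expectations over data and seeds, \<open>P\<^sub>n\<close> for the average over the sample
  and \<open>T\<close> for truncation at \<open>\<beta> n\<close>. Since \<open>m\<close> is the projection of \<open>Y\<close> on the functions of \<open>X\<close>, the estimation
  error of an estimator is its prediction risk minus the noise \<open>E (Y - m X)\<^sup>2\<close>, so it is enough to bound the
  risk of \<open>T f\<close>, \<open>f\<close> a boosting tree, by the noise plus a small term. Averaging over the ensemble is then
  convexity of the square (\<open>mean_square_le\<close>).

  \<^emph>\<open>Training error.\<close> Boosting with refitted coefficients is an orthogonal greedy algorithm. If the first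
  coordinate set of a tree is the full set, its first split competes with all half-spaces, so the drop of the
  residual sum of squares is at least the squared correlation of the residual with any half-space indicator. For
  a fixed ridge step function \<open>h\<close> with coefficients of total size \<open>V\<close> this gives a quadratic recursion for the
  excess over \<open>P\<^sub>n (Y - h X)\<^sup>2\<close>, and after \<open>N\<close> such trees the excess is at most \<open>4 V\<^sup>2 / N\<close>
  (\<open>boosting_training_error\<close>). Trees with smaller coordinate sets do no harm. The full set has positive
  probability for every tree, so \<open>N \<rightarrow> \<infinity>\<close> in probability as \<open>k n \<rightarrow> \<infinity>\<close> (\<open>few_full_seeds\<close>).

  \<^emph>\<open>Approximation.\<close> Ridge step functions are dense among the square-integrable functions for every law on the
  cube (\<open>step_functions_dense\<close>): they approximate functions of \<open>a \<bullet> x\<close>, in particular exponentials, whose span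
  is uniformly dense in the continuous functions by the theorem of Stone and Weierstrass. So \<open>P\<^sub>n (Y - h X)\<^sup>2\<close>
  has mean close to the noise.

  \<^emph>\<open>Generalization.\<close> A boosting tree is a combination of \<open>k t\<close> indicators of cells cut out by \<open>t - 1\<close>
  half-spaces. The bound of Sauer and Shelah for sign patterns yields nets of logarithmic size \<open>O(k ln n)\<close> on
  every set of \<open>2 n\<close> points for the truncated functions (\<open>truncated_finite_net\<close>). The loss \<open>(T f - T Y)\<^sup>2\<close> is
  nonnegative and bounded by \<open>4 \<beta>\<^sup>2\<close>, so comparing the sample with a ghost sample up to a factor \<open>1 + \<epsilon>\<close> costs
  only \<open>O(\<beta>\<^sup>2 k ln n / n)\<close>, instead of the square root that an additive comparison would cost (\<open>swap_factor_le\<close>,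
  \<open>sum_swaps_le\<close>). With \<open>\<beta>\<close> of order \<open>ln n\<close> this is \<open>O(k ln\<^sup>3 n / n)\<close> and vanishes. The comparison takes place
  under the expectation (\<open>expected_risk_le_empirical\<close>), so only the loss of the estimator itself, and never a
  supremum over a class, has to be measurable.

  Altogether the limit superior of the risk is at most \<open>(1 + \<epsilon>)\<^sup>2\<close> times the noise for every \<open>\<epsilon> > 0\<close>. The
  replacement of \<open>Y\<close> by \<open>T Y\<close> costs a factor \<open>1 + \<epsilon>\<close> and a multiple of \<open>E (Y - T Y)\<^sup>2\<close>, which tends to \<open>0\<close> as \<open>\<beta>
  n \<rightarrow> \<infinity>\<close>.
\<close>

section \<open>Sign patterns of finite-dimensional function spaces\<close>

definition shatters :: "'a set set \<Rightarrow> 'a set \<Rightarrow> bool" where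
  "shatters F S \<longleftrightarrow> (\<forall>T\<subseteq>S. \<exists>A\<in>F. A \<inter> S = T)"

lemma shattersI: "(\<And>T. T \<subseteq> S \<Longrightarrow> \<exists>A\<in>F. A \<inter> S = T) \<Longrightarrow> shatters F S"
  by (auto simp: shatters_def)

lemma shattersD: "shatters F S \<Longrightarrow> T \<subseteq> S \<Longrightarrow> \<exists>A\<in>F. A \<inter> S = T"
  by (simp add: shatters_def)

text \<open>
  Pajor's form of the Sauer-Shelah lemma. Fix a point \<open>x\<close> and split the family into the members without \<open>x\<close> and
  those with \<open>x\<close>, the latter with \<open>x\<close> removed. A set shattered by one of the parts is shattered by the family,
  and a set \<open>S\<close> shattered by both contributes \<open>insert x S\<close> as well.
\<close>

lemma card_le_card_shattered:
  assumes "finite P" "F \<subseteq> Pow P"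
  shows "card F \<le> card {S. S \<subseteq> P \<and> shatters F S}"
  using assms
proof (induction P arbitrary: F rule: finite_induct)
  case empty
  then consider "F = {}" | "F = {{}}" by (auto simp: subset_singleton_iff)
  then show ?case
    by cases (auto simp: shatters_def card_gt_0_iff Suc_le_eq)
next
  case (insert x Q)
  define F0 where "F0 = {A\<in>F. x \<notin> A}"
  define F1 where "F1 = (\<lambda>A. A - {x}) ` {A\<in>F. x \<in> A}"
  define G where "G = {S. S \<subseteq> insert x Q \<and> shatters F S}"
  define H where "H = (\<lambda>F. {S. S \<subseteq> Q \<and> shatters F S})"
  have finF: "finite F" using insert.prems insert.hyps(1)
    by (meson finite_Pow_iff finite_insert finite_subset)
  have finG: "finite G" unfolding G_def using insert.hyps(1) by auto
  have finH: "finite (H F')" for F' unfolding H_def using insert.hyps(1) by auto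
  have cF: "card F = card F0 + card F1"
  proof -
    have "card F1 = card {A\<in>F. x \<in> A}"
      unfolding F1_def by (intro card_image) (auto simp: inj_on_def)
    moreover have "card F = card {A\<in>F. x \<notin> A} + card {A\<in>F. x \<in> A}"
      using finF by (subst card_Un_disjoint[symmetric]) (auto intro: arg_cong[where f=card])
    ultimately show ?thesis by (simp add: F0_def)
  qed
  have "F0 \<subseteq> Pow Q" "F1 \<subseteq> Pow Q" using insert.prems by (auto simp: F0_def F1_def)
  then have "card F0 \<le> card (H F0)" "card F1 \<le> card (H F1)"
    using insert.IH by (auto simp: H_def)
  moreover have "card (H F0) + card (H F1) = card (H F0 \<union> H F1) + card (H F0 \<inter> H F1)"
    using finH by (intro card_Un_Int)
  moreover have "card (H F0 \<inter> H F1) = card (insert x ` (H F0 \<inter> H F1))"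
    using insert.hyps(2) by (intro card_image[symmetric]) (auto simp: inj_on_def H_def insert_ident)
  moreover have "card (H F0 \<union> H F1) + card (insert x ` (H F0 \<inter> H F1)) \<le> card G"
  proof -
    have "H F0 \<subseteq> G"
    proof
      fix S assume S: "S \<in> H F0"
      have "shatters F S"
        by (rule shattersI) (use shattersD[of F0 S] S in \<open>auto simp: H_def F0_def\<close>)
      then show "S \<in> G" using S by (auto simp: G_def H_def)
    qed
    moreover have "H F1 \<subseteq> G"
    proof
      fix S assume S: "S \<in> H F1"
      have "\<exists>A\<in>F. A \<inter> S = T" if T: "T \<subseteq> S" for T
      proof -
        obtain A' where "A' \<in> F1" "A' \<inter> S = T"
          using shattersD[of F1 S T] S T by (auto simp: H_def)
        then obtain A where "A \<in> F" "x \<in> A" "(A - {x}) \<inter> S = T"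
          unfolding F1_def by blast
        moreover have "x \<notin> S" using S insert.hyps(2) by (auto simp: H_def)
        ultimately show ?thesis by (intro bexI[of _ A]) auto
      qed
      then have "shatters F S" by (rule shattersI)
      then show "S \<in> G" using S by (auto simp: G_def H_def)
    qed
    moreover have "insert x ` (H F0 \<inter> H F1) \<subseteq> G"
    proof
      fix S' assume "S' \<in> insert x ` (H F0 \<inter> H F1)"
      then obtain S where S': "S' = insert x S" and S0: "S \<in> H F0" and S1: "S \<in> H F1" by auto
      have xS: "x \<notin> S" using S0 insert.hyps(2) by (auto simp: H_def)
      have "\<exists>A\<in>F. A \<inter> S' = T" if T: "T \<subseteq> S'" for T
      proof (cases "x \<in> T")
        case True
        have "T - {x} \<subseteq> S" using T S' by auto
        then obtain A' where "A' \<in> F1" "A' \<inter> S = T - {x}"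
          using shattersD[of F1 S "T - {x}"] S1 by (auto simp: H_def)
        then obtain A where "A \<in> F" "x \<in> A" "(A - {x}) \<inter> S = T - {x}"
          unfolding F1_def by blast
        then show ?thesis using True xS T S' by (intro bexI[of _ A]) auto
      next
        case False
        then have "T \<subseteq> S" using T S' by auto
        then obtain A where "A \<in> F0" "A \<inter> S = T"
          using shattersD[of F0 S T] S0 by (auto simp: H_def)
        then have "A \<in> F" "x \<notin> A" "A \<inter> S = T" by (auto simp: F0_def)
        then show ?thesis using False xS T S' by (intro bexI[of _ A]) auto
      qed
      then have "shatters F S'" by (rule shattersI)
      then show "S' \<in> G" using S0 S' by (auto simp: G_def H_def)
    qed
    moreover have "(H F0 \<union> H F1) \<inter> insert x ` (H F0 \<inter> H F1) = {}"
      using insert.hyps(2) by (auto simp: H_def)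
    ultimately show ?thesis
      using finH finG by (subst card_Un_disjoint[symmetric]) (auto intro!: card_mono)
  qed
  ultimately show ?case using cF by (simp add: G_def)
qed

text \<open>
  A set with at most \<open>d\<close> elements is the range of a \<open>d\<close>-tuple in which entries may be left blank.
\<close>

lemma card_subsets_card_le:
  assumes "finite P"
  shows "card {S. S \<subseteq> P \<and> card S \<le> d} \<le> (card P + 1) ^ d"
proof -
  have "{S. S \<subseteq> P \<and> card S \<le> d} \<subseteq>
      (\<lambda>g. {z. Some z \<in> g ` {..<d}}) ` ({..<d} \<rightarrow>\<^sub>E insert None (Some ` P))" (is "?L \<subseteq> ?f ` ?R")
  proof
    fix S assume S: "S \<in> ?L"
    then have "finite S" using assms finite_subset by auto
    then obtain h where h: "bij_betw h {..<card S} S"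
      using ex_bij_betw_nat_finite[of S] by (auto simp: atLeast0LessThan)
    define g where "g = (\<lambda>i\<in>{..<d}. if i < card S then Some (h i) else None)"
    have "h i \<in> S" if "i < card S" for i using h that by (auto simp: bij_betw_def)
    then have "g \<in> ?R" using S by (force simp: g_def)
    moreover have "?f g = S"
    proof -
      have "Some z \<in> g ` {..<d} \<longleftrightarrow> z \<in> h ` {..<card S}" for z
      proof -
        have "i < d" if "i < card S" for i using S that by auto
        then show ?thesis by (fastforce simp: g_def image_iff Bex_def split: if_splits)
      qed
      then show ?thesis using h by (auto simp: bij_betw_def)
    qed
    ultimately show "S \<in> ?f ` ?R" by blast
  qed
  moreover have fin: "finite ?R" using assms by (auto intro: finite_PiE)
  ultimately have "card ?L \<le> card ?R"
    by (meson card_image_le card_mono finite_imageI order_trans)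
  also have "card ?R = (card P + 1) ^ d"
    using assms by (simp add: card_PiE card_insert_if card_image)
  finally show ?thesis .
qed

lemma sauer_shelah:
  assumes "finite P" "F \<subseteq> Pow P" "\<And>S. S \<subseteq> P \<Longrightarrow> shatters F S \<Longrightarrow> card S \<le> d"
  shows "card F \<le> (card P + 1) ^ d"
proof -
  have "card F \<le> card {S. S \<subseteq> P \<and> shatters F S}"
    by (rule card_le_card_shattered) fact+
  also have "\<dots> \<le> card {S. S \<subseteq> P \<and> card S \<le> d}"
    using assms by (intro card_mono) auto
  also have "\<dots> \<le> (card P + 1) ^ d" by (rule card_subsets_card_le) fact
  finally show ?thesis .
qed

text \<open>
  Gaussian elimination of one unknown from the last equation.
\<close>

lemma homogeneous_system_nontrivial:
  fixes \<phi> :: "nat \<Rightarrow> 'a \<Rightarrow> real"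
  assumes "finite S" "d < card S"
  shows "\<exists>w. (\<exists>z\<in>S. w z \<noteq> 0) \<and> (\<forall>l<d. (\<Sum>z\<in>S. w z * \<phi> l z) = 0)"
  using assms
proof (induction d arbitrary: S \<phi>)
  case 0
  then obtain z where "z \<in> S" by fastforce
  then show ?case by (intro exI[of _ "\<lambda>_. 1"]) auto
next
  case (Suc d)
  show ?case
  proof (cases "\<forall>z\<in>S. \<phi> d z = 0")
    case True
    obtain w where "\<exists>z\<in>S. w z \<noteq> 0" "\<forall>l<d. (\<Sum>z\<in>S. w z * \<phi> l z) = 0"
      using Suc.IH[of S \<phi>] Suc.prems by auto
    with True show ?thesis by (intro exI[of _ w]) (auto simp: less_Suc_eq)
  next
    case False
    then obtain y where y: "y \<in> S" "\<phi> d y \<noteq> 0" by auto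
    define S' where "S' = S - {y}"
    define \<psi> where "\<psi> = (\<lambda>l z. \<phi> l z - \<phi> l y * \<phi> d z / \<phi> d y)"
    have "finite S'" "d < card S'" using Suc.prems y by (auto simp: S'_def)
    from Suc.IH[OF this, of \<psi>] obtain w where
      w: "\<exists>z\<in>S'. w z \<noteq> 0" "\<And>l. l < d \<Longrightarrow> (\<Sum>z\<in>S'. w z * \<psi> l z) = 0" by auto
    define w' where "w' = w(y := - (\<Sum>z\<in>S'. w z * \<phi> d z) / \<phi> d y)"
    have sum: "(\<Sum>z\<in>S. w' z * \<phi> l z) = (\<Sum>z\<in>S'. w z * \<psi> l z)" for l
    proof -
      have "(\<Sum>z\<in>S. w' z * \<phi> l z) = w' y * \<phi> l y + (\<Sum>z\<in>S'. w' z * \<phi> l z)"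
        using y Suc.prems by (simp add: S'_def sum.remove)
      also have "(\<Sum>z\<in>S'. w' z * \<phi> l z) = (\<Sum>z\<in>S'. w z * \<phi> l z)"
        by (intro sum.cong) (auto simp: w'_def S'_def)
      also have "w' y * \<phi> l y = - (\<Sum>z\<in>S'. w z * (\<phi> l y * \<phi> d z / \<phi> d y))"
        by (simp add: w'_def sum_distrib_left sum_distrib_right sum_divide_distrib mult_ac)
      finally show ?thesis
        by (simp add: \<psi>_def right_diff_distrib sum_subtractf)
    qed
    have "(\<Sum>z\<in>S. w' z * \<phi> l z) = 0" if "l < Suc d" for l
    proof (cases "l = d")
      case True
      have "\<psi> d z = 0" for z using y by (simp add: \<psi>_def)
      then show ?thesis unfolding True sum by simp
    next
      case False
      then show ?thesis unfolding sum using w(2) that by simp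
    qed
    moreover have "\<exists>z\<in>S. w' z \<noteq> 0" using w(1) by (auto simp: S'_def w'_def)
    ultimately show ?thesis by blast
  qed
qed

text \<open>
  A space spanned by \<open>d\<close> functions shatters no set of more than \<open>d\<close> points through the sets where its members
  are positive: on such a set a nontrivial weight \<open>w\<close> annihilates the space, although a member that is positive
  exactly where \<open>w\<close> is would have a positive pairing with \<open>w\<close>.
\<close>

lemma card_sign_patterns_le:
  fixes \<phi> :: "nat \<Rightarrow> 'a \<Rightarrow> real"
  assumes "finite P"
  shows "card (range (\<lambda>c. {z\<in>P. (\<Sum>l<d. c l * \<phi> l z) > 0})) \<le> (card P + 1) ^ d"
proof (rule sauer_shelah)
  let ?F = "range (\<lambda>c. {z\<in>P. (\<Sum>l<d. c l * \<phi> l z) > 0})"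
  fix S assume S: "S \<subseteq> P" "shatters ?F S"
  show "card S \<le> d"
  proof (rule ccontr)
    assume "\<not> card S \<le> d"
    moreover have finS: "finite S" using S(1) assms finite_subset by blast
    ultimately obtain w0 where w0: "\<exists>z\<in>S. w0 z \<noteq> 0" "\<forall>l<d. (\<Sum>z\<in>S. w0 z * \<phi> l z) = 0"
      using homogeneous_system_nontrivial[of S d \<phi>] by auto
    obtain w where w: "\<exists>z\<in>S. w z > 0" "\<And>l. l < d \<Longrightarrow> (\<Sum>z\<in>S. w z * \<phi> l z) = 0"
    proof (cases "\<exists>z\<in>S. w0 z > 0")
      case True
      with w0 that show ?thesis by blast
    next
      case False
      with w0 have "\<exists>z\<in>S. - w0 z > 0" by (metis neg_0_less_iff_less not_less_iff_gr_or_eq)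
      with w0 that[of "\<lambda>z. - w0 z"] show ?thesis by (auto simp: sum_negf)
    qed
    obtain c where c: "{z\<in>P. (\<Sum>l<d. c l * \<phi> l z) > 0} \<inter> S = {z\<in>S. w z > 0}"
      using S(2) by (auto dest!: shattersD[where T = "{z\<in>S. w z > 0}"])
    define f where "f z = (\<Sum>l<d. c l * \<phi> l z)" for z
    have f: "f z > 0 \<longleftrightarrow> w z > 0" if "z \<in> S" for z
      using c that S(1) by (auto simp: f_def set_eq_iff)
    have "(\<Sum>z\<in>S. w z * f z) = (\<Sum>l<d. c l * (\<Sum>z\<in>S. w z * \<phi> l z))"
      unfolding f_def sum_distrib_left by (subst sum.swap) (simp add: mult_ac)
    then have "(\<Sum>z\<in>S. w z * f z) = 0" using w(2) by simp
    moreover have "(\<Sum>z\<in>S. w z * f z) > 0"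
    proof -
      obtain z where z: "z \<in> S" "w z > 0" using w(1) by auto
      have "w z * f z \<ge> 0" if "z \<in> S" for z
        using f[OF that] by (cases "w z > 0") (auto simp: not_less mult_nonpos_nonpos)
      moreover have "w z * f z > 0" using z f by auto
      ultimately show ?thesis using finS z(1) by (intro sum_pos2[of S z]) auto
    qed
    ultimately show False by simp
  qed
qed (use assms in auto)


section \<open>Counting the traces of tree cells, and finite nets\<close>

definition halfspaces :: "(real ^ 'p) set set" where
  "halfspaces = {{x. a \<bullet> x > s} | a s. True} \<union> {{x. a \<bullet> x \<le> s} | a s. True}"

text \<open>
  The half-spaces along which a tree may split if the coordinate set is the full one.
\<close>

definition unit_halfspaces :: "(real ^ 'p) set set" where
  "unit_halfspaces = {{x. a \<bullet> x \<le> s} | a s. norm a = 1}"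

text \<open>
  The whole space is a half-space with normal vector \<open>0\<close>, so all nodes of depth at most \<open>r\<close> are included.
\<close>

primrec cells :: "nat \<Rightarrow> (real ^ 'p) set set" where
  "cells 0 = {cbox 0 1}"
| "cells (Suc r) = (\<lambda>(A, H). A \<inter> H) ` (cells r \<times> halfspaces)"

text \<open>
  The sets may vary with the function, only the number of terms is fixed; the class is not a linear space.
\<close>

definition span_class :: "nat \<Rightarrow> 'x set set \<Rightarrow> ('x \<Rightarrow> real) set" where
  "span_class K \<A> = {\<lambda>x. \<Sum>l<K. c l * indicator (A l) x | c A. \<forall>l<K. A l \<in> \<A>}"

text \<open>
  If \<open>h a b\<close> depends on \<open>a\<close> and \<open>b\<close> only through \<open>f a\<close> and \<open>g b\<close>, it has at most as many values as there are
  pairs of values of \<open>f\<close> and \<open>g\<close>.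
\<close>

lemma card_image_prod_le:
  assumes "finite (f ` A)" "finite (g ` B)"
    and "\<And>a b a' b'. a \<in> A \<Longrightarrow> a' \<in> A \<Longrightarrow> b \<in> B \<Longrightarrow> b' \<in> B \<Longrightarrow> f a = f a' \<Longrightarrow> g b = g b' \<Longrightarrow> h a b = h a' b'"
  shows "card ((\<lambda>(a, b). h a b) ` (A \<times> B)) \<le> card (f ` A) * card (g ` B)"
proof -
  let ?\<phi> = "\<lambda>(u, v). h (inv_into A f u) (inv_into B g v)"
  have "(\<lambda>(a, b). h a b) ` (A \<times> B) \<subseteq> ?\<phi> ` (f ` A \<times> g ` B)"
  proof safe
    fix a b assume ab: "a \<in> A" "b \<in> B"
    have "h a b = h (inv_into A f (f a)) (inv_into B g (g b))"
      using ab by (intro assms(3)) (auto simp: f_inv_into_f inv_into_into)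
    then show "h a b \<in> ?\<phi> ` (f ` A \<times> g ` B)" using ab by (intro image_eqI[of _ _ "(f a, g b)"]) auto
  qed
  then have "card ((\<lambda>(a, b). h a b) ` (A \<times> B)) \<le> card (f ` A \<times> g ` B)"
    using assms(1,2) by (meson card_image_le card_mono finite_SigmaI finite_imageI order_trans)
  then show ?thesis by (simp add: card_cartesian_product)
qed

lemma finite_traces: "finite P \<Longrightarrow> finite ((\<lambda>A. A \<inter> P) ` \<A>)"
  by (rule finite_subset[of _ "Pow P"]) auto

text \<open>
  The sets \<open>a \<bullet> x > s\<close> are sign patterns of the space spanned by the \<open>p\<close> coordinates and a constant; the factor
  \<open>2\<close> accounts for their complements.
\<close>

lemma card_halfspace_traces:
  fixes P :: "(real ^ 'p) set"
  assumes "finite P"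
  shows "card ((\<lambda>H. H \<inter> P) ` halfspaces) \<le> 2 * (card P + 1) ^ (CARD('p) + 1)"
proof -
  let ?d = "CARD('p)"
  obtain e :: "nat \<Rightarrow> 'p" where e: "bij_betw e {..<?d} UNIV"
    using ex_bij_betw_nat_finite[of "UNIV :: 'p set"] by (auto simp: atLeast0LessThan)
  define \<phi> where "\<phi> = (\<lambda>l (x :: real ^ 'p). if l < ?d then x $ e l else -1)"
  define F where "F = range (\<lambda>c. {x\<in>P. (\<Sum>l<?d + 1. c l * \<phi> l x) > 0})"
  have F: "card F \<le> (card P + 1) ^ (?d + 1)"
    unfolding F_def by (rule card_sign_patterns_le) fact
  have finF: "finite F" unfolding F_def by (rule finite_subset[of _ "Pow P"]) (use assms in auto)
  have gt: "{x. a \<bullet> x > s} \<inter> P \<in> F" for a s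
  proof -
    define c where "c = (\<lambda>l. if l < ?d then a $ e l else s)"
    have "(\<Sum>l<?d + 1. c l * \<phi> l x) = a \<bullet> x - s" for x
    proof -
      have "(\<Sum>l<?d + 1. c l * \<phi> l x) = (\<Sum>l<?d. a $ e l * x $ e l) - s"
        by (simp add: c_def \<phi>_def)
      also have "(\<Sum>l<?d. a $ e l * x $ e l) = (\<Sum>i\<in>UNIV. a $ i * x $ i)"
        by (rule sum.reindex_bij_betw) fact
      finally show ?thesis by (simp add: inner_vec_def)
    qed
    then have "{x. a \<bullet> x > s} \<inter> P = {x\<in>P. (\<Sum>l<?d + 1. c l * \<phi> l x) > 0}" by auto
    then show ?thesis unfolding F_def by blast
  qed
  have "{x. a \<bullet> x \<le> s} \<inter> P = P - ({x. a \<bullet> x > s} \<inter> P)" for a s by auto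
  then have "(\<lambda>H. H \<inter> P) ` halfspaces \<subseteq> F \<union> (\<lambda>A. P - A) ` F"
    using gt unfolding halfspaces_def by auto
  then have "card ((\<lambda>H. H \<inter> P) ` halfspaces) \<le> card (F \<union> (\<lambda>A. P - A) ` F)"
    using finF by (intro card_mono) auto
  also have "\<dots> \<le> card F + card F"
    using finF by (intro order_trans[OF card_Un_le]) (auto intro: card_image_le)
  finally show ?thesis using F by simp
qed

lemma card_cell_traces:
  fixes P :: "(real ^ 'p) set"
  assumes "finite P"
  shows "card ((\<lambda>A. A \<inter> P) ` cells r) \<le> (2 * (card P + 1) ^ (CARD('p) + 1)) ^ r"
proof (induction r)
  case (Suc r)
  have "(\<lambda>A. A \<inter> P) ` cells (Suc r) = (\<lambda>(A, H). A \<inter> H \<inter> P) ` (cells r \<times> halfspaces)"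
    by (simp add: image_image case_prod_unfold)
  also have "card \<dots> \<le> card ((\<lambda>A. A \<inter> P) ` cells r) * card ((\<lambda>H. H \<inter> P) ` halfspaces)"
    using assms by (intro card_image_prod_le finite_traces) (auto 4 3 simp: set_eq_iff)
  also have "\<dots> \<le> (2 * (card P + 1) ^ (CARD('p) + 1)) ^ r * (2 * (card P + 1) ^ (CARD('p) + 1))"
    by (rule mult_mono) (use Suc card_halfspace_traces[OF assms] in auto)
  finally show ?case by (simp add: mult.commute)
qed simp

text \<open>
  Once the traces of the \<open>K\<close> sets on \<open>P\<close> are fixed, the comparisons \<open>f x > g\<close> are sign patterns on \<open>P \<times> G\<close> of
  the space spanned by the \<open>K\<close> indicators and the level \<open>g\<close>. This controls combinations with arbitrarily large
  coefficients.
\<close>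

lemma card_level_patterns_le:
  fixes P :: "'x set" and G :: "real set"
  assumes "finite P" "finite G"
  shows "card ((\<lambda>f. {(x, g). x \<in> P \<and> g \<in> G \<and> f x > g}) ` span_class K \<A>)
          \<le> card ((\<lambda>A. A \<inter> P) ` \<A>) ^ K * (card P * card G + 1) ^ (K + 1)"
proof -
  define T where "T = {..<K} \<rightarrow>\<^sub>E (\<lambda>A. A \<inter> P) ` \<A>"
  define \<phi> where "\<phi> = (\<lambda>\<tau> l (x, g). if l < K then indicator (\<tau> l :: 'x set) x else g :: real)"
  define R where "R = (\<lambda>\<tau>. range (\<lambda>c. {z\<in>P \<times> G. (\<Sum>l<K + 1. c l * \<phi> \<tau> l z) > 0}))"
  have finT: "finite T" unfolding T_def using assms by (intro finite_PiE finite_traces) auto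
  have finR: "finite (R \<tau>)" for \<tau> unfolding R_def by (rule finite_subset[of _ "Pow (P \<times> G)"]) (use assms in auto)
  have "(\<lambda>f. {(x, g). x \<in> P \<and> g \<in> G \<and> f x > g}) ` span_class K \<A> \<subseteq> (\<Union>\<tau>\<in>T. R \<tau>)"
  proof safe
    fix f assume "f \<in> span_class K \<A>"
    then obtain c A where A: "\<And>l. l < K \<Longrightarrow> A l \<in> \<A>" and f: "f = (\<lambda>x. \<Sum>l<K. c l * indicator (A l) x)"
      unfolding span_class_def by blast
    define \<tau> where "\<tau> = (\<lambda>l\<in>{..<K}. A l \<inter> P)"
    define c' where "c' = c(K := -1)"
    have \<tau>: "\<tau> \<in> T" using A by (auto simp: \<tau>_def T_def)
    have "(\<Sum>l<K + 1. c' l * \<phi> \<tau> l (x, g)) = f x - g" if "x \<in> P" for x g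
    proof -
      have "(\<Sum>l<K. c' l * \<phi> \<tau> l (x, g)) = f x"
        unfolding f using that by (intro sum.cong) (auto simp: c'_def \<phi>_def \<tau>_def indicator_def)
      then show ?thesis by (simp add: c'_def \<phi>_def)
    qed
    then have "{(x, g). x \<in> P \<and> g \<in> G \<and> f x > g} = {z\<in>P \<times> G. (\<Sum>l<K + 1. c' l * \<phi> \<tau> l z) > 0}"
      by auto
    then show "{(x, g). x \<in> P \<and> g \<in> G \<and> f x > g} \<in> (\<Union>\<tau>\<in>T. R \<tau>)"
      using \<tau> unfolding R_def by blast
  qed
  then have "card ((\<lambda>f. {(x, g). x \<in> P \<and> g \<in> G \<and> f x > g}) ` span_class K \<A>) \<le> card (\<Union>\<tau>\<in>T. R \<tau>)"
    using finT finR by (intro card_mono) auto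
  also have "\<dots> \<le> (\<Sum>\<tau>\<in>T. card (R \<tau>))" using finT by (rule card_UN_le)
  also have "\<dots> \<le> (\<Sum>\<tau>\<in>T. (card P * card G + 1) ^ (K + 1))"
  proof (rule sum_mono)
    fix \<tau>
    show "card (R \<tau>) \<le> (card P * card G + 1) ^ (K + 1)"
      using card_sign_patterns_le[of "P \<times> G" "\<phi> \<tau>" "K + 1"] assms unfolding R_def card_cartesian_product by simp
  qed
  also have "\<dots> = card ((\<lambda>A. A \<inter> P) ` \<A>) ^ K * (card P * card G + 1) ^ (K + 1)"
    by (simp add: T_def card_PiE)
  finally show ?thesis .
qed

definition levels :: "real \<Rightarrow> nat \<Rightarrow> real set" where
  "levels \<beta> n = (\<lambda>j. - \<beta> + 2 * \<beta> * real j / real n) ` {..n}"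

lemma finite_levels: "finite (levels \<beta> n)" and card_levels_le: "card (levels \<beta> n) \<le> n + 1"
  unfolding levels_def by (auto intro: order_trans[OF card_image_le])

lemma truncate_at_level_less:
  fixes y y' \<beta> :: real
  assumes "\<beta> > 0" "n > 0" and gap: "truncate_at \<beta> y + 2 * \<beta> / real n < truncate_at \<beta> y'"
  shows "\<exists>g\<in>levels \<beta> n. y \<le> g \<and> g < y'"
proof -
  define \<eta> u v where "\<eta> = 2 * \<beta> / real n" and "u = truncate_at \<beta> y" and "v = truncate_at \<beta> y'"
  have \<eta>: "\<eta> > 0" using assms by (simp add: \<eta>_def)
  have u: "- \<beta> \<le> u" and v: "v \<le> \<beta>" using assms(1) by (auto simp: u_def v_def truncate_at_def)
  define j where "j = nat \<lceil>(u + \<beta>) / \<eta>\<rceil>"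
  have j: "real j = of_int \<lceil>(u + \<beta>) / \<eta>\<rceil>" using u \<eta> by (simp add: j_def)
  define g where "g = - \<beta> + \<eta> * real j"
  have "(u + \<beta>) / \<eta> \<le> real j" "real j < (u + \<beta>) / \<eta> + 1" unfolding j by linarith+
  then have "u + \<beta> \<le> \<eta> * real j" "\<eta> * real j < u + \<beta> + \<eta>"
    using \<eta> by (simp_all add: field_simps)
  then have g: "u \<le> g" "g < v" using gap by (auto simp: g_def u_def v_def \<eta>_def)
  have "\<eta> * real j < 2 * \<beta>" using g v by (simp add: g_def)
  then have "real j < real n" using assms by (simp add: \<eta>_def field_simps)
  then have "g \<in> levels \<beta> n" unfolding levels_def g_def \<eta>_def by (intro image_eqI[of _ _ j]) auto
  moreover have "y \<le> g" "g < y'" using g v assms(1)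
    by (auto simp: u_def v_def truncate_at_def max_def min_def split: if_splits)
  ultimately show ?thesis by blast
qed

text \<open>
  Functions that exceed the same levels at the same points differ by at most one mesh width after truncation, so
  one representative per pattern suffices. The net consists of members of the class itself; hence the losses of
  its elements inherit their bounds from the class.
\<close>

lemma truncated_finite_net:
  fixes P :: "'x set"
  assumes "finite P" "\<beta> > 0" "n > 0"
  shows "\<exists>C. finite C \<and> C \<subseteq> span_class K \<A> \<and>
      card C \<le> card ((\<lambda>A. A \<inter> P) ` \<A>) ^ K * (card P * (n + 1) + 1) ^ (K + 1) \<and>
      (\<forall>f\<in>span_class K \<A>. \<exists>g\<in>C. \<forall>x\<in>P. \<bar>truncate_at \<beta> (f x) - truncate_at \<beta> (g x)\<bar> \<le> 2 * \<beta> / real n)"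
proof -
  define pat where "pat = (\<lambda>f. {(x, g). x \<in> P \<and> g \<in> levels \<beta> n \<and> (f :: 'x \<Rightarrow> real) x > g})"
  define F where "F = span_class K \<A>"
  define C where "C = inv_into F pat ` (pat ` F)"
  have finpat: "finite (pat ` F)"
    by (rule finite_subset[of _ "Pow (P \<times> levels \<beta> n)"]) (use assms(1) finite_levels in \<open>auto simp: pat_def\<close>)
  have close: "\<bar>truncate_at \<beta> (f x) - truncate_at \<beta> (g x)\<bar> \<le> 2 * \<beta> / real n"
    if "pat f = pat g" "x \<in> P" for f g x
  proof (rule ccontr)
    assume "\<not> ?thesis"
    then consider "truncate_at \<beta> (f x) + 2 * \<beta> / real n < truncate_at \<beta> (g x)"
      | "truncate_at \<beta> (g x) + 2 * \<beta> / real n < truncate_at \<beta> (f x)" by linarith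
    then show False
    proof cases
      case 1
      then obtain l where "l \<in> levels \<beta> n" "f x \<le> l" "l < g x"
        using truncate_at_level_less assms by blast
      then have "(x, l) \<in> pat g" "(x, l) \<notin> pat f" using that(2) by (auto simp: pat_def)
      then show False using that(1) by simp
    next
      case 2
      then obtain l where "l \<in> levels \<beta> n" "g x \<le> l" "l < f x"
        using truncate_at_level_less assms by blast
      then have "(x, l) \<in> pat f" "(x, l) \<notin> pat g" using that(2) by (auto simp: pat_def)
      then show False using that(1) by simp
    qed
  qed
  have "card C \<le> card (pat ` F)" unfolding C_def by (rule card_image_le) fact
  also have "\<dots> \<le> card ((\<lambda>A. A \<inter> P) ` \<A>) ^ K * (card P * card (levels \<beta> n) + 1) ^ (K + 1)"
    unfolding pat_def F_def by (rule card_level_patterns_le) (use assms finite_levels in auto)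
  also have "\<dots> \<le> card ((\<lambda>A. A \<inter> P) ` \<A>) ^ K * (card P * (n + 1) + 1) ^ (K + 1)"
    using card_levels_le[of \<beta> n] by (intro mult_left_mono power_mono add_right_mono) auto
  finally have "card C \<le> \<dots>" .
  moreover have "finite C" using finpat by (simp add: C_def)
  moreover have "C \<subseteq> F" by (auto simp: C_def inv_into_into)
  moreover have "\<exists>g\<in>C. \<forall>x\<in>P. \<bar>truncate_at \<beta> (f x) - truncate_at \<beta> (g x)\<bar> \<le> 2 * \<beta> / real n"
    if "f \<in> F" for f
  proof
    show "inv_into F pat (pat f) \<in> C" using that by (simp add: C_def)
    have "pat f = pat (inv_into F pat (pat f))" using that by (simp add: f_inv_into_f)
    then show "\<forall>x\<in>P. \<bar>truncate_at \<beta> (f x) - truncate_at \<beta> (inv_into F pat (pat f) x)\<bar> \<le> 2 * \<beta> / real n"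
      using close by blast
  qed
  ultimately show ?thesis unfolding F_def by blast
qed


section \<open>Symmetrization in expectation\<close>

lemma exp_le_quadratic:
  fixes x :: real assumes "x \<le> 1" shows "exp x \<le> 1 + x + x\<^sup>2"
proof (cases "x \<ge> 0")
  case True then show ?thesis using exp_bound[of x] assms by simp
next
  case False
  show ?thesis
  proof (cases "x \<le> -1")
    case True
    have "exp x \<le> 1" using False by simp
    moreover have "0 \<le> - x * (- x - 1)" using True by (intro mult_nonneg_nonneg) auto
    moreover have "- x * (- x - 1) = x + x\<^sup>2" by (simp add: power2_eq_square algebra_simps)
    ultimately show ?thesis by linarith
  next
    case F2: False
    have "exp (-x) \<ge> 1 + - x + (- x)\<^sup>2 / 2" using False by (intro exp_lower_Taylor_quadratic) auto
    moreover have pos: "1 - x + x\<^sup>2 / 2 > 0" using False by (smt (verit) zero_le_power2 divide_nonneg_pos)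
    ultimately have "1 / exp (-x) \<le> 1 / (1 - x + x\<^sup>2 / 2)"
      by (intro divide_left_mono) auto
    then have "exp x \<le> 1 / (1 - x + x\<^sup>2 / 2)"
      by (simp add: exp_minus field_simps)
    also have "\<dots> \<le> 1 + x + x\<^sup>2"
    proof -
      have "(1 + x + x\<^sup>2) * (1 - x + x\<^sup>2 / 2) = 1 + x\<^sup>2 / 2 - x ^ 3 / 2 + x ^ 4 / 2"
        by (simp add: power2_eq_square power3_eq_cube power4_eq_xxxx algebra_simps
            add_divide_distrib diff_divide_distrib)
      moreover have "x ^ 3 \<le> 0" using False by (simp add: power_le_zero_eq)
      ultimately have "(1 + x + x\<^sup>2) * (1 - x + x\<^sup>2 / 2) \<ge> 1"
      proof -
        have "0 \<le> x\<^sup>2" "0 \<le> x ^ 4" by auto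
        with \<open>x ^ 3 \<le> 0\<close> \<open>_ = 1 + x\<^sup>2 / 2 - x ^ 3 / 2 + x ^ 4 / 2\<close> show ?thesis by argo
      qed
      with pos show ?thesis by (simp add: field_simps)
    qed
    finally show ?thesis .
  qed
qed

text \<open>
  The two exponents have the negative mean \<open>- \<kappa> \<epsilon> (u + v) / 2\<close>. Their squares are of order \<open>\<kappa>\<^sup>2 b (u + v)\<close>,
  because \<open>u\<close> and \<open>v\<close> are nonnegative and bounded by \<open>b\<close>, and the choice of \<open>\<kappa>\<close> makes the mean win. This is the
  source of the fast rate.
\<close>

lemma swap_factor_le:
  fixes u v b \<epsilon> :: real
  assumes "0 \<le> u" "u \<le> b" "0 \<le> v" "v \<le> b" "0 < \<epsilon>" "\<epsilon> \<le> 1" "0 < b"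
  defines "\<kappa> \<equiv> \<epsilon> / (6 * b)"
  shows "exp (\<kappa> * (u - (1 + \<epsilon>) * v)) + exp (\<kappa> * (v - (1 + \<epsilon>) * u)) \<le> 2"
proof -
  define l where "l = \<kappa>"
  have l: "l > 0" "l * b = \<epsilon> / 6" using assms by (auto simp: l_def \<kappa>_def)
  define x where "x = u - (1 + \<epsilon>) * v"
  define y where "y = v - (1 + \<epsilon>) * u"
  have v2: "(1 + \<epsilon>) * v \<le> 2 * v" "(1 + \<epsilon>) * u \<le> 2 * u" using assms by (auto intro!: mult_right_mono)
  have v3: "0 \<le> \<epsilon> * v" "0 \<le> \<epsilon> * u" using assms by auto
  have xy: "\<bar>x\<bar> \<le> 2 * b" "\<bar>y\<bar> \<le> 2 * b" "\<bar>x\<bar> + \<bar>y\<bar> \<le> 3 * (u + v)"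
  proof -
    have "x = u - v - \<epsilon> * v" "y = v - u - \<epsilon> * u" "\<epsilon> * v \<le> v" "\<epsilon> * u \<le> u"
      using v2 by (auto simp: x_def y_def algebra_simps)
    with v3 assms(1-4) have *: "\<bar>x\<bar> \<le> 2 * b" "\<bar>y\<bar> \<le> 2 * b" "\<bar>x\<bar> \<le> u + 2 * v" "\<bar>y\<bar> \<le> v + 2 * u"
      by linarith+
    then show "\<bar>x\<bar> \<le> 2 * b" "\<bar>y\<bar> \<le> 2 * b" by auto
    show "\<bar>x\<bar> + \<bar>y\<bar> \<le> 3 * (u + v)" using *(3,4) by argo
  qed
  have "x \<le> b" "y \<le> b" using v3 assms(1-4) unfolding x_def y_def distrib_right by linarith+
  then have "l * x \<le> l * b" "l * y \<le> l * b" using l by auto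
  then have "l * x \<le> 1" "l * y \<le> 1" using l(2) assms(6) by linarith+
  then have expo: "exp (l * x) \<le> 1 + l * x + (l * x)\<^sup>2" "exp (l * y) \<le> 1 + l * y + (l * y)\<^sup>2"
    by (auto intro!: exp_le_quadratic)
  have "x\<^sup>2 \<le> 2 * b * \<bar>x\<bar>" "y\<^sup>2 \<le> 2 * b * \<bar>y\<bar>"
    using xy by (metis abs_ge_zero mult_right_mono power2_abs power2_eq_square)+
  then have "x\<^sup>2 + y\<^sup>2 \<le> 2 * b * (\<bar>x\<bar> + \<bar>y\<bar>)" by (simp add: algebra_simps)
  also have "\<dots> \<le> 2 * b * (3 * (u + v))" using xy(3) assms by (intro mult_left_mono) auto
  also have "2 * b * (3 * (u + v)) = 6 * b * (u + v)" by simp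
  finally have "l\<^sup>2 * (x\<^sup>2 + y\<^sup>2) \<le> l\<^sup>2 * (6 * b * (u + v))"
    by (rule mult_left_mono) simp
  also have "\<dots> = l * (6 * (l * b) * (u + v))" by (simp add: power2_eq_square)
  also have "\<dots> = l * (\<epsilon> * (u + v))" unfolding l(2) by simp
  finally have squares: "(l * x)\<^sup>2 + (l * y)\<^sup>2 \<le> l * (\<epsilon> * (u + v))"
    by (simp add: power_mult_distrib distrib_left)
  have "l * x + l * y = - (l * (\<epsilon> * (u + v)))" by (simp add: x_def y_def algebra_simps)
  with expo squares have "exp (l * x) + exp (l * y) \<le> 2" by linarith
  then show ?thesis by (simp add: x_def y_def l_def)
qed

text \<open>
  Swapping sample and ghost point at random, an exponential moment of the penalized difference is at most \<open>1\<close>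
  for each element of the net (\<open>swap_factor_le\<close>, and the sum over all swaps is a product over the points). The
  function \<open>h \<sigma>\<close> and thus the element of the net close to it may depend on the swap; bounding its exponential by
  the sum over the net, and \<open>ln\<close> by its tangent at \<open>card C\<close>, gives the bound.
\<close>

lemma sum_swaps_le:
  fixes h :: "'i set \<Rightarrow> 'z \<Rightarrow> real" and z z' :: "'i \<Rightarrow> 'z"
  assumes I: "finite I" and C: "finite C"
    and \<epsilon>: "0 < \<epsilon>" "\<epsilon> \<le> 1" and b: "0 < b"
    and g: "\<And>g x. g \<in> C \<Longrightarrow> 0 \<le> g x \<and> g x \<le> b"
    and net: "\<And>\<sigma>. \<sigma> \<subseteq> I \<Longrightarrow> \<exists>g\<in>C. \<forall>i\<in>I. \<bar>h \<sigma> (z i) - g (z i)\<bar> \<le> \<eta> \<and> \<bar>h \<sigma> (z' i) - g (z' i)\<bar> \<le> \<eta>"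
  shows "(\<Sum>\<sigma>\<in>Pow I. \<Sum>i\<in>I. h \<sigma> (if i \<in> \<sigma> then z i else z' i) - (1 + \<epsilon>) * h \<sigma> (if i \<in> \<sigma> then z' i else z i))
     \<le> 2 ^ card I * (6 * b / \<epsilon> * ln (real (card C)) + 3 * \<eta> * real (card I))"
proof -
  define x where "x = (\<lambda>g \<sigma>. \<Sum>i\<in>I. (g (if i \<in> \<sigma> then z i else z' i) - (1 + \<epsilon>) * g (if i \<in> \<sigma> then z' i else z i)) :: real)"
  define l where "l = \<epsilon> / (6 * b)"
  define K where "K = real (card C)"
  have l: "l > 0" using \<epsilon> b by (simp add: l_def)
  have "C \<noteq> {}" using net[of "{}"] by auto
  then have K: "K > 0" using C by (simp add: K_def card_gt_0_iff)
  have expsum: "(\<Sum>\<sigma>\<in>Pow I. exp (l * x g \<sigma>)) \<le> 2 ^ card I" if "g \<in> C" for g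
  proof -
    define p where "p = (\<lambda>i. exp (l * (g (z i) - (1 + \<epsilon>) * g (z' i))))"
    define q where "q = (\<lambda>i. exp (l * (g (z' i) - (1 + \<epsilon>) * g (z i))))"
    have "exp (l * x g \<sigma>) = (\<Prod>i\<in>\<sigma>. p i) * (\<Prod>i\<in>I - \<sigma>. q i)" if \<sigma>: "\<sigma> \<in> Pow I" for \<sigma>
    proof -
      have "exp (l * x g \<sigma>) = (\<Prod>i\<in>I. if i \<in> \<sigma> then p i else q i)"
        unfolding x_def sum_distrib_left using I
        by (simp add: exp_sum p_def q_def if_distrib[of exp] cong: if_cong)
           (intro prod.cong, auto)
      also have "\<dots> = (\<Prod>i\<in>\<sigma>. if i \<in> \<sigma> then p i else q i) * (\<Prod>i\<in>I - \<sigma>. if i \<in> \<sigma> then p i else q i)"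
        using \<sigma> I by (subst prod.subset_diff[of \<sigma> I]) (auto simp: mult.commute)
      also have "\<dots> = (\<Prod>i\<in>\<sigma>. p i) * (\<Prod>i\<in>I - \<sigma>. q i)"
        by (intro arg_cong2[where f="(*)"] prod.cong) auto
      finally show ?thesis .
    qed
    then have "(\<Sum>\<sigma>\<in>Pow I. exp (l * x g \<sigma>)) = (\<Prod>i\<in>I. p i + q i)"
      by (simp add: prod_add[OF I])
    also have "\<dots> \<le> (\<Prod>i\<in>I. 2)"
    proof (intro prod_mono conjI)
      fix i
      show "0 \<le> p i + q i" by (simp add: p_def q_def add_nonneg_nonneg)
      show "p i + q i \<le> 2" unfolding p_def q_def l_def
        by (rule swap_factor_le) (use g[OF \<open>g \<in> C\<close>] \<epsilon> b in auto)
    qed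
    finally show ?thesis by simp
  qed
  have swap_le: "(\<Sum>i\<in>I. h \<sigma> (if i \<in> \<sigma> then z i else z' i) - (1 + \<epsilon>) * h \<sigma> (if i \<in> \<sigma> then z' i else z i))
      \<le> (ln K - 1 + (\<Sum>g\<in>C. exp (l * x g \<sigma>)) / K) / l + 3 * \<eta> * real (card I)" if \<sigma>: "\<sigma> \<in> Pow I" for \<sigma>
  proof -
    obtain g where gC: "g \<in> C" and close: "\<And>i. i \<in> I \<Longrightarrow> \<bar>h \<sigma> (z i) - g (z i)\<bar> \<le> \<eta> \<and> \<bar>h \<sigma> (z' i) - g (z' i)\<bar> \<le> \<eta>"
      using net \<sigma> by blast
    have "(\<Sum>i\<in>I. h \<sigma> (if i \<in> \<sigma> then z i else z' i) - (1 + \<epsilon>) * h \<sigma> (if i \<in> \<sigma> then z' i else z i))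
        \<le> (\<Sum>i\<in>I. (g (if i \<in> \<sigma> then z i else z' i) - (1 + \<epsilon>) * g (if i \<in> \<sigma> then z' i else z i)) + 3 * \<eta>)"
    proof (rule sum_mono)
      fix i assume i: "i \<in> I"
      have *: "a - (1 + \<epsilon>) * c \<le> a' - (1 + \<epsilon>) * c' + 3 * \<eta>" if "\<bar>a - a'\<bar> \<le> \<eta>" "\<bar>c - c'\<bar> \<le> \<eta>" for a a' c c' :: real
      proof -
        have "(1 + \<epsilon>) * (c' - c) \<le> (1 + \<epsilon>) * \<eta>" using that \<epsilon> by (intro mult_left_mono) auto
        also have "\<dots> \<le> 2 * \<eta>" using that \<epsilon> by (intro mult_right_mono) auto
        finally show ?thesis using that by (simp add: algebra_simps)
      qed
      show "h \<sigma> (if i \<in> \<sigma> then z i else z' i) - (1 + \<epsilon>) * h \<sigma> (if i \<in> \<sigma> then z' i else z i) \<le>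
         (g (if i \<in> \<sigma> then z i else z' i) - (1 + \<epsilon>) * g (if i \<in> \<sigma> then z' i else z i)) + 3 * \<eta>"
        by (rule *) (use close[OF i] in auto)
    qed
    also have "\<dots> = x g \<sigma> + 3 * \<eta> * real (card I)"
      by (simp only: sum.distrib sum_constant x_def) simp
    also have "x g \<sigma> \<le> (ln K - 1 + (\<Sum>g\<in>C. exp (l * x g \<sigma>)) / K) / l"
    proof -
      have "exp (l * x g \<sigma>) / K > 0" using K by simp
      then have "ln (exp (l * x g \<sigma>) / K) \<le> exp (l * x g \<sigma>) / K - 1" by (rule ln_le_minus_one)
      then have "l * x g \<sigma> \<le> ln K - 1 + exp (l * x g \<sigma>) / K"
        using K by (simp add: ln_div)
      also have "exp (l * x g \<sigma>) / K \<le> (\<Sum>g\<in>C. exp (l * x g \<sigma>)) / K"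
        using K gC C by (intro divide_right_mono member_le_sum) auto
      finally show ?thesis using l by (simp add: field_simps)
    qed
    finally show ?thesis by simp
  qed
  have "(\<Sum>\<sigma>\<in>Pow I. \<Sum>i\<in>I. h \<sigma> (if i \<in> \<sigma> then z i else z' i) - (1 + \<epsilon>) * h \<sigma> (if i \<in> \<sigma> then z' i else z i))
     \<le> (\<Sum>\<sigma>\<in>Pow I. (ln K - 1 + (\<Sum>g\<in>C. exp (l * x g \<sigma>)) / K) / l + 3 * \<eta> * real (card I))"
    by (rule sum_mono) (rule swap_le)
  also have "\<dots> = (2 ^ card I * (ln K - 1) + (\<Sum>g\<in>C. \<Sum>\<sigma>\<in>Pow I. exp (l * x g \<sigma>)) / K) / l
        + 2 ^ card I * (3 * \<eta> * real (card I))"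
    using I by (subst sum.swap) (simp add: sum.distrib sum_divide_distrib[symmetric] card_Pow)
  also have "(\<Sum>g\<in>C. \<Sum>\<sigma>\<in>Pow I. exp (l * x g \<sigma>)) \<le> (\<Sum>g\<in>C. 2 ^ card I)"
    by (intro sum_mono expsum)
  also have "\<dots> = K * 2 ^ card I" by (simp add: K_def)
  finally have "(\<Sum>\<sigma>\<in>Pow I. \<Sum>i\<in>I. h \<sigma> (if i \<in> \<sigma> then z i else z' i) - (1 + \<epsilon>) * h \<sigma> (if i \<in> \<sigma> then z' i else z i))
     \<le> (2 ^ card I * (ln K - 1) + K * 2 ^ card I / K) / l + 2 ^ card I * (3 * \<eta> * real (card I))"
    using l K by (simp add: divide_right_mono)
  also have "\<dots> = 2 ^ card I * (6 * b / \<epsilon> * ln K + 3 * \<eta> * real (card I))"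
    using K by (simp add: l_def field_simps)
  finally show ?thesis by (simp add: K_def)
qed

lemma integral_PiM_coordinates:
  fixes F :: "('j \<Rightarrow> 'z) \<Rightarrow> real"
  assumes "prob_space \<nu>" and f: "inj_on f J" "f \<in> J \<rightarrow> K" and F: "F \<in> borel_measurable (Pi\<^sub>M J (\<lambda>_. \<nu>))"
  shows "(\<integral>W. F (\<lambda>j\<in>J. W (f j)) \<partial>Pi\<^sub>M K (\<lambda>_. \<nu>)) = (\<integral>D. F D \<partial>Pi\<^sub>M J (\<lambda>_. \<nu>))"
proof -
  have meas: "(\<lambda>W. \<lambda>j\<in>J. W (f j)) \<in> measurable (Pi\<^sub>M K (\<lambda>_. \<nu>)) (Pi\<^sub>M J (\<lambda>_. \<nu>))"
    using f by (intro measurable_restrict measurable_component_singleton) auto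
  have "Pi\<^sub>M J (\<lambda>_. \<nu>) = distr (Pi\<^sub>M K (\<lambda>_. \<nu>)) (Pi\<^sub>M J (\<lambda>_. \<nu>)) (\<lambda>W. \<lambda>j\<in>J. W (f j))"
    using distr_PiM_reindex[of K "\<lambda>_. \<nu>" f J] assms by simp
  then have "(\<integral>D. F D \<partial>Pi\<^sub>M J (\<lambda>_. \<nu>)) =
      (\<integral>D. F D \<partial>distr (Pi\<^sub>M K (\<lambda>_. \<nu>)) (Pi\<^sub>M J (\<lambda>_. \<nu>)) (\<lambda>W. \<lambda>j\<in>J. W (f j)))" by simp
  also have "\<dots> = (\<integral>W. F (\<lambda>j\<in>J. W (f j)) \<partial>Pi\<^sub>M K (\<lambda>_. \<nu>))"
    by (rule integral_distr[OF meas F])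
  finally show ?thesis by simp
qed

text \<open>
  The risk at an independent point is the mean of the losses at the points of a ghost sample. The joint law of
  both samples does not change when points are exchanged between them, so the difference of the two averages may
  be averaged over all exchanges; \<open>W (False, i)\<close> and \<open>W (True, i)\<close> are the two \<open>i\<close>-th points, and \<open>\<sigma>\<close> selects
  the exchanged ones.
\<close>

lemma expected_risk_le_empirical:
  fixes h :: "(nat \<Rightarrow> 'z) \<Rightarrow> 'z \<Rightarrow> real"
  assumes \<nu>: "prob_space \<nu>" and n: "n \<ge> 1"
    and h: "(\<lambda>(D, z). h D z) \<in> borel_measurable (Pi\<^sub>M {..<n} (\<lambda>_. \<nu>) \<Otimes>\<^sub>M \<nu>)"
    and bound: "\<And>D z. 0 \<le> h D z \<and> h D z \<le> b"
    and swaps: "\<And>W. (\<Sum>\<sigma>\<in>Pow {..<n}. \<Sum>i<n. h (\<lambda>j\<in>{..<n}. W (j \<in> \<sigma>, j)) (W (i \<notin> \<sigma>, i))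
          - (1 + \<epsilon>) * h (\<lambda>j\<in>{..<n}. W (j \<in> \<sigma>, j)) (W (i \<in> \<sigma>, i))) \<le> 2 ^ n * K"
  shows "(\<integral>D. (\<integral>z. h D z \<partial>\<nu>) \<partial>Pi\<^sub>M {..<n} (\<lambda>_. \<nu>))
     \<le> (1 + \<epsilon>) * (\<integral>D. (\<Sum>i<n. h D (D i)) / n \<partial>Pi\<^sub>M {..<n} (\<lambda>_. \<nu>)) + K / n"
proof -
  interpret \<nu>: prob_space \<nu> by fact
  let ?P = "Pi\<^sub>M {..<n} (\<lambda>_. \<nu>)"
  let ?W = "Pi\<^sub>M (UNIV \<times> {..<n}) (\<lambda>_. \<nu>) :: (bool \<times> nat \<Rightarrow> 'z) measure"
  interpret P: prob_space ?P by (intro prob_space_PiM) (rule \<nu>)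
  interpret W: prob_space ?W by (intro prob_space_PiM) (rule \<nu>)
  interpret ps: product_prob_space "\<lambda>_. \<nu>" UNIV by standard
  define A where "A = (\<integral>D. (\<integral>z. h D z \<partial>\<nu>) \<partial>?P)"
  define B where "B i = (\<integral>D. h D (D i) \<partial>?P)" for i
  have hcomp: "(\<lambda>x. h (F x) (G x)) \<in> borel_measurable N" if "F \<in> measurable N ?P" "G \<in> measurable N \<nu>" for F G
      and N :: "'n measure"
    using measurable_compose[OF measurable_Pair[OF that] h] by simp
  have intW: "integrable ?W F" if "F \<in> borel_measurable ?W" "\<And>x. 0 \<le> F x \<and> F x \<le> b" for F
    using that by (intro W.integrable_const_bound[where B=b]) auto
  have intP: "integrable ?P F" if "F \<in> borel_measurable ?P" "\<And>x. 0 \<le> F x \<and> F x \<le> b" for F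
    using that by (intro P.integrable_const_bound[where B=b]) auto
  have Dm: "(\<lambda>W. \<lambda>j\<in>{..<n}. W (j \<in> \<sigma>, j)) \<in> measurable ?W ?P" for \<sigma>
    by (intro measurable_restrict measurable_component_singleton) auto
  have ghost: "(\<integral>W. h (\<lambda>j\<in>{..<n}. W (j \<in> \<sigma>, j)) (W (i \<notin> \<sigma>, i)) \<partial>?W) = A" if i: "i < n" for \<sigma> i
  proof -
    \<comment> \<open>the sample after the exchange, extended by the \<open>i\<close>-th ghost point as an additional coordinate \<open>n\<close>\<close>
    define f where "f j = (if j < n then (j \<in> \<sigma>, j) else (i \<notin> \<sigma>, i))" for j
    define F where "F = (\<lambda>D. h (restrict D {..<n}) (D n))"
    have Fm: "F \<in> borel_measurable (Pi\<^sub>M {..<Suc n} (\<lambda>_. \<nu>))"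
      unfolding F_def by (intro hcomp measurable_restrict_subset measurable_component_singleton) auto
    have "(\<integral>W. F (\<lambda>j\<in>{..<Suc n}. W (f j)) \<partial>?W) = (\<integral>D. F D \<partial>Pi\<^sub>M {..<Suc n} (\<lambda>_. \<nu>))"
      using i by (intro integral_PiM_coordinates \<nu> Fm) (auto simp: f_def inj_on_def less_Suc_eq)
    also have "\<dots> = (\<integral>D. F D \<partial>Pi\<^sub>M (insert n {..<n}) (\<lambda>_. \<nu>))" by (simp add: lessThan_Suc)
    also have "\<dots> = (\<integral>D. (\<integral>z. F (D(n := z)) \<partial>\<nu>) \<partial>?P)"
    proof (rule ps.product_integral_insert)
      interpret S: prob_space "Pi\<^sub>M (insert n {..<n}) (\<lambda>_. \<nu>)" by (intro prob_space_PiM) (rule \<nu>)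
      show "integrable (Pi\<^sub>M (insert n {..<n}) (\<lambda>_. \<nu>)) F"
        using Fm bound by (intro S.integrable_const_bound[where B=b]) (auto simp: F_def lessThan_Suc)
    qed auto
    also have "\<dots> = A"
      unfolding A_def
    proof (intro Bochner_Integration.integral_cong refl)
      fix D z assume "D \<in> space ?P"
      then have "restrict (D(n := z)) {..<n} = D" by (auto simp: space_PiM PiE_def extensional_def restrict_def)
      then show "F (D(n := z)) = h D z" by (simp add: F_def)
    qed
    also have "(\<integral>W. F (\<lambda>j\<in>{..<Suc n}. W (f j)) \<partial>?W) = (\<integral>W. h (\<lambda>j\<in>{..<n}. W (j \<in> \<sigma>, j)) (W (i \<notin> \<sigma>, i)) \<partial>?W)"
    proof (intro Bochner_Integration.integral_cong refl)
      fix W :: "bool \<times> nat \<Rightarrow> 'z"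
      have "restrict (\<lambda>j\<in>{..<Suc n}. W (f j)) {..<n} = (\<lambda>j\<in>{..<n}. W (j \<in> \<sigma>, j))"
        by (auto simp: f_def)
      then show "F (\<lambda>j\<in>{..<Suc n}. W (f j)) = h (\<lambda>j\<in>{..<n}. W (j \<in> \<sigma>, j)) (W (i \<notin> \<sigma>, i))"
        by (simp add: F_def f_def)
    qed
    finally show ?thesis .
  qed
  have hDm: "(\<lambda>D. h D (D i)) \<in> borel_measurable ?P" if "i < n" for i
    using that by (intro hcomp measurable_ident_sets refl measurable_component_singleton) auto
  have sample: "(\<integral>W. h (\<lambda>j\<in>{..<n}. W (j \<in> \<sigma>, j)) (W (i \<in> \<sigma>, i)) \<partial>?W) = B i" if i: "i < n" for \<sigma> i
  proof -
    have "(\<integral>W. (\<lambda>D. h D (D i)) (\<lambda>j\<in>{..<n}. W ((\<lambda>j. (j \<in> \<sigma>, j)) j)) \<partial>?W) = (\<integral>D. h D (D i) \<partial>?P)"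
      using i by (intro integral_PiM_coordinates[where f = "\<lambda>j. (j \<in> \<sigma>, j)"] \<nu> hDm) (auto simp: inj_on_def)
    then show ?thesis using i by (simp add: B_def)
  qed
  have i1: "integrable ?W (\<lambda>W. h (\<lambda>j\<in>{..<n}. W (j \<in> \<sigma>, j)) (W (i \<notin> \<sigma>, i)))" if "i < n" for \<sigma> i
    by (intro intW hcomp Dm measurable_component_singleton bound) (use that in auto)
  have i2: "integrable ?W (\<lambda>W. h (\<lambda>j\<in>{..<n}. W (j \<in> \<sigma>, j)) (W (i \<in> \<sigma>, i)))" if "i < n" for \<sigma> i
    by (intro intW hcomp Dm measurable_component_singleton bound) (use that in auto)
  have "2 ^ n * (n * A - (1 + \<epsilon>) * (\<Sum>i<n. B i))
     = (\<Sum>\<sigma>\<in>Pow {..<n}. \<Sum>i<n. A - (1 + \<epsilon>) * B i)"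
    by (simp add: sum_subtractf sum_distrib_left card_Pow)
  also have "\<dots> = (\<Sum>\<sigma>\<in>Pow {..<n}. \<Sum>i<n. \<integral>W. h (\<lambda>j\<in>{..<n}. W (j \<in> \<sigma>, j)) (W (i \<notin> \<sigma>, i))
          - (1 + \<epsilon>) * h (\<lambda>j\<in>{..<n}. W (j \<in> \<sigma>, j)) (W (i \<in> \<sigma>, i)) \<partial>?W)"
    using i1 i2 ghost sample by (intro sum.cong refl) (simp add: Bochner_Integration.integral_diff)
  also have "\<dots> = (\<integral>W. (\<Sum>\<sigma>\<in>Pow {..<n}. \<Sum>i<n. h (\<lambda>j\<in>{..<n}. W (j \<in> \<sigma>, j)) (W (i \<notin> \<sigma>, i))
          - (1 + \<epsilon>) * h (\<lambda>j\<in>{..<n}. W (j \<in> \<sigma>, j)) (W (i \<in> \<sigma>, i))) \<partial>?W)"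
    using i1 i2 by (subst Bochner_Integration.integral_sum; (intro Bochner_Integration.integrable_sum
        Bochner_Integration.integrable_diff integrable_mult_right)?; simp?)
  also have "\<dots> \<le> (\<integral>W. 2 ^ n * K \<partial>?W)"
    using i1 i2 swaps by (intro integral_mono Bochner_Integration.integrable_sum
        Bochner_Integration.integrable_diff integrable_mult_right) auto
  also have "\<dots> = 2 ^ n * K" by (simp add: W.prob_space)
  finally have "n * A - (1 + \<epsilon>) * (\<Sum>i<n. B i) \<le> K" by simp
  then have "A \<le> (1 + \<epsilon>) * ((\<Sum>i<n. B i) / n) + K / n" using n by (simp add: field_simps)
  also have "(\<Sum>i<n. B i) / n = (\<integral>D. (\<Sum>i<n. h D (D i)) / n \<partial>?P)"
  proof -
    have "(\<integral>D. (\<Sum>i<n. h D (D i)) \<partial>?P) = (\<Sum>i<n. B i)"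
      unfolding B_def by (rule Bochner_Integration.integral_sum) (intro intP hDm bound, simp)
    then show ?thesis by simp
  qed
  finally show ?thesis by (simp add: A_def)
qed


section \<open>Trees as combinations of cell indicators\<close>

lemma daughters_Un_Int:
  "daughter_le A S z \<union> daughter_gt A S z = A" "daughter_le A S z \<inter> daughter_gt A S z = {}"
  by (auto simp: daughter_le_def daughter_gt_def split: prod.splits)

text \<open>
  The leaves evolve only by replacing a node with its two daughters. So a node functional that does not increase
  under a split has a nonincreasing sum over the leaves, whatever splits are chosen. This is applied to sums of
  squares and, in both directions, to indicators.
\<close>

lemma split_layer_sum_le:
  fixes F :: "('p::finite) node \<Rightarrow> real"
  assumes "\<And>A S z. F (daughter_le A S z) + F (daughter_gt A S z) \<le> F A"
  shows "sum_list (map F (split_layer sel t n D \<S> cur later)) \<le> sum_list (map F later) + sum_list (map F cur)"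
proof (induction cur arbitrary: later)
  case (Cons A cur)
  show ?case
  proof (cases "length later + length (A # cur) \<ge> t \<or> node_count n D A \<le> 1")
    case True
    then show ?thesis using Cons[of "later @ [A]"] by (auto simp: Let_def)
  next
    case False
    define S where "S = \<S> (length later + length (A # cur))"
    define z where "z = sel n D A S"
    have "split_layer sel t n D \<S> (A # cur) later = split_layer sel t n D \<S> cur (later @ [daughter_le A S z,
        daughter_gt A S z])"
      using False by (simp add: Let_def S_def z_def)
    then show ?thesis
      using Cons[of "later @ [daughter_le A S z, daughter_gt A S z]"] assms[of A S z] by simp
  qed
qed simp

lemma layers_sum_le:
  fixes F :: "('p::finite) node \<Rightarrow> real"
  assumes "\<And>A S z. F (daughter_le A S z) + F (daughter_gt A S z) \<le> F A"
  shows "sum_list (map F (((\<lambda>layer. split_layer sel t n D \<S> layer []) ^^ r) L)) \<le> sum_list (map F L)"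
proof (induction r)
  case (Suc r)
  then show ?case
    using split_layer_sum_le[of F sel t n D \<S> "((\<lambda>layer. split_layer sel t n D \<S> layer []) ^^ r) L" "[]", OF
        assms] by simp
qed simp

lemma odt_leaves_sum_eq:
  fixes F :: "('p::finite) node \<Rightarrow> real"
  assumes "\<And>A S z. F (daughter_le A S z) + F (daughter_gt A S z) = F A"
  shows "sum_list (map F (odt_leaves sel t n D \<S>)) = F (cbox 0 1)"
proof (rule antisym)
  show "sum_list (map F (odt_leaves sel t n D \<S>)) \<le> F (cbox 0 1)"
    using layers_sum_le[where F=F and r="t - 1" and L="[cbox 0 1]"] assms by (simp add: odt_leaves_def)
  have "sum_list (map (\<lambda>A. - F A) (odt_leaves sel t n D \<S>)) \<le> - F (cbox 0 1)"
  proof -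
    have "- F (daughter_le A S z) + - F (daughter_gt A S z) \<le> - F A" for A S z
      using assms[of A S z] by linarith
    from layers_sum_le[where F="\<lambda>A. - F A" and r="t - 1" and L="[cbox 0 1]", OF this]
    show ?thesis by (simp add: odt_leaves_def)
  qed
  then show "F (cbox 0 1) \<le> sum_list (map F (odt_leaves sel t n D \<S>))"
    by (simp add: uminus_sum_list_map[symmetric, unfolded o_def])
qed

lemma leaf_indicator_sum:
  "(\<Sum>A\<leftarrow>odt_leaves sel t n D \<S>. indicator A x :: real) = indicator (cbox 0 1) x"
  by (rule odt_leaves_sum_eq)
     (use daughters_Un_Int in \<open>auto simp: indicator_def daughter_le_def daughter_gt_def split: prod.splits\<close>)

text \<open>
  The search for the leaf containing \<open>x\<close> becomes a sum, because at most one entry of the list contains \<open>x\<close>.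
\<close>

lemma find_disjoint_eq_sum:
  fixes g :: "'x set \<Rightarrow> real"
  assumes "(\<Sum>A\<leftarrow>L. indicator A x :: real) \<le> 1"
  shows "(case find (\<lambda>A. x \<in> A) L of Some A \<Rightarrow> g A | None \<Rightarrow> 0) = (\<Sum>A\<leftarrow>L. g A * indicator A x)"
  using assms
proof (induction L)
  case (Cons A L)
  have nn: "(\<Sum>A\<leftarrow>L. indicator A x :: real) \<ge> 0" by (intro sum_list_nonneg) auto
  show ?case
  proof (cases "x \<in> A")
    case True
    then have "(\<Sum>A\<leftarrow>L. indicator A x :: real) \<le> 0" using Cons.prems by simp
    with nn have "(\<Sum>A\<leftarrow>L. indicator A x :: real) = 0" by simp
    then have "\<forall>A\<in>set L. indicator A x = (0::real)"
      by (subst (asm) sum_list_nonneg_eq_0_iff) auto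
    then have "map (\<lambda>A. g A * indicator A x) L = map (\<lambda>_. 0) L" by simp
    then have "(\<Sum>A\<leftarrow>L. g A * indicator A x) = 0" by (simp only: sum_list_0)
    then show ?thesis using True by simp
  next
    case False
    then show ?thesis using Cons by simp
  qed
qed simp

lemma odt_estimator_eq_sum:
  "odt_estimator sel t n D \<S> x = (\<Sum>A\<leftarrow>odt_leaves sel t n D \<S>. node_mean n D A * indicator A x)"
  unfolding odt_estimator_def
  by (rule find_disjoint_eq_sum) (unfold leaf_indicator_sum, simp add: indicator_def)

lemma whole_space_halfspace: "UNIV \<in> halfspaces"
proof -
  have "(UNIV :: (real ^ 'p) set) = {x. 0 \<bullet> x \<le> (0::real)}" by auto
  then show ?thesis unfolding halfspaces_def by blast
qed

lemma cells_Suc_mono: "A \<in> cells r \<Longrightarrow> A \<in> cells (Suc r)"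
  using whole_space_halfspace by (force intro: image_eqI[of _ _ "(A, UNIV)"])

lemma daughters_in_cells:
  assumes "A \<in> cells r"
  shows "daughter_le A S z \<in> cells (Suc r)" "daughter_gt A S z \<in> cells (Suc r)"
proof -
  obtain \<theta> s where z: "z = (\<theta>, s)" by (cases z)
  define a where "a = (\<chi> i. if i \<in> S then \<theta> i else 0)"
  have a: "a \<bullet> x = (\<Sum>i\<in>S. \<theta> i * x $ i)" for x
    unfolding a_def inner_vec_def by (simp add: if_distrib[of "\<lambda>y. y * _"] sum.If_cases cong: if_cong)
  have "daughter_le A S z = A \<inter> {x. a \<bullet> x \<le> s}" "daughter_gt A S z = A \<inter> {x. a \<bullet> x > s}"
    by (auto simp: daughter_le_def daughter_gt_def z a)
  moreover have "{x. a \<bullet> x \<le> s} \<in> halfspaces" "{x. a \<bullet> x > s} \<in> halfspaces"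
    unfolding halfspaces_def by blast+
  ultimately show "daughter_le A S z \<in> cells (Suc r)" "daughter_gt A S z \<in> cells (Suc r)"
    using assms unfolding cells.simps by (force intro: image_eqI)+
qed

lemma split_layer_in_cells:
  assumes "set later \<subseteq> cells (Suc r)" "set cur \<subseteq> cells r"
  shows "set (split_layer sel t n D \<S> cur later) \<subseteq> cells (Suc r)"
  using assms
proof (induction cur arbitrary: later)
  case (Cons A cur)
  define S where "S = \<S> (length later + length (A # cur))"
  define z where "z = sel n D A S"
  have "set (later @ [A]) \<subseteq> cells (Suc r)" "set (later @ [daughter_le A S z, daughter_gt A S z]) \<subseteq> cells (Suc r)"
    using Cons.prems cells_Suc_mono daughters_in_cells[of A r] by auto
  then have "set (split_layer sel t n D \<S> cur (later @ [A])) \<subseteq> cells (Suc r)"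
     "set (split_layer sel t n D \<S> cur (later @ [daughter_le A S z, daughter_gt A S z])) \<subseteq> cells (Suc r)"
    using Cons.prems Cons.IH by (meson list.set_intros(2) order_trans set_subset_Cons)+
  then show ?case by (simp add: Let_def S_def z_def del: cells.simps)
qed simp

lemma odt_leaves_in_cells: "set (odt_leaves sel t n D \<S>) \<subseteq> cells (t - 1)"
proof -
  have "set (((\<lambda>layer. split_layer sel t n D \<S> layer []) ^^ r) [cbox 0 1]) \<subseteq> cells r" for r
  proof (induction r)
    case (Suc r)
    then show ?case by (simp del: cells.simps add: split_layer_in_cells)
  qed simp
  then show ?thesis by (simp add: odt_leaves_def)
qed

lemma span_class_intro:
  "(\<And>l. l < K \<Longrightarrow> A l \<in> \<A>) \<Longrightarrow> (\<lambda>x. \<Sum>l<K. c l * indicator (A l) x) \<in> span_class K \<A>"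
  unfolding span_class_def by blast

lemma span_class_add:
  assumes "f \<in> span_class K \<A>" "g \<in> span_class L \<A>"
  shows "(\<lambda>x. f x + g x) \<in> span_class (K + L) \<A>"
proof -
  obtain c A d B where f: "f = (\<lambda>x. \<Sum>l<K. c l * indicator (A l) x)" "\<And>l. l < K \<Longrightarrow> A l \<in> \<A>"
    and g: "g = (\<lambda>x. \<Sum>l<L. d l * indicator (B l) x)" "\<And>l. l < L \<Longrightarrow> B l \<in> \<A>"
    using assms unfolding span_class_def by auto
  define e where "e l = (if l < K then c l else d (l - K))" for l
  define E where "E l = (if l < K then A l else B (l - K))" for l
  have "(\<Sum>l<K + L. e l * indicator (E l) x) = f x + g x" for x
  proof -
    have "(\<Sum>l<K + L. e l * indicator (E l) x) = (\<Sum>l<K. e l * indicator (E l) x) + (\<Sum>l<L. e (K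
        + l) * indicator (E (K + l)) x)"
      by (induction L) (simp_all only: add_0_right add_Suc_right sum.lessThan_Suc lessThan_0 sum.empty add.assoc)
    then show ?thesis by (simp add: e_def E_def f(1) g(1))
  qed
  then have eq: "(\<lambda>x. f x + g x) = (\<lambda>x. \<Sum>l<K + L. e l * indicator (E l) x)" by (intro ext) (rule sym)
  show ?thesis unfolding eq by (rule span_class_intro) (auto simp: E_def f(2) g(2))
qed

lemma span_class_cmult:
  assumes "f \<in> span_class K \<A>"
  shows "(\<lambda>x. a * f x) \<in> span_class K \<A>"
proof -
  obtain c A where f: "f = (\<lambda>x. \<Sum>l<K. c l * indicator (A l) x)" "\<And>l. l < K \<Longrightarrow> A l \<in> \<A>"
    using assms unfolding span_class_def by auto
  have eq: "(\<lambda>x. a * f x) = (\<lambda>x. \<Sum>l<K. (a * c l) * indicator (A l) x)"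
    unfolding f(1) sum_distrib_left mult.assoc ..
  show ?thesis unfolding eq by (rule span_class_intro) (rule f(2))
qed

lemma odt_estimator_in_span_class:
  assumes "t \<ge> 1"
  shows "odt_estimator sel t n D \<S> \<in> span_class t (cells (t - 1))"
proof -
  define L where "L = odt_leaves sel t n D \<S>"
  have len: "length L \<le> t"
    using odt_leaves_complete[OF assms, of sel n D \<S>] by (auto simp: L_def)
  have ne: "L \<noteq> []"
    using leaf_indicator_sum[where x=0 and sel=sel and t=t and n=n and D=D and \<S>=\<S>]
    by (auto simp: L_def mem_box_cart indicator_def)
  define A where "A l = (if l < length L then L ! l else hd L)" for l
  define c where "c l = (if l < length L then node_mean n D (L ! l) else 0)" for l
  have A: "A l \<in> cells (t - 1)" for l
    using odt_leaves_in_cells[of sel t n D \<S>] ne unfolding A_def L_def[symmetric]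
    by (auto simp: subset_iff)
  have "odt_estimator sel t n D \<S> x = (\<Sum>l<t. c l * indicator (A l) x)" for x
  proof -
    have "odt_estimator sel t n D \<S> x = (\<Sum>l<length L. node_mean n D (L ! l) * indicator (L ! l) x)"
      unfolding odt_estimator_eq_sum L_def[symmetric]
      by (simp add: sum_list_sum_nth lessThan_atLeast0)
    also have "\<dots> = (\<Sum>l<length L. c l * indicator (A l) x)" by (simp add: A_def c_def)
    also have "\<dots> = (\<Sum>l<t. c l * indicator (A l) x)"
      using len by (intro sum.mono_neutral_left) (auto simp: c_def)
    finally show ?thesis .
  qed
  then have eq: "odt_estimator sel t n D \<S> = (\<lambda>x. \<Sum>l<t. c l * indicator (A l) x)" by (rule ext)
  show ?thesis unfolding eq by (rule span_class_intro) (rule A)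
qed

lemma length_boost_trees: "length (boost_trees sel coef t n D \<S> j) = j"
  by (induction j) (auto simp: Let_def)

lemma linear_combination_append1:
  "linear_combination a (fs @ [f]) x = linear_combination a fs x + a (length fs) * f x"
  by (simp add: linear_combination_def nth_append)

lemma linear_combination_in_span_class:
  assumes "\<forall>f\<in>set fs. f \<in> span_class t \<A>"
  shows "linear_combination a fs \<in> span_class (length fs * t) \<A>"
  using assms
proof (induction fs rule: rev_induct)
  case Nil
  then show ?case by (auto simp: linear_combination_def span_class_def)
next
  case (snoc f fs)
  then have "(\<lambda>x. linear_combination a fs x + a (length fs) * f x) \<in> span_class (length fs * t + t) \<A>"
    by (intro span_class_add span_class_cmult) auto
  moreover have "linear_combination a (fs @ [f]) = (\<lambda>x. linear_combination a fs x + a (length fs) * f x)"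
    by (rule ext) (rule linear_combination_append1)
  ultimately show ?case by (simp add: add.commute)
qed

lemma boost_estimator_in_span_class:
  assumes "t \<ge> 1"
  shows "boost_estimator sel coef t n D \<S> k \<in> span_class (k * t) (cells (t - 1))"
proof -
  have "\<forall>f\<in>set (boost_trees sel coef t n D \<S> j). f \<in> span_class t (cells (t - 1))" for j
    by (induction j) (use odt_estimator_in_span_class[OF assms] in \<open>auto simp: Let_def\<close>)
  then show ?thesis
    using linear_combination_in_span_class[of "boost_trees sel coef t n D \<S> k" t "cells (t - 1)"]
    by (simp add: boost_estimator_def boost_fit_def length_boost_trees)
qed


section \<open>Training error of boosting\<close>

lemma finite_node_idx [simp]: "finite (node_idx n D A)"
  by (simp add: node_idx_def)

lemma node_sse_eq: "node_sse n D A = (\<Sum>i\<in>node_idx n D A. (snd (D i))\<^sup>2)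
    - (\<Sum>i\<in>node_idx n D A. snd (D i))\<^sup>2 / node_count n D A"
proof (cases "node_count n D A = 0")
  case True
  then have "node_idx n D A = {}" by (simp add: node_count_def)
  then show ?thesis by (simp add: node_sse_def)
next
  case False
  define I where "I = node_idx n D A"
  define S where "S = (\<Sum>i\<in>I. snd (D i))"
  define N where "N = real (node_count n D A)"
  have N: "N > 0" "N = card I" using False by (auto simp: N_def node_count_def I_def)
  have "node_sse n D A = (\<Sum>i\<in>I. (snd (D i))\<^sup>2 - 2 * (S / N) * snd (D i) + (S / N)\<^sup>2)"
    unfolding node_sse_def node_mean_def I_def[symmetric] S_def[symmetric] N_def[symmetric]
    by (intro sum.cong) (auto simp: power2_eq_square algebra_simps)
  also have "\<dots> = (\<Sum>i\<in>I. (snd (D i))\<^sup>2) - 2 * (S / N) * S + N * (S / N)\<^sup>2"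
    by (simp only: sum.distrib sum_subtractf sum_distrib_left[symmetric] sum_constant S_def[symmetric] N(2))
  also have "\<dots> = (\<Sum>i\<in>I. (snd (D i))\<^sup>2) - S\<^sup>2 / N" using N by (simp add: power2_eq_square field_simps)
  finally show ?thesis by (simp add: I_def S_def N_def)
qed

lemma node_sse_le: "node_sse n D A \<le> (\<Sum>i\<in>node_idx n D A. (snd (D i) - c)\<^sup>2)"
proof -
  define I where "I = node_idx n D A"
  define \<mu> where "\<mu> = node_mean n D A"
  have 0: "(\<Sum>i\<in>I. snd (D i) - \<mu>) = 0"
  proof (cases "card I = 0")
    case True
    then show ?thesis by (simp add: I_def)
  next
    case False
    then have "(\<Sum>i\<in>I. snd (D i)) = card I * \<mu>"
      by (simp add: \<mu>_def node_mean_def node_count_def I_def)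
    then show ?thesis by (simp add: sum_subtractf)
  qed
  have "(\<Sum>i\<in>I. (snd (D i) - c)\<^sup>2) = (\<Sum>i\<in>I. (snd (D i) - \<mu>)\<^sup>2 + 2 * (\<mu> - c) * (snd (D i) - \<mu>) + (\<mu> - c)\<^sup>2)"
    by (intro sum.cong) (auto simp: power2_eq_square algebra_simps)
  also have "\<dots> = (\<Sum>i\<in>I. (snd (D i) - \<mu>)\<^sup>2) + 2 * (\<mu> - c) * (\<Sum>i\<in>I. snd (D i) - \<mu>) + card I * (\<mu> - c)\<^sup>2"
    by (simp only: sum.distrib sum_distrib_left sum_constant)
  finally show ?thesis unfolding 0 by (simp add: node_sse_def I_def \<mu>_def)
qed

lemma sum_node_idx_daughters:
  "(\<Sum>i\<in>node_idx n D (daughter_le A S z). h i) + (\<Sum>i\<in>node_idx n D (daughter_gt A S z). h i) = (\<Sum>i\<in>node_idx n D A. h i)"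
proof -
  have "node_idx n D A = node_idx n D (daughter_le A S z) \<union> node_idx n D (daughter_gt A S z)"
    "node_idx n D (daughter_le A S z) \<inter> node_idx n D (daughter_gt A S z) = {}"
    using daughters_Un_Int[of A S z] by (auto simp: node_idx_def)
  then show ?thesis by (metis finite_node_idx sum.union_disjoint)
qed

lemma node_sse_daughters_le:
  "node_sse n D (daughter_le A S z) + node_sse n D (daughter_gt A S z) \<le> node_sse n D A"
proof -
  let ?c = "node_mean n D A"
  have "node_sse n D (daughter_le A S z) + node_sse n D (daughter_gt A S z)
     \<le> (\<Sum>i\<in>node_idx n D (daughter_le A S z). (snd (D i) - ?c)\<^sup>2)
         + (\<Sum>i\<in>node_idx n D (daughter_gt A S z). (snd (D i) - ?c)\<^sup>2)"
    by (intro add_mono node_sse_le)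
  then show ?thesis by (simp only: sum_node_idx_daughters node_sse_def[of n D A])
qed

lemma sum_sum_list_swap:
  fixes g :: "'i \<Rightarrow> 'b \<Rightarrow> real"
  shows "(\<Sum>i\<in>I. \<Sum>A\<leftarrow>L. g i A) = (\<Sum>A\<leftarrow>L. \<Sum>i\<in>I. g i A)"
  by (induction L) (auto simp: sum.distrib)

lemma tree_residual_sum_eq:
  assumes cube: "\<And>i. i < n \<Longrightarrow> fst (D i) \<in> cbox 0 1"
  shows "(\<Sum>i<n. (snd (D i) - odt_estimator sel t n D \<S> (fst (D i)))\<^sup>2)
      = (\<Sum>A\<leftarrow>odt_leaves sel t n D \<S>. node_sse n D A)"
proof -
  define L where "L = odt_leaves sel t n D \<S>"
  have pt: "(snd (D i) - odt_estimator sel t n D \<S> (fst (D i)))\<^sup>2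
      = (\<Sum>A\<leftarrow>L. (snd (D i) - node_mean n D A)\<^sup>2 * indicator A (fst (D i)))" if i: "i < n" for i
  proof -
    have s: "(\<Sum>A\<leftarrow>L. indicator A (fst (D i)) :: real) = 1"
      using cube[OF i] unfolding L_def leaf_indicator_sum by simp
    then have eq: "(case find (\<lambda>A. fst (D i) \<in> A) L of Some A \<Rightarrow> (snd (D i) - node_mean n D A)\<^sup>2 | None \<Rightarrow> 0)
       = (\<Sum>A\<leftarrow>L. (snd (D i) - node_mean n D A)\<^sup>2 * indicator A (fst (D i)))"
      by (intro find_disjoint_eq_sum) simp
    have "find (\<lambda>A. fst (D i) \<in> A) L \<noteq> None"
    proof
      assume "find (\<lambda>A. fst (D i) \<in> A) L = None"
      then have "map (\<lambda>A. indicator A (fst (D i)) :: real) L = map (\<lambda>_. 0) L"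
        by (auto simp: find_None_iff)
      then have "(\<Sum>A\<leftarrow>L. indicator A (fst (D i)) :: real) = 0" by (simp only: sum_list_0)
      with s show False by simp
    qed
    with eq show ?thesis by (auto simp: odt_estimator_def L_def[symmetric])
  qed
  have "(\<Sum>i<n. (snd (D i) - odt_estimator sel t n D \<S> (fst (D i)))\<^sup>2)
      = (\<Sum>A\<leftarrow>L. \<Sum>i<n. (snd (D i) - node_mean n D A)\<^sup>2 * indicator A (fst (D i)))"
    unfolding sum_sum_list_swap[symmetric] by (intro sum.cong refl) (simp only: pt lessThan_iff)
  also have "(\<lambda>A. \<Sum>i<n. (snd (D i) - node_mean n D A)\<^sup>2 * indicator A (fst (D i))) = node_sse n D"
  proof
    fix A
    show "(\<Sum>i<n. (snd (D i) - node_mean n D A)\<^sup>2 * indicator A (fst (D i))) = node_sse n D A"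
      unfolding node_sse_def node_idx_def
      by (intro sum.mono_neutral_cong_right) (auto simp: indicator_def)
  qed
  finally show ?thesis by (simp add: L_def)
qed

text \<open>
  The first split acts on the whole cube and uses \<open>\<S> 1\<close>; all later splits can only lower the sum of squares
  further.
\<close>

lemma first_split_optimal:
  assumes "optimal_split_rule sel" "t \<ge> 2" "n \<ge> 2" "\<S> 1 \<noteq> {}"
    and cube: "\<And>i. i < n \<Longrightarrow> fst (D i) \<in> cbox 0 1"
    and z: "z \<in> unit_directions (\<S> 1) \<times> UNIV"
  shows "(\<Sum>A\<leftarrow>odt_leaves sel t n D \<S>. node_sse n D A)
     \<le> node_sse n D (daughter_le (cbox 0 1) (\<S> 1) z) + node_sse n D (daughter_gt (cbox 0 1) (\<S> 1) z)"
proof -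
  let ?Q = "cbox 0 1 :: 'a node"
  define y where "y = sel n D ?Q (\<S> 1)"
  have "node_idx n D ?Q = {..<n}" using cube by (auto simp: node_idx_def)
  then have count: "node_count n D ?Q = n" by (simp add: node_count_def)
  have first: "split_layer sel t n D \<S> [?Q] [] = [daughter_le ?Q (\<S> 1) y, daughter_gt ?Q (\<S> 1) y]"
    using assms(2,3) by (simp add: count Let_def y_def)
  have "odt_leaves sel t n D \<S> = ((\<lambda>layer. split_layer sel t n D \<S> layer []) ^^ Suc (t - 2)) [?Q]"
    using assms(2) by (simp add: odt_leaves_def Suc_diff_Suc numeral_2_eq_2 del: funpow.simps)
  also have "\<dots> = ((\<lambda>layer. split_layer sel t n D \<S> layer []) ^^ (t - 2)) [daughter_le ?Q (\<S> 1) y, daughter_gt ?Q (\<S> 1) y]"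
    unfolding funpow_Suc_right o_def first ..
  finally have "(\<Sum>A\<leftarrow>odt_leaves sel t n D \<S>. node_sse n D A)
      \<le> node_sse n D (daughter_le ?Q (\<S> 1) y) + node_sse n D (daughter_gt ?Q (\<S> 1) y)"
    using layers_sum_le[where F="node_sse n D" and r="t - 2" and sel=sel and t=t and n=n and D=D and \<S>=\<S>
        and L="[daughter_le ?Q (\<S> 1) y, daughter_gt ?Q (\<S> 1) y]", OF node_sse_daughters_le] by simp
  moreover have "impurity_gain n D ?Q (\<S> 1) z \<le> impurity_gain n D ?Q (\<S> 1) y"
  proof -
    have "is_arg_max (impurity_gain n D ?Q (\<S> 1)) (\<lambda>z. z \<in> unit_directions (\<S> 1) \<times> UNIV) y"
      using assms(1,3,4) count unfolding optimal_split_rule_def y_def by auto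
    then show ?thesis using z by (auto simp: is_arg_max_def not_less)
  qed
  then have "node_sse n D (daughter_le ?Q (\<S> 1) y) + node_sse n D (daughter_gt ?Q (\<S> 1) y)
    \<le> node_sse n D (daughter_le ?Q (\<S> 1) z) + node_sse n D (daughter_gt ?Q (\<S> 1) z)"
    using assms(3) by (simp add: impurity_gain_def count divide_le_cancel)
  ultimately show ?thesis by linarith
qed

text \<open>
  By optimality the tree is at least as good as the split along \<open>H\<close>, and there the drop of the sum of squares on
  the daughter inside \<open>H\<close> alone is the squared sum of the responses divided by the number of points, which is at
  most \<open>n\<close>.
\<close>

lemma full_tree_improves:
  fixes D :: "('p::finite) dataset"
  assumes "optimal_split_rule sel" "t \<ge> 2" "n \<ge> 2" "\<S> 1 = UNIV"
    and cube: "\<And>i. i < n \<Longrightarrow> fst (D i) \<in> cbox 0 1"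
    and H: "H \<in> unit_halfspaces"
  shows "(\<Sum>i<n. snd (D i) * indicator H (fst (D i)))\<^sup>2
     \<le> n * ((\<Sum>i<n. (snd (D i))\<^sup>2) - (\<Sum>i<n. (snd (D i) - odt_estimator sel t n D \<S> (fst (D i)))\<^sup>2))"
proof -
  let ?Q = "cbox 0 1 :: 'p node"
  obtain a s where H_eq: "H = {x. a \<bullet> x \<le> s}" and a: "norm a = 1"
    using H by (auto simp: unit_halfspaces_def)
  note first = assms(4)[simplified]
  define z where "z = (($) a, s)"
  have z: "z \<in> unit_directions (\<S> 1) \<times> UNIV"
    using a by (auto simp: z_def unit_directions_def first norm_vec_def L2_set_def)
  define le where "le = node_idx n D (daughter_le ?Q (\<S> 1) z)"
  define gt where "gt = node_idx n D (daughter_gt ?Q (\<S> 1) z)"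
  have le_eq: "le = {i. i < n \<and> fst (D i) \<in> H}"
    using cube by (auto simp: le_def node_idx_def daughter_le_def z_def first H_eq inner_vec_def)
  have "node_idx n D ?Q = {..<n}" using cube by (auto simp: node_idx_def)
  then have split: "(\<Sum>i\<in>le. (snd (D i))\<^sup>2) + (\<Sum>i\<in>gt. (snd (D i))\<^sup>2) = (\<Sum>i<n. (snd (D i))\<^sup>2)"
    using sum_node_idx_daughters[where h="\<lambda>i. (snd (D i))\<^sup>2" and n=n and D=D and A="?Q"] by (simp add: le_def gt_def)
  have "card le \<le> n" using card_mono[of "{..<n}" le] by (auto simp: le_eq)
  moreover define S where "S = (\<Sum>i\<in>le. snd (D i))"
  ultimately have "S\<^sup>2 / n \<le> S\<^sup>2 / card le"
  proof (cases "card le = 0")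
    case True
    then have "le = {}" by (simp add: le_eq)
    then show ?thesis by (simp add: S_def)
  next
    case False
    then show ?thesis using \<open>card le \<le> n\<close> assms(3) by (intro divide_left_mono) (auto simp del: card_eq_0_iff)
  qed
  moreover have "node_sse n D (daughter_le ?Q (\<S> 1) z) = (\<Sum>i\<in>le. (snd (D i))\<^sup>2) - S\<^sup>2 / card le"
    by (simp add: node_sse_eq le_def S_def node_count_def)
  moreover have "node_sse n D (daughter_gt ?Q (\<S> 1) z) \<le> (\<Sum>i\<in>gt. (snd (D i))\<^sup>2)"
    using node_sse_le[of n D _ 0] by (simp add: gt_def)
  moreover have "(\<Sum>i<n. (snd (D i) - odt_estimator sel t n D \<S> (fst (D i)))\<^sup>2)
     \<le> node_sse n D (daughter_le ?Q (\<S> 1) z) + node_sse n D (daughter_gt ?Q (\<S> 1) z)"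
  proof -
    have "(\<Sum>i<n. (snd (D i) - odt_estimator sel t n D \<S> (fst (D i)))\<^sup>2) = (\<Sum>A\<leftarrow>odt_leaves sel t n D \<S>. node_sse n D A)"
      by (rule tree_residual_sum_eq) (rule cube)
    also have "\<dots> \<le> node_sse n D (daughter_le ?Q (\<S> 1) z) + node_sse n D (daughter_gt ?Q (\<S> 1) z)"
      by (rule first_split_optimal[where \<S>=\<S> and z=z and D=D, OF assms(1-3) _ cube z]) (use assms(4) in auto)
    finally show ?thesis .
  qed
  ultimately have "S\<^sup>2 / n \<le> (\<Sum>i<n. (snd (D i))\<^sup>2) - (\<Sum>i<n. (snd (D i) - odt_estimator sel t n D \<S> (fst (D i)))\<^sup>2)"
    using split by linarith
  moreover have "S = (\<Sum>i<n. snd (D i) * indicator H (fst (D i)))"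
    unfolding S_def le_eq by (intro sum.mono_neutral_cong_left) (auto simp: indicator_def)
  ultimately show ?thesis using assms(3) by (simp add: field_simps)
qed

definition training_error ::
  "(nat \<Rightarrow> ('p::finite) split_rule) \<Rightarrow> 'p coeff_rule \<Rightarrow> nat \<Rightarrow> nat \<Rightarrow> 'p dataset \<Rightarrow> (nat \<Rightarrow> nat \<Rightarrow> 'p set) \<Rightarrow> nat \<Rightarrow> real" where
  "training_error sel coef t n D \<S> j = (\<Sum>i<n. (snd (D i) - boost_estimator sel coef t n D \<S> j (fst (D i)))\<^sup>2)"

lemma least_squares_le:
  assumes "least_squares_rule coef"
  shows "(\<Sum>i<n. (snd (D i) - boost_fit coef n D fs (fst (D i)))\<^sup>2) \<le> (\<Sum>i<n. (snd (D i)
      - linear_combination a fs (fst (D i)))\<^sup>2)"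
  using assms unfolding least_squares_rule_def is_arg_min_def boost_fit_def by (auto simp: not_less)

text \<open>
  Rescaling the coefficients by \<open>1 + u\<close> does not lower the sum of squares, for \<open>u\<close> of either sign.
\<close>

lemma least_squares_orthogonal:
  assumes "least_squares_rule coef"
  shows "(\<Sum>i<n. (snd (D i) - boost_fit coef n D fs (fst (D i))) * boost_fit coef n D fs (fst (D i))) = 0"
proof -
  define f where "f i = boost_fit coef n D fs (fst (D i))" for i
  define r where "r i = snd (D i) - f i" for i
  define P where "P = (\<Sum>i<n. (f i)\<^sup>2)"
  define Q where "Q = (\<Sum>i<n. r i * f i)"
  have P: "P \<ge> 0" unfolding P_def by (intro sum_nonneg) auto
  have quad: "0 \<le> u\<^sup>2 * P - 2 * u * Q" for u
  proof -
    have lin: "linear_combination (\<lambda>l. (1 + u) * coef n D fs l) fs (fst (D i)) = (1 + u) * f i" for i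
      by (simp add: linear_combination_def f_def boost_fit_def sum_distrib_left mult.assoc)
    have "(\<Sum>i<n. (r i)\<^sup>2) \<le> (\<Sum>i<n. (snd (D i) - (1 + u) * f i)\<^sup>2)"
      using least_squares_le[OF assms, where n=n and D=D and fs=fs and a="\<lambda>l. (1 + u) * coef n D fs l"]
          unfolding lin by (simp add: r_def f_def)
    also have "\<dots> = (\<Sum>i<n. (r i)\<^sup>2 + (u\<^sup>2 * (f i)\<^sup>2 - 2 * u * (r i * f i)))"
      by (intro sum.cong) (auto simp: r_def power2_eq_square algebra_simps)
    also have "\<dots> = (\<Sum>i<n. (r i)\<^sup>2) + (u\<^sup>2 * P - 2 * u * Q)"
      by (simp add: sum.distrib sum_subtractf sum_distrib_left P_def Q_def)
    finally show ?thesis by simp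
  qed
  \<comment> \<open>nearly the minimizer \<open>Q / P\<close> of the quadratic, but defined and conclusive also if \<open>P = 0\<close>\<close>
  define u where "u = Q / (P + 1)"
  have Q: "Q = u * (P + 1)" using P by (simp add: u_def)
  have "0 \<le> u\<^sup>2 * P - 2 * u * Q" by (rule quad)
  also have "\<dots> = - (u\<^sup>2 * (P + 2))" by (simp add: Q power2_eq_square algebra_simps)
  finally have "u\<^sup>2 * (P + 2) \<le> 0" by simp
  then have "u = 0" using P by (simp add: mult_le_0_iff)
  then have "Q = 0" by (simp add: Q)
  then show ?thesis by (simp add: Q_def r_def f_def)
qed

text \<open>
  The refitted coefficients are at least as good as the old ones with coefficient \<open>0\<close> or \<open>1\<close> for the new tree.
\<close>

lemma boost_estimator_Suc_le:
  fixes D :: "('p::finite) dataset" and sel :: "nat \<Rightarrow> 'p split_rule" and t n j :: nat and \<S> :: "nat \<Rightarrow> nat \<Rightarrow> 'p set"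
  assumes "least_squares_rule coef"
  defines "R \<equiv> residual_data coef n D (boost_trees sel coef t n D \<S> j)"
  shows "training_error sel coef t n D \<S> (Suc j) \<le> training_error sel coef t n D \<S> j"
    and "training_error sel coef t n D \<S> (Suc j)
      \<le> (\<Sum>i<n. (snd (R i) - odt_estimator (sel (Suc j)) t n R (\<S> (Suc j)) (fst (R i)))\<^sup>2)"
proof -
  define fs where "fs = boost_trees sel coef t n D \<S> j"
  define T where "T = odt_estimator (sel (Suc j)) t n R (\<S> (Suc j))"
  have trees: "boost_trees sel coef t n D \<S> (Suc j) = fs @ [T]" by (simp add: Let_def fs_def T_def R_def)
  have len: "length fs = j" by (simp add: fs_def length_boost_trees)
  have lin: "linear_combination ((coef n D fs)(j := u)) (fs @ [T]) x = boost_fit coef n D fs x + u * T x" for u x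
    unfolding linear_combination_append1 by (simp add: len boost_fit_def linear_combination_def)
  have step: "training_error sel coef t n D \<S> (Suc j) \<le> (\<Sum>i<n. (snd (D i) - (boost_fit coef n D fs (fst (D i))
      + u * T (fst (D i))))\<^sup>2)" for u
    unfolding training_error_def boost_estimator_def trees lin[symmetric] by (rule least_squares_le) fact
  show "training_error sel coef t n D \<S> (Suc j) \<le> training_error sel coef t n D \<S> j"
    using step[of 0] by (simp add: training_error_def boost_estimator_def fs_def)
  show "training_error sel coef t n D \<S> (Suc j)
      \<le> (\<Sum>i<n. (snd (R i) - odt_estimator (sel (Suc j)) t n R (\<S> (Suc j)) (fst (R i)))\<^sup>2)"
  proof -
    have "(\<Sum>i<n. (snd (R i) - T (fst (R i)))\<^sup>2) = (\<Sum>i<n. (snd (D i) - (boost_fit coef n D fs (fst (D i))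
        + 1 * T (fst (D i))))\<^sup>2)"
      by (intro sum.cong refl) (simp add: R_def residual_data_def fs_def[symmetric] diff_diff_eq)
    then show ?thesis using step[of 1] unfolding T_def[symmetric] by simp
  qed
qed

text \<open>
  The residual \<open>r\<close> is orthogonal to the fit, so its sum of squares is its pairing with the responses. Splitting
  the response into \<open>Y - f X\<close> and \<open>f X\<close>, the first pairing is estimated by the mean of the two sums of squares,
  and the second one by \<open>V\<close> times the largest correlation of \<open>r\<close> with a half-space, that is, by the progress of
  the next tree.
\<close>

lemma greedy_step:
  fixes D :: "('p::finite) dataset" and sel :: "nat \<Rightarrow> 'p split_rule" and t n j K :: nat
    and \<S> :: "nat \<Rightarrow> nat \<Rightarrow> 'p set" and E :: "nat \<Rightarrow> real" and c :: "nat \<Rightarrow> real" and V :: real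
  assumes "optimal_split_rule (sel (Suc j))" "least_squares_rule coef" "t \<ge> 2" "n \<ge> 2" "\<S> (Suc j) 1 = UNIV"
    and cube: "\<And>i. i < n \<Longrightarrow> fst (D i) \<in> cbox 0 1"
    and A: "\<And>l. l < K \<Longrightarrow> A l \<in> unit_halfspaces"
    and f: "\<And>x. f x = (\<Sum>l<K. c l * indicator (A l) x)"
    and V: "V = (\<Sum>l<K. \<bar>c l\<bar>)"
  defines "E \<equiv> training_error sel coef t n D \<S>"
  shows "E j - (\<Sum>i<n. (snd (D i) - f (fst (D i)))\<^sup>2) \<le> 2 * V * sqrt (n * (E j - E (Suc j)))"
proof -
  define fs where "fs = boost_trees sel coef t n D \<S> j"
  define R where "R = residual_data coef n D fs"
  define r where "r i = snd (D i) - boost_fit coef n D fs (fst (D i))" for i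
  define d where "d = (\<Sum>i<n. (snd (D i) - f (fst (D i)))\<^sup>2)"
  define G where "G = sqrt (n * (E j - E (Suc j)))"
  have R: "fst (R i) = fst (D i)" "snd (R i) = r i" if "i < n" for i
    using that by (auto simp: R_def residual_data_def r_def)
  have Ej: "E j = (\<Sum>i<n. (r i)\<^sup>2)" by (simp add: E_def training_error_def boost_estimator_def fs_def r_def)
  have G: "\<bar>\<Sum>i<n. r i * indicator (A l) (fst (D i))\<bar> \<le> G" if "l < K" for l
  proof -
    have "(\<Sum>i<n. snd (R i) * indicator (A l) (fst (R i)))\<^sup>2
     \<le> n * ((\<Sum>i<n. (snd (R i))\<^sup>2) - (\<Sum>i<n. (snd (R i) - odt_estimator (sel (Suc j)) t n R (\<S> (Suc j)) (fst (R i)))\<^sup>2))"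
      by (rule full_tree_improves) (use assms A[OF that] R cube in auto)
    also have "\<dots> \<le> n * (E j - E (Suc j))"
    proof (intro mult_left_mono diff_mono)
      show "(\<Sum>i<n. (snd (R i))\<^sup>2) \<le> E j" by (simp add: R Ej)
      show "E (Suc j) \<le> (\<Sum>i<n. (snd (R i) - odt_estimator (sel (Suc j)) t n R (\<S> (Suc j)) (fst (R i)))\<^sup>2)"
        unfolding E_def R_def fs_def by (rule boost_estimator_Suc_le(2)[OF assms(2)])
    qed simp
    finally have "(\<Sum>i<n. r i * indicator (A l) (fst (D i)))\<^sup>2 \<le> n * (E j - E (Suc j))"
      by (simp add: R)
    then show ?thesis unfolding G_def by (intro real_le_rsqrt) (simp only: power2_abs)
  qed
  have "E j = (\<Sum>i<n. r i * snd (D i))"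
  proof -
    have "(\<Sum>i<n. r i * snd (D i)) = (\<Sum>i<n. (r i)\<^sup>2 + r i * boost_fit coef n D fs (fst (D i)))"
      by (intro sum.cong) (auto simp: r_def power2_eq_square algebra_simps)
    then show ?thesis
      using least_squares_orthogonal[OF assms(2), where n=n and D=D and fs=fs] by (simp add: sum.distrib Ej r_def)
  qed
  also have "\<dots> = (\<Sum>i<n. r i * (snd (D i) - f (fst (D i)))) + (\<Sum>i<n. r i * f (fst (D i)))"
    by (simp add: sum.distrib[symmetric] algebra_simps)
  also have "(\<Sum>i<n. r i * (snd (D i) - f (fst (D i)))) \<le> (\<Sum>i<n. ((r i)\<^sup>2 + (snd (D i) - f (fst (D i)))\<^sup>2) / 2)"
  proof (rule sum_mono)
    fix i
    have "0 \<le> (r i - (snd (D i) - f (fst (D i))))\<^sup>2" by simp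
    then show "r i * (snd (D i) - f (fst (D i))) \<le> ((r i)\<^sup>2 + (snd (D i) - f (fst (D i)))\<^sup>2) / 2"
      by (simp add: power2_diff)
  qed
  also have "\<dots> = (E j + d) / 2" by (simp add: Ej d_def sum.distrib sum_divide_distrib[symmetric])
  also have "(\<Sum>i<n. r i * f (fst (D i))) = (\<Sum>l<K. c l * (\<Sum>i<n. r i * indicator (A l) (fst (D i))))"
    unfolding f sum_distrib_left by (subst sum.swap) (simp add: mult_ac)
  also have "\<dots> \<le> (\<Sum>l<K. \<bar>c l\<bar> * G)"
  proof (rule sum_mono)
    fix l assume "l \<in> {..<K}"
    then have "\<bar>c l\<bar> * \<bar>\<Sum>i<n. r i * indicator (A l) (fst (D i))\<bar> \<le> \<bar>c l\<bar> * G"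
      using G by (intro mult_left_mono) auto
    moreover have "u * v \<le> \<bar>u\<bar> * \<bar>v\<bar>" for u v :: real by (simp add: abs_mult[symmetric])
    ultimately show "c l * (\<Sum>i<n. r i * indicator (A l) (fst (D i))) \<le> \<bar>c l\<bar> * G"
      by (rule order_trans[rotated])
  qed
  also have "\<dots> = V * G" by (simp add: V sum_distrib_right)
  finally have "E j \<le> (E j + d) / 2 + V * G" by simp
  then have "E j - d \<le> 2 * (V * G)" by argo
  then show ?thesis by (simp only: d_def G_def mult.assoc)
qed

text \<open>
  The recursion says that the reciprocal of \<open>a\<close> grows by at least \<open>1 / C\<close>.
\<close>

lemma quadratic_recursion_step:
  fixes a a' C N :: real
  assumes "N \<ge> 0" "C \<ge> 0" "a' \<le> a" "N * a \<le> C" and rec: "a \<ge> 0 \<Longrightarrow> a\<^sup>2 \<le> C * (a - a')"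
  shows "(N + 1) * a' \<le> C"
proof (cases "a' \<le> 0")
  case True
  then have "(N + 1) * a' \<le> 0" using assms(1) by (simp add: mult_nonneg_nonpos)
  then show ?thesis using assms(2) by linarith
next
  case False
  then have a: "a > 0" "a' > 0" using assms(3) by auto
  have "a * a' \<le> a * a" using a assms(3) by (intro mult_left_mono) auto
  also have "\<dots> \<le> C * (a - a')" using rec a by (simp add: power2_eq_square)
  finally have *: "a' * (a + C) \<le> C * a" by (simp add: algebra_simps)
  have "(N + 1) * a' * a = (N * a) * a' + a * a'" by (simp add: algebra_simps)
  also have "\<dots> \<le> C * a' + a * a'" using assms(4) a by (intro add_right_mono mult_right_mono) auto
  also have "\<dots> \<le> C * a" using * by (simp add: algebra_simps)
  finally show ?thesis using a by simp
qed

lemma boosting_training_error: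
  fixes D :: "('p::finite) dataset" and t n k K :: nat and c :: "nat \<Rightarrow> real" and V :: real
  assumes "\<And>j. optimal_split_rule (sel j)" "least_squares_rule coef" "t \<ge> 2" "n \<ge> 2"
    and cube: "\<And>i. i < n \<Longrightarrow> fst (D i) \<in> cbox 0 1"
    and A: "\<And>l. l < K \<Longrightarrow> A l \<in> unit_halfspaces"
    and f: "\<And>x. f x = (\<Sum>l<K. c l * indicator (A l) x)"
    and V: "V = (\<Sum>l<K. \<bar>c l\<bar>)"
  shows "real (card {j\<in>{1..k}. \<S> j 1 = UNIV})
       * (training_error sel coef t n D \<S> k - (\<Sum>i<n. (snd (D i) - f (fst (D i)))\<^sup>2)) \<le> 4 * V\<^sup>2 * n"
proof (induction k)
  case 0
  then show ?case by simp
next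
  case (Suc k)
  define E where "E = training_error sel coef t n D \<S>"
  define d where "d = (\<Sum>i<n. (snd (D i) - f (fst (D i)))\<^sup>2)"
  have mono: "E (Suc k) \<le> E k" unfolding E_def by (rule boost_estimator_Suc_le) fact
  have V0: "V \<ge> 0" unfolding V by (intro sum_nonneg) auto
  show ?case
  proof (cases "\<S> (Suc k) 1 = UNIV")
    case False
    then have "{j\<in>{1..Suc k}. \<S> j 1 = UNIV} = {j\<in>{1..k}. \<S> j 1 = UNIV}"
      by (auto simp: le_Suc_eq)
    then have "real (card {j\<in>{1..Suc k}. \<S> j 1 = UNIV}) * (E (Suc k) - d) \<le> real (card {j\<in>{1..k}. \<S> j 1
        = UNIV}) * (E k - d)"
      using mono by (simp add: mult_left_mono)
    then show ?thesis using Suc by (simp add: E_def d_def)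
  next
    case True
    then have "{j\<in>{1..Suc k}. \<S> j 1 = UNIV} = insert (Suc k) {j\<in>{1..k}. \<S> j 1 = UNIV}"
      by (auto simp: le_Suc_eq)
    then have "card {j\<in>{1..Suc k}. \<S> j 1 = UNIV} = Suc (card {j\<in>{1..k}. \<S> j 1 = UNIV})" by simp
    moreover have "(real (card {j\<in>{1..k}. \<S> j 1 = UNIV}) + 1) * (E (Suc k) - d) \<le> 4 * V\<^sup>2 * n"
    proof (rule quadratic_recursion_step)
      show "real (card {j\<in>{1..k}. \<S> j 1 = UNIV}) * (E k - d) \<le> 4 * V\<^sup>2 * n"
        using Suc by (simp add: E_def d_def)
      assume a0: "E k - d \<ge> 0"
      have "E k - d \<le> 2 * V * sqrt (n * (E k - E (Suc k)))"
        unfolding E_def d_def using assms True by (intro greedy_step) auto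
      then have "(E k - d)\<^sup>2 \<le> (2 * V * sqrt (n * (E k - E (Suc k))))\<^sup>2"
        using a0 by (intro power_mono) auto
      also have "\<dots> = 4 * V\<^sup>2 * n * (E k - d - (E (Suc k) - d))"
        using mono by (simp add: power_mult_distrib)
      finally show "(E k - d)\<^sup>2 \<le> 4 * V\<^sup>2 * n * (E k - d - (E (Suc k) - d))" .
    qed (use mono in auto)
    ultimately show ?thesis by (simp add: E_def d_def add.commute)
  qed
qed

lemma training_error_le_initial:
  assumes "least_squares_rule coef"
  shows "training_error sel coef t n D \<S> k \<le> (\<Sum>i<n. (snd (D i))\<^sup>2)"
proof (induction k)
  case 0
  then show ?case by (simp add: training_error_def boost_estimator_def boost_fit_def linear_combination_def)
next
  case (Suc k)
  then show ?case using boost_estimator_Suc_le(1)[OF assms] order_trans by blast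
qed


section \<open>Density of ridge step functions in the square-integrable functions\<close>

definition step_functions :: "((real ^ 'p) \<Rightarrow> real) set" where
  "step_functions = (\<Union>K. span_class K unit_halfspaces)"

text \<open>
  The integral is a nonnegative one, so that membership involves no integrability side condition.
\<close>

definition L2_step_closure :: "(real ^ 'p) measure \<Rightarrow> ((real ^ 'p) \<Rightarrow> real) \<Rightarrow> bool" where
  "L2_step_closure \<mu> g \<longleftrightarrow> g \<in> borel_measurable borel \<and>
     (\<forall>e>0. \<exists>f\<in>step_functions. (\<integral>\<^sup>+x. ennreal ((g x - f x)\<^sup>2) \<partial>\<mu>) < ennreal e)"

lemma unit_halfspace_borel: "A \<in> unit_halfspaces \<Longrightarrow> A \<in> sets borel"
  by (auto simp: unit_halfspaces_def closed_halfspace_le)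

lemma step_functions_measurable: "f \<in> step_functions \<Longrightarrow> f \<in> borel_measurable borel"
proof -
  assume "f \<in> step_functions"
  then obtain K where "f \<in> span_class K unit_halfspaces" unfolding step_functions_def by blast
  then obtain c A where A: "\<And>l. l < K \<Longrightarrow> A l \<in> unit_halfspaces"
    and f: "f = (\<lambda>x. \<Sum>l<K. c l * indicator (A l) x)"
    unfolding span_class_def by blast
  show ?thesis unfolding f
    by (intro borel_measurable_sum borel_measurable_times borel_measurable_const borel_measurable_indicator
        unit_halfspace_borel A) simp
qed

lemma step_functions_add: "f \<in> step_functions \<Longrightarrow> g \<in> step_functions \<Longrightarrow> (\<lambda>x. f x + g x) \<in> step_functions"
  unfolding step_functions_def using span_class_add by blast

lemma step_functions_cmult: "f \<in> step_functions \<Longrightarrow> (\<lambda>x. a * f x) \<in> step_functions"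
  unfolding step_functions_def using span_class_cmult by blast

lemma indicator_step_function:
  assumes "A \<in> unit_halfspaces" shows "indicator A \<in> step_functions"
proof -
  have "(\<lambda>x. \<Sum>l<1::nat. 1 * indicator A x) \<in> span_class 1 unit_halfspaces"
    by (rule span_class_intro) (rule assms)
  moreover have "(\<lambda>x. \<Sum>l<1::nat. 1 * indicator A x) = (indicator A :: _ \<Rightarrow> real)" by (simp add: fun_eq_iff)
  ultimately show ?thesis unfolding step_functions_def by (intro UN_I[of 1]) (simp_all only: UNIV_I)
qed

lemma square_add_le: "((a::real) + b)\<^sup>2 \<le> 2 * a\<^sup>2 + 2 * b\<^sup>2"
  using zero_le_power2[of "a - b"] by (simp add: power2_eq_square algebra_simps)

lemma nn_integral_square_triangle:
  assumes "sets \<mu> = sets borel" "f \<in> borel_measurable borel" "g \<in> borel_measurable borel" "h \<in> borel_measurable borel"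
  shows "(\<integral>\<^sup>+x. ennreal ((f x - h x)\<^sup>2) \<partial>\<mu>) \<le>
    2 * (\<integral>\<^sup>+x. ennreal ((f x - g x)\<^sup>2) \<partial>\<mu>) + 2 * (\<integral>\<^sup>+x. ennreal ((g x - h x)\<^sup>2) \<partial>\<mu>)"
proof -
  note [measurable_cong] = assms(1)
  note [measurable] = assms(2-4)
  have "(\<integral>\<^sup>+x. ennreal ((f x - h x)\<^sup>2) \<partial>\<mu>) \<le> (\<integral>\<^sup>+x. 2 * ennreal ((f x - g x)\<^sup>2) + 2 * ennreal ((g x - h x)\<^sup>2) \<partial>\<mu>)"
  proof (rule nn_integral_mono)
    fix x
    have "(f x - h x)\<^sup>2 \<le> 2 * (f x - g x)\<^sup>2 + 2 * (g x - h x)\<^sup>2"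
      using square_add_le[of "f x - g x" "g x - h x"] by simp
    then have "ennreal ((f x - h x)\<^sup>2) \<le> ennreal (2 * (f x - g x)\<^sup>2 + 2 * (g x - h x)\<^sup>2)" by (rule ennreal_leI)
    also have "\<dots> = 2 * ennreal ((f x - g x)\<^sup>2) + 2 * ennreal ((g x - h x)\<^sup>2)"
      by (subst ennreal_plus) (simp_all add: ennreal_mult')
    finally show "ennreal ((f x - h x)\<^sup>2) \<le> 2 * ennreal ((f x - g x)\<^sup>2) + 2 * ennreal ((g x - h x)\<^sup>2)" .
  qed
  also have "\<dots> = 2 * (\<integral>\<^sup>+x. ennreal ((f x - g x)\<^sup>2) \<partial>\<mu>) + 2 * (\<integral>\<^sup>+x. ennreal ((g x - h x)\<^sup>2) \<partial>\<mu>)"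
    by (subst nn_integral_add) (auto simp: nn_integral_cmult)
  finally show ?thesis .
qed

lemma ennreal_double_less:
  assumes "a < ennreal (e / 4)" "b < ennreal (e / 4)" "e > 0"
  shows "2 * a + 2 * b < ennreal e"
proof -
  obtain r where r: "a = ennreal r" "0 \<le> r" using assms(1) by (cases a) auto
  obtain s where s: "b = ennreal s" "0 \<le> s" using assms(2) by (cases b) auto
  have "r < e / 4" "s < e / 4" using assms r s by (auto simp: ennreal_less_iff)
  then have "ennreal (2 * r + 2 * s) < ennreal e" using r s by (subst ennreal_less_iff) auto
  then show ?thesis using r s by (simp add: ennreal_plus ennreal_mult')
qed

lemma L2_step_closure_step: "f \<in> step_functions \<Longrightarrow> L2_step_closure \<mu> f"
  unfolding L2_step_closure_def by (auto simp: step_functions_measurable intro!: bexI[of _ f])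

lemma L2_step_closure_closed:
  assumes "sets \<mu> = sets borel" "g \<in> borel_measurable borel"
    and "\<And>e. e > 0 \<Longrightarrow> \<exists>h. L2_step_closure \<mu> h \<and> (\<integral>\<^sup>+x. ennreal ((g x - h x)\<^sup>2) \<partial>\<mu>) < ennreal e"
  shows "L2_step_closure \<mu> g"
  unfolding L2_step_closure_def
proof (intro conjI allI impI)
  fix e :: real assume e: "e > 0"
  then obtain h where h: "L2_step_closure \<mu> h" "(\<integral>\<^sup>+x. ennreal ((g x - h x)\<^sup>2) \<partial>\<mu>) < ennreal (e / 4)"
    using assms(3)[of "e / 4"] by auto
  then obtain f where f: "f \<in> step_functions" "(\<integral>\<^sup>+x. ennreal ((h x - f x)\<^sup>2) \<partial>\<mu>) < ennreal (e / 4)"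
    using e unfolding L2_step_closure_def by (meson divide_pos_pos zero_less_numeral)
  have "(\<integral>\<^sup>+x. ennreal ((g x - f x)\<^sup>2) \<partial>\<mu>) \<le>
    2 * (\<integral>\<^sup>+x. ennreal ((g x - h x)\<^sup>2) \<partial>\<mu>) + 2 * (\<integral>\<^sup>+x. ennreal ((h x - f x)\<^sup>2) \<partial>\<mu>)"
    using assms h(1) f(1) by (intro nn_integral_square_triangle) (auto simp: L2_step_closure_def
        step_functions_measurable)
  also have "\<dots> < ennreal e" by (rule ennreal_double_less) fact+
  finally show "\<exists>f\<in>step_functions. (\<integral>\<^sup>+x. ennreal ((g x - f x)\<^sup>2) \<partial>\<mu>) < ennreal e" using f(1) by blast
qed (rule assms(2))

lemma L2_step_closure_add:
  assumes "sets \<mu> = sets borel" "L2_step_closure \<mu> g" "L2_step_closure \<mu> h"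
  shows "L2_step_closure \<mu> (\<lambda>x. g x + h x)"
proof -
  note [measurable_cong] = assms(1)
  have [measurable]: "g \<in> borel_measurable borel" "h \<in> borel_measurable borel"
    using assms by (auto simp: L2_step_closure_def)
  have "\<exists>f\<in>step_functions. (\<integral>\<^sup>+x. ennreal ((g x + h x - f x)\<^sup>2) \<partial>\<mu>) < ennreal e" if e: "e > 0" for e
  proof -
    have e4: "e / 4 > 0" using e by simp
    obtain f1 where f1: "f1 \<in> step_functions" "(\<integral>\<^sup>+x. ennreal ((g x - f1 x)\<^sup>2) \<partial>\<mu>) < ennreal (e / 4)"
      using assms(2) e4 unfolding L2_step_closure_def by blast
    obtain f2 where f2: "f2 \<in> step_functions" "(\<integral>\<^sup>+x. ennreal ((h x - f2 x)\<^sup>2) \<partial>\<mu>) < ennreal (e / 4)"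
      using assms(3) e4 unfolding L2_step_closure_def by blast
    note [measurable] = step_functions_measurable[OF f1(1)] step_functions_measurable[OF f2(1)]
    have "(\<integral>\<^sup>+x. ennreal ((g x + h x - (f1 x + f2 x))\<^sup>2) \<partial>\<mu>) \<le>
       2 * (\<integral>\<^sup>+x. ennreal ((g x + h x - (f1 x + h x))\<^sup>2) \<partial>\<mu>) + 2 * (\<integral>\<^sup>+x. ennreal ((f1 x + h x - (f1 x + f2 x))\<^sup>2) \<partial>\<mu>)"
      by (intro nn_integral_square_triangle assms(1)) measurable
    also have "\<dots> < ennreal e" using f1(2) f2(2) e by (intro ennreal_double_less) auto
    finally show ?thesis by (rule bexI[OF _ step_functions_add[OF f1(1) f2(1)]])
  qed
  then show ?thesis unfolding L2_step_closure_def by auto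
qed

lemma L2_step_closure_cmult:
  assumes "sets \<mu> = sets borel" "L2_step_closure \<mu> g"
  shows "L2_step_closure \<mu> (\<lambda>x. a * g x)"
proof -
  note [measurable_cong] = assms(1)
  have [measurable]: "g \<in> borel_measurable borel"
    using assms by (auto simp: L2_step_closure_def)
  have "\<exists>f\<in>step_functions. (\<integral>\<^sup>+x. ennreal ((a * g x - f x)\<^sup>2) \<partial>\<mu>) < ennreal e" if e: "e > 0" for e
  proof -
    define e' where "e' = e / (a\<^sup>2 + 1)"
    have a: "a\<^sup>2 + 1 > 0" by (simp add: add_nonneg_pos)
    have e': "e' > 0" using e a by (simp add: e'_def)
    obtain f where f: "f \<in> step_functions" "(\<integral>\<^sup>+x. ennreal ((g x - f x)\<^sup>2) \<partial>\<mu>) < ennreal e'"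
      using assms(2) e' unfolding L2_step_closure_def by blast
    note [measurable] = step_functions_measurable[OF f(1)]
    have "(\<integral>\<^sup>+x. ennreal ((a * g x - a * f x)\<^sup>2) \<partial>\<mu>) = (\<integral>\<^sup>+x. ennreal (a\<^sup>2) * ennreal ((g x - f x)\<^sup>2) \<partial>\<mu>)"
      by (intro nn_integral_cong) (simp add: ennreal_mult'[symmetric] power_mult_distrib[symmetric] right_diff_distrib)
    also have "\<dots> = ennreal (a\<^sup>2) * (\<integral>\<^sup>+x. ennreal ((g x - f x)\<^sup>2) \<partial>\<mu>)"
      by (rule nn_integral_cmult) measurable
    also have "\<dots> \<le> ennreal (a\<^sup>2) * ennreal e'" using f(2) by (intro mult_left_mono) auto
    also have "\<dots> = ennreal (a\<^sup>2 * e')" using e' by (simp add: ennreal_mult')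
    also have "\<dots> < ennreal e"
    proof -
      have "a\<^sup>2 * e' < (a\<^sup>2 + 1) * e'" using e' by (intro mult_strict_right_mono) auto
      also have "\<dots> = e" using a by (simp add: e'_def)
      finally show ?thesis using e by (intro ennreal_lessI) auto
    qed
    finally show ?thesis by (rule bexI[OF _ step_functions_cmult[OF f(1)]])
  qed
  then show ?thesis unfolding L2_step_closure_def by auto
qed

lemma L2_step_closure_sum:
  fixes \<mu> :: "(real ^ 'p) measure"
  assumes "sets \<mu> = sets borel" "finite I" "\<And>i. i \<in> I \<Longrightarrow> L2_step_closure \<mu> (g i)"
  shows "L2_step_closure \<mu> (\<lambda>x. \<Sum>i\<in>I. g i x)"
  using assms(2,3)
proof (induction I rule: finite_induct)
  case empty
  have "(\<lambda>x :: real ^ 'p. \<Sum>l<0::nat. 0 * indicator {} x) \<in> span_class 0 unit_halfspaces" by (rule span_class_intro) simp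
  then have "(\<lambda>x :: real ^ 'p. 0) \<in> step_functions" unfolding step_functions_def by auto
  then show ?case by (simp add: L2_step_closure_step)
next
  case (insert i I)
  then show ?case by (simp add: L2_step_closure_add[OF assms(1)])
qed

lemma L2_step_closure_uniform:
  assumes "prob_space \<mu>" "sets \<mu> = sets borel" "AE x in \<mu>. x \<in> Q" "g \<in> borel_measurable borel"
    and approx: "\<And>e. e > 0 \<Longrightarrow> \<exists>h. L2_step_closure \<mu> h \<and> (\<forall>x\<in>Q. \<bar>g x - h x\<bar> \<le> e)"
  shows "L2_step_closure \<mu> g"
proof (rule L2_step_closure_closed[OF assms(2,4)])
  interpret prob_space \<mu> by fact
  fix e :: real assume e: "e > 0"
  \<comment> \<open>at most \<open>1\<close>, so that the square of a uniform error does not exceed the error\<close>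
  define e' where "e' = min 1 (e / 2)"
  have e': "e' > 0" "e' \<le> 1" "e' \<le> e / 2" using e by (auto simp: e'_def)
  obtain h where h: "L2_step_closure \<mu> h" "\<And>x. x \<in> Q \<Longrightarrow> \<bar>g x - h x\<bar> \<le> e'" using approx[OF e'(1)] by blast
  have "(\<integral>\<^sup>+x. ennreal ((g x - h x)\<^sup>2) \<partial>\<mu>) \<le> (\<integral>\<^sup>+x. ennreal (e / 2) \<partial>\<mu>)"
  proof (rule nn_integral_mono_AE)
    show "AE x in \<mu>. ennreal ((g x - h x)\<^sup>2) \<le> ennreal (e / 2)"
      using assms(3)
    proof eventually_elim
      case (elim x)
      have "(g x - h x)\<^sup>2 \<le> e'\<^sup>2" using h(2)[OF elim] by (metis abs_le_square_iff abs_of_pos e'(1))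
      also have "\<dots> \<le> e'" using e' by (simp add: power2_eq_square mult_left_le)
      finally show ?case using e' by (intro ennreal_leI) auto
    qed
  qed
  also have "\<dots> = ennreal (e / 2)" by (simp add: emeasure_space_1)
  also have "\<dots> < ennreal e" using e by (intro ennreal_lessI) auto
  finally show "\<exists>h. L2_step_closure \<mu> h \<and> (\<integral>\<^sup>+x. ennreal ((g x - h x)\<^sup>2) \<partial>\<mu>) < ennreal e" using h(1) by blast
qed

lemma L2_step_closure_dominated:
  assumes "sets \<mu> = sets borel" "g \<in> borel_measurable borel" "w \<in> borel_measurable borel"
    and u: "\<And>k. L2_step_closure \<mu> (u k)" and lim: "\<And>x. (\<lambda>k. u k x) \<longlonglongrightarrow> g x"
    and dom: "\<And>k x. (g x - u k x)\<^sup>2 \<le> w x" and fin: "(\<integral>\<^sup>+x. ennreal (w x) \<partial>\<mu>) < \<infinity>"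
  shows "L2_step_closure \<mu> g"
proof (rule L2_step_closure_closed[OF assms(1,2)])
  note [measurable_cong] = assms(1)
  have [measurable]: "g \<in> borel_measurable borel" "w \<in> borel_measurable borel" "\<And>k. u k \<in> borel_measurable borel"
    using assms u by (auto simp: L2_step_closure_def)
  fix e :: real assume e: "e > 0"
  have "(\<lambda>k. \<integral>\<^sup>+x. ennreal ((g x - u k x)\<^sup>2) \<partial>\<mu>) \<longlonglongrightarrow> (\<integral>\<^sup>+x. 0 \<partial>\<mu>)"
  proof (rule nn_integral_dominated_convergence[where w="\<lambda>x. ennreal (w x)"])
    show "AE x in \<mu>. (\<lambda>k. ennreal ((g x - u k x)\<^sup>2)) \<longlonglongrightarrow> 0"
    proof (rule AE_I2)
      fix x
      have "(\<lambda>k. ennreal ((g x - u k x)\<^sup>2)) \<longlonglongrightarrow> ennreal ((g x - g x)\<^sup>2)"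
        by (intro tendsto_ennrealI tendsto_intros lim)
      then show "(\<lambda>k. ennreal ((g x - u k x)\<^sup>2)) \<longlonglongrightarrow> 0" by simp
    qed
  qed (use dom fin in \<open>auto intro!: ennreal_leI\<close>)
  then have "\<forall>\<^sub>F k in sequentially. (\<integral>\<^sup>+x. ennreal ((g x - u k x)\<^sup>2) \<partial>\<mu>) < ennreal e"
    using e by (intro order_tendstoD(2)) auto
  then obtain k where "(\<integral>\<^sup>+x. ennreal ((g x - u k x)\<^sup>2) \<partial>\<mu>) < ennreal e"
      by (meson eventually_happens trivial_limit_sequentially)
  then show "\<exists>h. L2_step_closure \<mu> h \<and> (\<integral>\<^sup>+x. ennreal ((g x - h x)\<^sup>2) \<partial>\<mu>) < ennreal e" using u by blast
qed

text \<open>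
  On a bounded set \<open>a \<bullet> x\<close> stays in a compact interval, on which \<open>\<phi>\<close> is uniformly continuous. It is approximated
  by its value at the next grid point above \<open>a \<bullet> x\<close>, and the set where this is a given grid point is a
  difference of two half-spaces.
\<close>

lemma L2_step_closure_ridge:
  fixes a :: "real ^ 'p" and \<phi> :: "real \<Rightarrow> real"
  assumes \<mu>: "prob_space \<mu>" "sets \<mu> = sets borel" "AE x in \<mu>. x \<in> Q" and Q: "bounded Q"
    and a: "norm a = 1" and \<phi>: "continuous_on UNIV \<phi>"
  shows "L2_step_closure \<mu> (\<lambda>x. \<phi> (a \<bullet> x))"
proof (rule L2_step_closure_uniform[OF \<mu>])
  show "(\<lambda>x. \<phi> (a \<bullet> x)) \<in> borel_measurable borel"
    using \<phi> by (intro borel_measurable_continuous_onI continuous_on_compose2[OF \<phi>] continuous_intros) auto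
  fix e :: real assume e: "e > 0"
  obtain R where R: "R > 0" "\<And>x. x \<in> Q \<Longrightarrow> norm x \<le> R" using Q by (meson bounded_pos)
  have aR: "\<bar>a \<bullet> x\<bar> \<le> R" if "x \<in> Q" for x
    using Cauchy_Schwarz_ineq2[of a x] R(2)[OF that] a by simp
  \<comment> \<open>the next grid point may exceed \<open>R\<close> by the mesh width \<open>\<delta> \<le> R\<close>\<close>
  have "uniformly_continuous_on {-R..2*R} \<phi>"
    by (intro compact_uniformly_continuous continuous_on_subset[OF \<phi>]) auto
  then obtain \<delta>0 where \<delta>0: "\<delta>0 > 0"
    "\<And>u v. u \<in> {-R..2*R} \<Longrightarrow> v \<in> {-R..2*R} \<Longrightarrow> dist v u < \<delta>0 \<Longrightarrow> dist (\<phi> v) (\<phi> u) < e"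
    using e unfolding uniformly_continuous_on_def by metis
  define \<delta> where "\<delta> = min (\<delta>0 / 2) R"
  have \<delta>: "\<delta> > 0" "\<delta> < \<delta>0" "\<delta> \<le> R" using \<delta>0 R by (auto simp: \<delta>_def)
  define s where "s k = - R + \<delta> * real k" for k :: nat
  define H where "H k = {x :: real ^ 'p. a \<bullet> x \<le> s k}" for k
  define N where "N = nat \<lceil>2 * R / \<delta>\<rceil>"
  define h where "h x = \<phi> (s 0) * indicator (H 0) x + (\<Sum>k<N. \<phi> (s (Suc k)) * (indicator (H (Suc k)) x
      + (- 1) * indicator (H k) x))" for x
  have H: "L2_step_closure \<mu> (indicator (H k))" for k
    by (rule L2_step_closure_step, rule indicator_step_function) (use a in \<open>auto simp: H_def unit_halfspaces_def\<close>)
  have "L2_step_closure \<mu> h"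
    unfolding h_def by (intro L2_step_closure_add L2_step_closure_cmult L2_step_closure_sum \<mu> H finite_lessThan)
  moreover have "\<bar>\<phi> (a \<bullet> x) - h x\<bar> \<le> e" if x: "x \<in> Q" for x
  proof -
    define u where "u = a \<bullet> x"
    define K where "K = nat \<lceil>(u + R) / \<delta>\<rceil>"
    have u: "- R \<le> u" "u \<le> R" using aR[OF x] by (auto simp: u_def)
    have K: "real K = of_int \<lceil>(u + R) / \<delta>\<rceil>" using u \<delta> by (simp add: K_def)
    have "(u + R) / \<delta> \<le> real K" "real K < (u + R) / \<delta> + 1" unfolding K by linarith+
    then have uK: "u \<le> s K" "s K < u + \<delta>" using \<delta> by (simp_all add: s_def field_simps)
    have ind: "indicator (H k) x = (if K \<le> k then 1 else 0 :: real)" for k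
    proof -
      have "u \<le> s k \<longleftrightarrow> K \<le> k"
      proof
        assume "K \<le> k"
        then have "s K \<le> s k" using \<delta> by (simp add: s_def)
        then show "u \<le> s k" using uK by simp
      next
        assume "u \<le> s k"
        then have "(u + R) / \<delta> \<le> real k" using \<delta> by (simp add: s_def field_simps)
        then show "K \<le> k" by (simp add: K_def)
      qed
      then show ?thesis by (simp add: H_def u_def)
    qed
    have KN: "K \<le> N" unfolding K_def N_def
      using u \<delta> by (intro nat_mono ceiling_mono divide_right_mono) auto
    have "h x = \<phi> (s K)"
    proof (cases K)
      case 0
      then show ?thesis by (simp add: h_def ind)
    next
      case (Suc K')
      have "(\<Sum>k<N. \<phi> (s (Suc k)) * (indicator (H (Suc k)) x + (- 1) * indicator (H k) x)) = (\<Sum>k<N. if k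
          = K' then \<phi> (s (Suc k)) else 0)"
        unfolding ind Suc by (intro sum.cong) auto
      also have "\<dots> = \<phi> (s K)" using KN Suc by simp
      finally show ?thesis by (simp add: h_def ind Suc)
    qed
    moreover have "dist (\<phi> u) (\<phi> (s K)) < e"
      by (rule \<delta>0(2)) (use uK u \<delta> in \<open>auto simp: dist_real_def\<close>)
    ultimately show ?thesis by (simp add: u_def dist_real_def)
  qed
  ultimately show "\<exists>h. L2_step_closure \<mu> h \<and> (\<forall>x\<in>Q. \<bar>\<phi> (a \<bullet> x) - h x\<bar> \<le> e)" by blast
qed

text \<open>
  The span of the exponentials of linear forms, an algebra because they are closed under products. Each
  generator is a function of a single linear form.
\<close>

inductive_set exp_polys :: "(real ^ 'p \<Rightarrow> real) set" where
  exp: "(\<lambda>x. exp (w \<bullet> x)) \<in> exp_polys"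
| add: "f \<in> exp_polys \<Longrightarrow> g \<in> exp_polys \<Longrightarrow> (\<lambda>x. f x + g x) \<in> exp_polys"
| cmult: "f \<in> exp_polys \<Longrightarrow> (\<lambda>x. c * f x) \<in> exp_polys"

lemma exp_polys_mult:
  assumes "f \<in> exp_polys" "g \<in> exp_polys" shows "(\<lambda>x. f x * g x) \<in> exp_polys"
  using assms(1)
proof (induction rule: exp_polys.induct)
  case (exp w)
  from assms(2) show ?case
  proof (induction rule: exp_polys.induct)
    case (exp v)
    have "(\<lambda>x. exp (w \<bullet> x) * exp (v \<bullet> x)) = (\<lambda>x. exp ((w + v) \<bullet> x))"
      by (simp add: exp_add[symmetric] inner_add_left)
    then show ?case by (simp only: exp_polys.exp)
  next
    case (add f g)
    then show ?case using exp_polys.add by (simp only: distrib_left)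
  next
    case (cmult f c)
    have "(\<lambda>x. exp (w \<bullet> x) * (c * f x)) = (\<lambda>x. c * (exp (w \<bullet> x) * f x))" by (simp add: mult_ac)
    then show ?case using cmult.IH exp_polys.cmult by (simp only:)
  qed
next
  case (add f1 f2)
  then show ?case using exp_polys.add by (simp only: distrib_right)
next
  case (cmult f c)
  then show ?case using exp_polys.cmult by (simp only: mult.assoc)
qed

lemma L2_step_closure_exp_polys:
  fixes \<mu> :: "(real ^ 'p) measure"
  assumes \<mu>: "prob_space \<mu>" "sets \<mu> = sets borel" "AE x in \<mu>. x \<in> Q" and Q: "bounded Q"
    and f: "f \<in> exp_polys"
  shows "L2_step_closure \<mu> f"
  using f
proof (induction rule: exp_polys.induct)
  case (exp w)
  define a :: "real ^ 'p" where "a = (if w = 0 then axis undefined 1 else w /\<^sub>R norm w)"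
  have a: "norm a = 1" by (auto simp: a_def norm_axis_1)
  have "w \<bullet> x = norm w * (a \<bullet> x)" for x by (auto simp: a_def inner_scaleR_left)
  moreover have "L2_step_closure \<mu> (\<lambda>x. (\<lambda>u. exp (norm w * u)) (a \<bullet> x))"
    by (rule L2_step_closure_ridge[OF \<mu> Q a]) (intro continuous_intros)
  ultimately show ?case by simp
qed (simp_all add: L2_step_closure_add[OF \<mu>(2)] L2_step_closure_cmult[OF \<mu>(2)])

lemma L2_step_closure_continuous:
  fixes \<mu> :: "(real ^ 'p) measure"
  assumes \<mu>: "prob_space \<mu>" "sets \<mu> = sets borel" "AE x in \<mu>. x \<in> Q" and Q: "compact Q"
    and f: "continuous_on UNIV f"
  shows "L2_step_closure \<mu> f"
proof (rule L2_step_closure_uniform[OF \<mu>])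
  show "f \<in> borel_measurable borel" using f by (rule borel_measurable_continuous_onI)
  fix e :: real assume e: "e > 0"
  have "\<exists>g. g \<in> exp_polys \<and> (\<forall>x\<in>Q. \<bar>f x - g x\<bar> < e)"
  proof (rule Stone_Weierstrass_HOL[OF Q])
    fix c :: real
    have "(\<lambda>x :: real ^ 'p. c * exp (0 \<bullet> x)) \<in> exp_polys" by (intro exp_polys.intros)
    then show "(\<lambda>x :: real ^ 'p. c) \<in> exp_polys" by simp
  next
    fix g :: "real ^ 'p \<Rightarrow> real" assume "g \<in> exp_polys"
    then show "continuous_on Q g" by induction (auto intro!: continuous_intros)
  next
    fix x y :: "real ^ 'p" assume "x \<in> Q \<and> y \<in> Q \<and> x \<noteq> y"
    then have "(x - y) \<bullet> (x - y) \<noteq> 0" by simp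
    then have "exp ((x - y) \<bullet> x) \<noteq> exp ((x - y) \<bullet> y)" by (simp add: inner_diff_right)
    then show "\<exists>f. f \<in> exp_polys \<and> f x \<noteq> f y" using exp_polys.exp[of "x - y"] by (intro exI[of _ "\<lambda>z. exp ((x
        - y) \<bullet> z)"]) auto
  next
    show "continuous_on Q f" by (rule continuous_on_subset[OF f]) simp
  qed (use e exp_polys.add exp_polys_mult in auto)
  then obtain g where g: "g \<in> exp_polys" "\<forall>x\<in>Q. \<bar>f x - g x\<bar> < e" by blast
  have "L2_step_closure \<mu> g" by (rule L2_step_closure_exp_polys[OF \<mu> compact_imp_bounded[OF Q] g(1)])
  then show "\<exists>h. L2_step_closure \<mu> h \<and> (\<forall>x\<in>Q. \<bar>f x - h x\<bar> \<le> e)" using g(2)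
      by (intro exI[of _ g]) (auto intro: less_imp_le)
qed

text \<open>
  Closed sets form an intersection-stable generator, and their indicators are limits of continuous functions of
  the distance. Complements and disjoint unions are handled by linearity and dominated convergence.
\<close>

lemma L2_step_closure_indicator:
  fixes \<mu> :: "(real ^ 'p) measure"
  assumes \<mu>: "prob_space \<mu>" "sets \<mu> = sets borel" "AE x in \<mu>. x \<in> Q" and Q: "compact Q"
    and A: "A \<in> sets borel"
  shows "L2_step_closure \<mu> (indicator A)"
proof -
  interpret prob_space \<mu> by fact
  have one: "L2_step_closure \<mu> (\<lambda>x. 1)" by (rule L2_step_closure_continuous[OF \<mu> Q]) (rule continuous_on_const)
  have const: "(\<integral>\<^sup>+x. ennreal 1 \<partial>\<mu>) < \<infinity>" by (simp add: emeasure_space_1)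
  have "Int_stable (Collect closed :: (real ^ 'p) set set)" by (auto simp: Int_stable_def)
  moreover have "(Collect closed :: (real ^ 'p) set set) \<subseteq> Pow UNIV" by auto
  moreover have "A \<in> sigma_sets UNIV (Collect closed)" using A by (simp add: borel_eq_closed)
  ultimately show ?thesis
  proof (induction rule: sigma_sets_induct_disjoint)
    case (basic C)
    then have C: "closed C" by simp
    show ?case
    proof (cases "C = {}")
      case True
      then show ?thesis using L2_step_closure_cmult[OF \<mu>(2) one, of 0] by simp
    next
      case False
      define u where "u k x = max 0 (1 - real k * infdist x C)" for k :: nat and x
      show ?thesis
      proof (rule L2_step_closure_dominated[where u=u and w="\<lambda>_. 1", OF \<mu>(2) _ _ _ _ _ const])
        show "L2_step_closure \<mu> (u k)" for k
          unfolding u_def by (rule L2_step_closure_continuous[OF \<mu> Q]) (intro continuous_intros)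
        show "(\<lambda>k. u k x) \<longlonglongrightarrow> indicator C x" for x
        proof (cases "x \<in> C")
          case True
          then show ?thesis by (simp add: u_def)
        next
          case F: False
          then have pos: "infdist x C > 0"
            using C False by (metis in_closed_iff_infdist_zero infdist_nonneg less_eq_real_def)
          have "\<forall>\<^sub>F k in sequentially. u k x = indicator C x"
          proof (rule eventually_sequentiallyI)
            fix k assume "nat \<lceil>1 / infdist x C\<rceil> \<le> k"
            then have "1 / infdist x C \<le> real k" by (simp add: nat_le_iff ceiling_le_iff)
            then have "1 \<le> real k * infdist x C" using pos by (simp add: field_simps)
            then show "u k x = indicator C x" using F by (simp add: u_def)
          qed
          then show ?thesis by (rule tendsto_eventually)
        qed
        show "(indicator C x - u k x)\<^sup>2 \<le> 1" for k x
        proof -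
          have "0 \<le> u k x" "u k x \<le> 1" by (auto simp: u_def infdist_nonneg)
          then have "\<bar>indicator C x - u k x\<bar> \<le> 1" by (auto simp: indicator_def)
          then show ?thesis by (simp add: abs_square_le_1)
        qed
      qed (use C in auto)
    qed
  next
    case empty
    then show ?case using L2_step_closure_cmult[OF \<mu>(2) one, of 0] by simp
  next
    case (compl A)
    have "(\<lambda>x. 1 + (- 1) * indicator A x :: real) = indicator (UNIV - A)" by (auto simp: indicator_def)
    then show ?case using L2_step_closure_add[OF \<mu>(2) one L2_step_closure_cmult[OF \<mu>(2) compl.IH, of "-1"]] by simp
  next
    case (union A)
    define u where "u k x = (\<Sum>i<k. indicator (A i) x :: real)" for k :: nat and x
    have disj: "disjoint_family A" by fact
    have u: "u k x = indicator (\<Union>i<k. A i) x" for k x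
      unfolding u_def
    proof (induction k)
      case (Suc k)
      have d: "x \<notin> A i" if "x \<in> A k" "i < k" for i
        using disjoint_family_onD[OF disj, of i k] that by auto
      show ?case unfolding sum.lessThan_Suc Suc.IH
        by (cases "x \<in> A k") (use d in \<open>auto simp: indicator_def less_Suc_eq\<close>)
    qed simp
    have meas: "A i \<in> sets borel" for i using union.hyps(2) by (auto simp: borel_eq_closed)
    show ?case
    proof (rule L2_step_closure_dominated[where u=u and w="\<lambda>_. 1", OF \<mu>(2) _ _ _ _ _ const])
      show "L2_step_closure \<mu> (u k)" for k unfolding u_def using union by (intro L2_step_closure_sum \<mu>) auto
      show "(\<lambda>k. u k x) \<longlonglongrightarrow> indicator (\<Union>i. A i) x" for x
      proof -
        have "(\<lambda>k. indicator (\<Union>i<k. A i) x :: real) \<longlonglongrightarrow> indicator (\<Union>i. A i) x"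
          by (rule LIMSEQ_indicator_UN)
        then show ?thesis by (simp add: u)
      qed
      show "(indicator (\<Union>i. A i) x - u k x)\<^sup>2 \<le> 1" for k x unfolding u by (auto simp: indicator_def)
    qed (use meas in auto)
  qed
qed

theorem step_functions_dense:
  fixes \<mu> :: "(real ^ 'p) measure"
  assumes \<mu>: "prob_space \<mu>" "sets \<mu> = sets borel" "AE x in \<mu>. x \<in> Q" and Q: "compact Q"
    and g: "g \<in> borel_measurable borel" "(\<integral>\<^sup>+x. ennreal ((g x)\<^sup>2) \<partial>\<mu>) < \<infinity>"
  shows "L2_step_closure \<mu> g"
proof -
  have pos: "L2_step_closure \<mu> v" if "v \<in> borel_measurable borel" "\<And>x. 0 \<le> v x" "(\<integral>\<^sup>+x. ennreal ((v x)\<^sup>2) \<partial>\<mu>) < \<infinity>" for v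
    using that
  proof (induction v rule: borel_measurable_induct_real)
    case (set A)
    then show ?case by (intro L2_step_closure_indicator[OF \<mu> Q])
  next
    case (mult u c)
    show ?case
    proof (cases "c = 0")
      case True
      then show ?thesis using L2_step_closure_cmult[OF \<mu>(2) L2_step_closure_indicator[OF \<mu> Q, of "{}"], of 0] by simp
    next
      case False
      note [measurable_cong] = \<mu>(2)
      note [measurable] = mult.hyps(2)
      have "(\<integral>\<^sup>+x. ennreal ((c * u x)\<^sup>2) \<partial>\<mu>) = ennreal (c\<^sup>2) * (\<integral>\<^sup>+x. ennreal ((u x)\<^sup>2) \<partial>\<mu>)"
        by (subst nn_integral_cmult[symmetric]) (auto simp: power_mult_distrib ennreal_mult')
      then have "(\<integral>\<^sup>+x. ennreal ((u x)\<^sup>2) \<partial>\<mu>) < \<infinity>"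
        using mult.prems False by (auto simp: ennreal_mult_less_top)
      then show ?thesis using mult.IH L2_step_closure_cmult[OF \<mu>(2)] by blast
    qed
  next
    case (add u v)
    have "(\<integral>\<^sup>+x. ennreal ((u x)\<^sup>2) \<partial>\<mu>) \<le> (\<integral>\<^sup>+x. ennreal ((v x + u x)\<^sup>2) \<partial>\<mu>)"
      "(\<integral>\<^sup>+x. ennreal ((v x)\<^sup>2) \<partial>\<mu>) \<le> (\<integral>\<^sup>+x. ennreal ((v x + u x)\<^sup>2) \<partial>\<mu>)"
      using add.hyps by (auto intro!: nn_integral_mono ennreal_leI power_mono)
    then have "L2_step_closure \<mu> u" "L2_step_closure \<mu> v" using add by (auto dest: le_less_trans)
    then show ?case by (intro L2_step_closure_add \<mu>)
  next
    case (seq U)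
    have le: "U i x \<le> v x" for i x
      using seq.hyps(3) seq.hyps(4)[of x] by (intro incseq_le) (auto simp: incseq_def le_fun_def)
    show ?case
    proof (rule L2_step_closure_dominated[where u=U and w="\<lambda>x. (v x)\<^sup>2", OF \<mu>(2) _ _ _ _ _ seq.prems])
      show "v \<in> borel_measurable borel"
        by (rule borel_measurable_LIMSEQ_real[of borel U]) (use seq.hyps in auto)
      then show "(\<lambda>x. (v x)\<^sup>2) \<in> borel_measurable borel" by measurable
      show "L2_step_closure \<mu> (U k)" for k
      proof (rule seq.IH)
        have "(\<integral>\<^sup>+x. ennreal ((U k x)\<^sup>2) \<partial>\<mu>) \<le> (\<integral>\<^sup>+x. ennreal ((v x)\<^sup>2) \<partial>\<mu>)"
          using seq.hyps(2) le by (intro nn_integral_mono ennreal_leI power_mono) auto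
        then show "(\<integral>\<^sup>+x. ennreal ((U k x)\<^sup>2) \<partial>\<mu>) < \<infinity>" using seq.prems by (rule le_less_trans)
      qed
      show "(v x - U k x)\<^sup>2 \<le> (v x)\<^sup>2" for k x
        using le[of k x] seq.hyps(2)[of k x] by (intro power_mono) auto
    qed (use seq.hyps in auto)
  qed
  note [measurable_cong] = \<mu>(2)
  note [measurable] = g(1)
  have "L2_step_closure \<mu> (\<lambda>x. max 0 (g x))"
  proof (rule pos)
    have "(\<integral>\<^sup>+x. ennreal ((max 0 (g x))\<^sup>2) \<partial>\<mu>) \<le> (\<integral>\<^sup>+x. ennreal ((g x)\<^sup>2) \<partial>\<mu>)"
      by (intro nn_integral_mono ennreal_leI) (auto simp: max_def)
    then show "(\<integral>\<^sup>+x. ennreal ((max 0 (g x))\<^sup>2) \<partial>\<mu>) < \<infinity>" using g(2) by (rule le_less_trans)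
  qed auto
  moreover have "L2_step_closure \<mu> (\<lambda>x. max 0 (- g x))"
  proof (rule pos)
    have "(\<integral>\<^sup>+x. ennreal ((max 0 (- g x))\<^sup>2) \<partial>\<mu>) \<le> (\<integral>\<^sup>+x. ennreal ((g x)\<^sup>2) \<partial>\<mu>)"
      by (intro nn_integral_mono ennreal_leI) (auto simp: max_def)
    then show "(\<integral>\<^sup>+x. ennreal ((max 0 (- g x))\<^sup>2) \<partial>\<mu>) < \<infinity>" using g(2) by (rule le_less_trans)
  qed auto
  ultimately have "L2_step_closure \<mu> (\<lambda>x. max 0 (g x) + (- 1) * max 0 (- g x))"
    by (intro L2_step_closure_add L2_step_closure_cmult \<mu>)
  moreover have "(\<lambda>x. max 0 (g x) + (- 1) * max 0 (- g x)) = g" by (auto simp: max_def)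
  ultimately show ?thesis by simp
qed


section \<open>Risk of the ensemble for fixed seeds\<close>

text \<open>
  The size of the net for combinations of \<open>K\<close> indicators of cells of depth \<open>r\<close> in dimension \<open>p\<close>, on the \<open>2 n\<close>
  points of two samples and with \<open>n + 1\<close> truncation levels.
\<close>

definition cover_bound :: "nat \<Rightarrow> nat \<Rightarrow> nat \<Rightarrow> nat \<Rightarrow> nat" where
  "cover_bound p r K n = ((2 * (2 * n + 1) ^ (p + 1)) ^ r) ^ K * (2 * n * (n + 1) + 1) ^ (K + 1)"

text \<open>
  \<open>n\<close> times the price of passing from empirical to expected truncated losses, uniformly over the net.
\<close>

definition net_penalty :: "nat \<Rightarrow> nat \<Rightarrow> nat \<Rightarrow> nat \<Rightarrow> real \<Rightarrow> real \<Rightarrow> real" where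
  "net_penalty p r K n \<epsilon> \<beta> = 24 * \<beta>\<^sup>2 / \<epsilon> * ln (real (cover_bound p r K n)) + 24 * \<beta>\<^sup>2"

lemma net_penalty_nonneg: "\<epsilon> > 0 \<Longrightarrow> 0 \<le> net_penalty p r K n \<epsilon> \<beta>"
proof -
  have "cover_bound p r K n \<ge> 1" by (simp add: cover_bound_def Suc_le_eq)
  moreover assume "\<epsilon> > 0"
  ultimately show ?thesis
    unfolding net_penalty_def by (intro add_nonneg_nonneg mult_nonneg_nonneg divide_nonneg_nonneg ln_ge_zero) auto
qed

lemma truncate_at_Lipschitz: "\<bar>truncate_at \<beta> x - truncate_at \<beta> y\<bar> \<le> \<bar>x - y\<bar>" if "\<beta> \<ge> 0"
  using that by (auto simp: truncate_at_def max_def min_def)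

lemma truncate_at_bounds: "\<beta> \<ge> 0 \<Longrightarrow> \<bar>truncate_at \<beta> x\<bar> \<le> \<beta>"
  by (auto simp: truncate_at_def max_def min_def)

lemma measurable_truncate_at [measurable]: "truncate_at \<beta> \<in> borel_measurable borel"
  unfolding truncate_at_def[abs_def] by measurable

definition truncated_loss :: "real \<Rightarrow> ('x \<Rightarrow> real) \<Rightarrow> 'x \<times> real \<Rightarrow> real" where
  "truncated_loss \<beta> f z = (truncate_at \<beta> (f (fst z)) - truncate_at \<beta> (snd z))\<^sup>2"

lemma truncated_loss_bounds:
  assumes "\<beta> \<ge> 0" shows "0 \<le> truncated_loss \<beta> f z" "truncated_loss \<beta> f z \<le> 4 * \<beta>\<^sup>2"
proof -
  have "\<bar>truncate_at \<beta> (f (fst z)) - truncate_at \<beta> (snd z)\<bar> \<le> \<bar>2 * \<beta>\<bar>"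
    using truncate_at_bounds[OF assms, of "f (fst z)"] truncate_at_bounds[OF assms, of "snd z"] assms by linarith
  then show "truncated_loss \<beta> f z \<le> 4 * \<beta>\<^sup>2"
    unfolding truncated_loss_def abs_le_square_iff by (simp add: power_mult_distrib)
qed (simp add: truncated_loss_def)

lemma abs_truncated_loss_le: "\<beta> \<ge> 0 \<Longrightarrow> \<bar>truncated_loss \<beta> f z\<bar> \<le> 4 * \<beta>\<^sup>2"
  using truncated_loss_bounds[of \<beta> f z] by simp

lemma truncated_loss_diff:
  assumes "\<beta> \<ge> 0" "\<bar>truncate_at \<beta> (f (fst z)) - truncate_at \<beta> (g (fst z))\<bar> \<le> \<eta>"
  shows "\<bar>truncated_loss \<beta> f z - truncated_loss \<beta> g z\<bar> \<le> 4 * \<beta> * \<eta>"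
proof -
  define a b c where "a = truncate_at \<beta> (f (fst z))" "b = truncate_at \<beta> (g (fst z))" "c = truncate_at \<beta> (snd z)"
  have "\<bar>a\<bar> \<le> \<beta>" "\<bar>b\<bar> \<le> \<beta>" "\<bar>c\<bar> \<le> \<beta>" unfolding a_b_c_def using truncate_at_bounds assms(1) by auto
  then have "\<bar>a + b - 2 * c\<bar> \<le> 4 * \<beta>" by linarith
  then have "\<bar>a - b\<bar> * \<bar>a + b - 2 * c\<bar> \<le> \<eta> * (4 * \<beta>)"
    using assms(2) by (intro mult_mono) (auto simp: a_b_c_def)
  moreover have "(a - c)\<^sup>2 - (b - c)\<^sup>2 = (a - b) * (a + b - 2 * c)"
    by (simp add: power2_eq_square algebra_simps)
  ultimately show ?thesis
    unfolding truncated_loss_def a_b_c_def[symmetric] by (simp add: abs_mult mult_ac)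
qed

text \<open>
  With \<open>n + 1\<close> levels the truncated functions of the net are \<open>2 \<beta> / n\<close>-dense, hence their losses are \<open>8 \<beta>\<^sup>2 /
  n\<close>-dense, and the discretization contributes just a constant multiple of \<open>\<beta>\<^sup>2\<close> to the sum over the points.
\<close>

lemma swapped_loss_le:
  fixes W :: "bool \<times> nat \<Rightarrow> (real ^ 'p) \<times> real" and est :: "nat set \<Rightarrow> real ^ 'p \<Rightarrow> real"
  assumes \<beta>: "\<beta> > 0" and \<epsilon>: "0 < \<epsilon>" "\<epsilon> \<le> 1" and n: "n \<ge> 1"
    and est: "\<And>\<sigma>. est \<sigma> \<in> span_class K (cells r)"
  shows "(\<Sum>\<sigma>\<in>Pow {..<n}. \<Sum>i<n. truncated_loss \<beta> (est \<sigma>) (W (i \<notin> \<sigma>, i)) - (1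
      + \<epsilon>) * truncated_loss \<beta> (est \<sigma>) (W (i \<in> \<sigma>, i)))
    \<le> 2 ^ n * net_penalty CARD('p) r K n \<epsilon> \<beta>"
proof -
  define P where "P = fst ` W ` (UNIV \<times> {..<n})"
  have finP: "finite P" by (auto simp: P_def)
  have "card P \<le> card (UNIV \<times> {..<n} :: (bool \<times> nat) set)"
    unfolding P_def image_image by (rule card_image_le) auto
  then have cardP: "card P \<le> 2 * n" by (simp add: card_cartesian_product)
  obtain C where C: "finite C" "C \<subseteq> span_class K (cells r)"
      "card C \<le> card ((\<lambda>A. A \<inter> P) ` cells r) ^ K * (card P * (n + 1) + 1) ^ (K + 1)"
    and net: "\<And>f. f \<in> span_class K (cells r) \<Longrightarrow>
        \<exists>g\<in>C. \<forall>x\<in>P. \<bar>truncate_at \<beta> (f x) - truncate_at \<beta> (g x)\<bar> \<le> 2 * \<beta> / real n"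
    using truncated_finite_net[OF finP \<beta>, of n K "cells r"] n by auto
  define C' where "C' = truncated_loss \<beta> ` C"
  have finC': "finite C'" using C(1) by (simp add: C'_def)
  have "card C' \<le> card C" unfolding C'_def by (rule card_image_le) fact
  also have "card C \<le> ((2 * (card P + 1) ^ (CARD('p) + 1)) ^ r) ^ K * (card P * (n + 1) + 1) ^ (K + 1)"
    using C(3) card_cell_traces[OF finP, of r] by (elim order_trans) (intro mult_right_mono power_mono, auto)
  also have "\<dots> \<le> cover_bound CARD('p) r K n"
    unfolding cover_bound_def using cardP
    by (intro mult_mono power_mono mult_left_mono add_mono) auto
  finally have cardC': "card C' \<le> cover_bound CARD('p) r K n" .
  have "C \<noteq> {}" using net[OF est] by auto
  then have "card C' \<ge> 1" using finC' by (simp add: C'_def Suc_le_eq card_gt_0_iff)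
  then have ln: "ln (real (card C')) \<le> ln (real (cover_bound CARD('p) r K n))"
    using cardC' by (subst ln_le_cancel_iff) auto
  have loss_net: "\<exists>g\<in>C'. \<forall>i\<in>{..<n}. \<bar>truncated_loss \<beta> (est \<sigma>) (W (False, i)) - g (W (False, i))\<bar> \<le> 8 * \<beta>\<^sup>2 / n
      \<and> \<bar>truncated_loss \<beta> (est \<sigma>) (W (True, i)) - g (W (True, i))\<bar> \<le> 8 * \<beta>\<^sup>2 / n" for \<sigma>
  proof -
    obtain g where g: "g \<in> C" "\<And>x. x \<in> P \<Longrightarrow> \<bar>truncate_at \<beta> (est \<sigma> x) - truncate_at \<beta> (g x)\<bar> \<le> 2 * \<beta> / real n"
      using net[OF est] by blast
    have "\<bar>truncated_loss \<beta> (est \<sigma>) (W (b, i)) - truncated_loss \<beta> g (W (b, i))\<bar> \<le> 8 * \<beta>\<^sup>2 / n" if "i < n" for b i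
    proof -
      have "fst (W (b, i)) \<in> P" using that unfolding P_def by auto
      then have "\<bar>truncated_loss \<beta> (est \<sigma>) (W (b, i)) - truncated_loss \<beta> g (W (b, i))\<bar> \<le> 4 * \<beta> * (2 * \<beta> / real n)"
        using \<beta> g(2) by (intro truncated_loss_diff) auto
      also have "\<dots> = 8 * \<beta>\<^sup>2 / n" by (simp add: power2_eq_square)
      finally show ?thesis .
    qed
    then show ?thesis using g(1) by (intro bexI[of _ "truncated_loss \<beta> g"]) (auto simp: C'_def)
  qed
  have sw: "W (i \<notin> \<sigma>, i) = (if i \<in> \<sigma> then W (False, i) else W (True, i))"
    "W (i \<in> \<sigma>, i) = (if i \<in> \<sigma> then W (True, i) else W (False, i))" for i and \<sigma> :: "nat set" by auto
  have "(\<Sum>\<sigma>\<in>Pow {..<n}. \<Sum>i<n. truncated_loss \<beta> (est \<sigma>) (W (i \<notin> \<sigma>, i)) - (1 + \<epsilon>) * truncated_loss \<beta> (est \<sigma>) (W (i \<in> \<sigma>, i)))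
    \<le> 2 ^ card {..<n} * (6 * (4 * \<beta>\<^sup>2) / \<epsilon> * ln (real (card C')) + 3 * (8 * \<beta>\<^sup>2 / n) * real (card {..<n}))"
    unfolding sw
  proof (rule sum_swaps_le)
    show "0 \<le> g x \<and> g x \<le> 4 * \<beta>\<^sup>2" if g: "g \<in> C'" for g x
    proof -
      obtain f where "g = truncated_loss \<beta> f" using g by (auto simp: C'_def)
      then show ?thesis using truncated_loss_bounds[of \<beta> f x] \<beta> by simp
    qed
  qed (use \<beta> \<epsilon> finC' loss_net in auto)
  also have "\<dots> = 2 ^ n * (24 * \<beta>\<^sup>2 / \<epsilon> * ln (real (card C')) + 24 * \<beta>\<^sup>2)" using n by simp
  also have "\<dots> \<le> 2 ^ n * net_penalty CARD('p) r K n \<epsilon> \<beta>"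
    unfolding net_penalty_def using ln \<epsilon> by (intro mult_left_mono add_right_mono) auto
  finally show ?thesis .
qed

lemma square_add_le_weighted:
  fixes a b \<epsilon> :: real
  assumes "\<epsilon> > 0" shows "(a + b)\<^sup>2 \<le> (1 + \<epsilon>) * a\<^sup>2 + (1 + 1 / \<epsilon>) * b\<^sup>2"
proof -
  have "0 \<le> (\<epsilon> * a - b)\<^sup>2 / \<epsilon>" using assms by simp
  also have "\<dots> = \<epsilon> * a\<^sup>2 - 2 * a * b + b\<^sup>2 / \<epsilon>" using assms by (simp add: power2_eq_square field_simps)
  finally show ?thesis by (simp add: power2_eq_square algebra_simps)
qed

lemma integral_sample_mean:
  fixes \<phi> :: "'z \<Rightarrow> real" and n :: nat
  assumes "prob_space \<nu>" "integrable \<nu> \<phi>" "n \<ge> 1"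
  shows "integrable (Pi\<^sub>M {..<n} (\<lambda>_. \<nu>)) (\<lambda>D. (\<Sum>i<n. \<phi> (D i)) / n)"
    and "(\<integral>D. (\<Sum>i<n. \<phi> (D i)) / n \<partial>Pi\<^sub>M {..<n} (\<lambda>_. \<nu>)) = (\<integral>z. \<phi> z \<partial>\<nu>)"
proof -
  interpret product_prob_space "\<lambda>_::nat. \<nu>" UNIV
    using assms(1) by (simp add: product_prob_space_def product_prob_space_axioms_def product_sigma_finite_def
        prob_space_imp_sigma_finite)
  let ?P = "Pi\<^sub>M {..<n} (\<lambda>_. \<nu>)"
  have distr: "distr ?P \<nu> (\<lambda>D. D i) = \<nu>" if "i < n" for i
    using distr_PiM_component[of "{..<n}" "\<lambda>_. \<nu>" i] that assms(1) by simp
  have meas: "(\<lambda>D. D i) \<in> measurable ?P \<nu>" if "i < n" for i using that by (intro measurable_component_singleton) auto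
  have int: "integrable ?P (\<lambda>D. \<phi> (D i))" and eq: "(\<integral>D. \<phi> (D i) \<partial>?P) = (\<integral>z. \<phi> z \<partial>\<nu>)" if "i < n" for i
  proof -
    have "integrable (distr ?P \<nu> (\<lambda>D. D i)) \<phi>" unfolding distr[OF that] by fact
    then show "integrable ?P (\<lambda>D. \<phi> (D i))"
      using integrable_distr_eq[OF meas[OF that], of \<phi>] assms(2) by simp
    have "(\<integral>z. \<phi> z \<partial>distr ?P \<nu> (\<lambda>D. D i)) = (\<integral>D. \<phi> (D i) \<partial>?P)"
      using assms(2) by (intro integral_distr meas[OF that]) auto
    then show "(\<integral>D. \<phi> (D i) \<partial>?P) = (\<integral>z. \<phi> z \<partial>\<nu>)" unfolding distr[OF that] by simp
  qed
  show "integrable ?P (\<lambda>D. (\<Sum>i<n. \<phi> (D i)) / n)"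
    by (intro integrable_divide Bochner_Integration.integrable_sum int) auto
  have "(\<integral>D. (\<Sum>i<n. \<phi> (D i)) \<partial>?P) = (\<Sum>i<n. \<integral>D. \<phi> (D i) \<partial>?P)"
    by (rule Bochner_Integration.integral_sum) (use int in auto)
  also have "\<dots> = n * (\<integral>z. \<phi> z \<partial>\<nu>)" using eq by simp
  finally show "(\<integral>D. (\<Sum>i<n. \<phi> (D i)) / n \<partial>?P) = (\<integral>z. \<phi> z \<partial>\<nu>)" using assms(3) by simp
qed

lemma mean_square_le:
  fixes g :: "nat \<Rightarrow> real" assumes B: "B \<ge> 1"
  shows "((\<Sum>b=1..B. g b) / B - y)\<^sup>2 \<le> (\<Sum>b=1..B. (g b - y)\<^sup>2) / B"
proof -
  have "(\<Sum>b=1..B. g b) / B - y = (\<Sum>b=1..B. g b - y) / B"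
    using B by (simp add: sum_subtractf diff_divide_distrib)
  moreover have "(\<Sum>b=1..B. 1 * (g b - y))\<^sup>2 \<le> (\<Sum>b=1..B. 1\<^sup>2) * (\<Sum>b=1..B. (g b - y)\<^sup>2)"
    by (rule Cauchy_Schwarz_ineq_sum)
  then have "(\<Sum>b=1..B. g b - y)\<^sup>2 \<le> B * (\<Sum>b=1..B. (g b - y)\<^sup>2)" by simp
  then have "(\<Sum>b=1..B. g b - y)\<^sup>2 / B\<^sup>2 \<le> (\<Sum>b=1..B. (g b - y)\<^sup>2) / B"
    using B by (simp add: field_simps power2_eq_square)
  ultimately show ?thesis by (simp add: power_divide)
qed

lemma integrable_mult_of_squares:
  fixes f g :: "'a \<Rightarrow> real"
  assumes [measurable]: "f \<in> borel_measurable M" "g \<in> borel_measurable M"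
    and "integrable M (\<lambda>z. (f z)\<^sup>2)" "integrable M (\<lambda>z. (g z)\<^sup>2)"
  shows "integrable M (\<lambda>z. f z * g z)"
proof (rule Bochner_Integration.integrable_bound[of _ "\<lambda>z. (f z)\<^sup>2 + (g z)\<^sup>2"])
  show "AE z in M. norm (f z * g z) \<le> norm ((f z)\<^sup>2 + (g z)\<^sup>2)"
  proof (rule AE_I2)
    fix z
    have "0 \<le> (\<bar>f z\<bar> - \<bar>g z\<bar>)\<^sup>2" by simp
    then have "2 * (\<bar>f z\<bar> * \<bar>g z\<bar>) \<le> (f z)\<^sup>2 + (g z)\<^sup>2" by (simp add: power2_diff)
    moreover have "0 \<le> \<bar>f z\<bar> * \<bar>g z\<bar>" by simp
    ultimately have "\<bar>f z\<bar> * \<bar>g z\<bar> \<le> (f z)\<^sup>2 + (g z)\<^sup>2" by linarith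
    then show "norm (f z * g z) \<le> norm ((f z)\<^sup>2 + (g z)\<^sup>2)" by (simp add: abs_mult)
  qed
qed (use assms in auto)

text \<open>
  Only the law \<open>\<nu>\<close> of the pair matters for fixed seeds. The regression function enters through the orthogonality
  of \<open>Y - m X\<close> to the square-integrable functions of \<open>X\<close>.
\<close>

locale regression_law = prob_space \<nu>
  for \<nu> :: "((real ^ 'p) \<times> real) measure" +
  fixes m :: "real ^ 'p \<Rightarrow> real"
  assumes sets_law [measurable_cong]: "sets \<nu> = sets borel"
    and in_cube: "AE z in \<nu>. fst z \<in> cbox 0 1"
    and response_L2: "integrable \<nu> (\<lambda>z. (snd z)\<^sup>2)"
    and m_measurable [measurable]: "m \<in> borel_measurable borel"
    and m_L2: "integrable \<nu> (\<lambda>z. (m (fst z))\<^sup>2)"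
    and orthogonal: "\<And>g. g \<in> borel_measurable borel \<Longrightarrow> integrable \<nu> (\<lambda>z. (g (fst z))\<^sup>2) \<Longrightarrow>
        (\<integral>z. (snd z - m (fst z)) * g (fst z) \<partial>\<nu>) = 0"
begin

abbreviation sample :: "nat \<Rightarrow> (nat \<Rightarrow> (real ^ 'p) \<times> real) measure" where
  "sample n \<equiv> Pi\<^sub>M {..<n} (\<lambda>_. \<nu>)"

lemma fst_snd_measurable [measurable]: "fst \<in> measurable \<nu> borel" "snd \<in> borel_measurable \<nu>"
proof -
  have "fst \<in> measurable borel (borel :: (real ^ 'p) measure)" "snd \<in> measurable (borel :: ((real ^ 'p) \<times> real)
      measure) borel"
    by (intro borel_measurable_continuous_onI continuous_intros)+
  then show "fst \<in> measurable \<nu> borel" "snd \<in> borel_measurable \<nu>"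
    unfolding measurable_cong_sets[OF sets_law refl] .
qed

lemma integrable_square_diff:
  fixes f g :: "(real ^ 'p) \<times> real \<Rightarrow> real"
  assumes [measurable]: "f \<in> borel_measurable \<nu>" "g \<in> borel_measurable \<nu>"
    and "integrable \<nu> (\<lambda>z. (f z)\<^sup>2)" "integrable \<nu> (\<lambda>z. (g z)\<^sup>2)"
  shows "integrable \<nu> (\<lambda>z. (f z - g z)\<^sup>2)"
proof -
  have "integrable \<nu> (\<lambda>z. (f z)\<^sup>2 - 2 * (f z * g z) + (g z)\<^sup>2)"
    using assms integrable_mult_of_squares[OF assms] by auto
  moreover have "(\<lambda>z. (f z)\<^sup>2 - 2 * (f z * g z) + (g z)\<^sup>2) = (\<lambda>z. (f z - g z)\<^sup>2)"
    by (auto simp: power2_eq_square algebra_simps)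
  ultimately show ?thesis by simp
qed

definition noise :: real where "noise = (\<integral>z. (snd z - m (fst z))\<^sup>2 \<partial>\<nu>)"

lemma risk_decomposition:
  assumes [measurable]: "g \<in> borel_measurable borel" and g: "integrable \<nu> (\<lambda>z. (g (fst z))\<^sup>2)"
  shows "(\<integral>z. (snd z - g (fst z))\<^sup>2 \<partial>\<nu>) = noise + (\<integral>z. (g (fst z) - m (fst z))\<^sup>2 \<partial>\<nu>)"
proof -
  have gm: "integrable \<nu> (\<lambda>z. (g (fst z) - m (fst z))\<^sup>2)"
    by (rule integrable_square_diff) (use g m_L2 in auto)
  have ym: "integrable \<nu> (\<lambda>z. (snd z - m (fst z))\<^sup>2)"
    by (rule integrable_square_diff) (use response_L2 m_L2 in auto)
  have cross: "integrable \<nu> (\<lambda>z. (snd z - m (fst z)) * (g (fst z) - m (fst z)))"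
    by (rule integrable_mult_of_squares) (use gm ym in auto)
  have "(\<integral>z. (snd z - g (fst z))\<^sup>2 \<partial>\<nu>) = (\<integral>z. ((snd z - m (fst z))\<^sup>2 + (g (fst z) - m (fst z))\<^sup>2)
      - 2 * ((snd z - m (fst z)) * (g (fst z) - m (fst z))) \<partial>\<nu>)"
    by (intro Bochner_Integration.integral_cong refl) (simp add: power2_eq_square algebra_simps)
  also have "\<dots> = (\<integral>z. (snd z - m (fst z))\<^sup>2 \<partial>\<nu>) + (\<integral>z. (g (fst z) - m (fst z))\<^sup>2 \<partial>\<nu>)
      - 2 * (\<integral>z. (snd z - m (fst z)) * (g (fst z) - m (fst z)) \<partial>\<nu>)"
    using gm ym cross by simp
  also have "(\<integral>z. (snd z - m (fst z)) * (g (fst z) - m (fst z)) \<partial>\<nu>) = 0"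
    using orthogonal[of "\<lambda>x. g x - m x"] gm by simp
  finally show ?thesis by (simp add: noise_def)
qed

definition tail :: "real \<Rightarrow> real" where "tail \<beta> = (\<integral>z. (snd z - truncate_at \<beta> (snd z))\<^sup>2 \<partial>\<nu>)"

text \<open>
  The untruncated risk of the truncated estimator dominates its estimation error, while its loss against the
  truncated response is what the empirical comparison controls. The weighted square splits off the truncation of
  the response.
\<close>

lemma truncated_risk_le:
  assumes [measurable]: "g \<in> borel_measurable borel" and \<beta>: "\<beta> \<ge> 0" and \<epsilon>: "\<epsilon> > 0"
  shows "noise + (\<integral>z. (truncate_at \<beta> (g (fst z)) - m (fst z))\<^sup>2 \<partial>\<nu>)
     \<le> (1 + \<epsilon>) * (\<integral>z. truncated_loss \<beta> g z \<partial>\<nu>) + (1 + 1 / \<epsilon>) * tail \<beta>"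
proof -
  have bnd: "integrable \<nu> (\<lambda>z. (truncate_at \<beta> (h z))\<^sup>2)" if [measurable]: "h \<in> borel_measurable \<nu>" for h
  proof (rule integrable_const_bound[where B="\<beta>\<^sup>2"])
    have "(truncate_at \<beta> x)\<^sup>2 \<le> \<beta>\<^sup>2" for x
      using truncate_at_bounds[OF \<beta>, of x] \<beta> by (simp add: abs_le_square_iff[symmetric])
    then show "AE z in \<nu>. norm ((truncate_at \<beta> (h z))\<^sup>2) \<le> \<beta>\<^sup>2" by simp
  qed measurable
  have tg: "integrable \<nu> (\<lambda>z. (truncate_at \<beta> (g (fst z)))\<^sup>2)" by (rule bnd) measurable
  have ty: "integrable \<nu> (\<lambda>z. (truncate_at \<beta> (snd z))\<^sup>2)" by (rule bnd) measurable
  have i1: "integrable \<nu> (\<lambda>z. (snd z - truncate_at \<beta> (g (fst z)))\<^sup>2)"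
    by (rule integrable_square_diff) (use response_L2 tg in auto)
  have i2: "integrable \<nu> (truncated_loss \<beta> g)"
    unfolding truncated_loss_def[abs_def] by (rule integrable_square_diff) (use ty tg in auto)
  have i3: "integrable \<nu> (\<lambda>z. (snd z - truncate_at \<beta> (snd z))\<^sup>2)"
    by (rule integrable_square_diff) (use response_L2 ty in auto)
  have "noise + (\<integral>z. (truncate_at \<beta> (g (fst z)) - m (fst z))\<^sup>2 \<partial>\<nu>)
      = (\<integral>z. (snd z - truncate_at \<beta> (g (fst z)))\<^sup>2 \<partial>\<nu>)"
    using tg by (intro risk_decomposition[symmetric]) auto
  also have "\<dots> \<le> (\<integral>z. (1 + \<epsilon>) * truncated_loss \<beta> g z + (1 + 1 / \<epsilon>) * (snd z - truncate_at \<beta> (snd z))\<^sup>2 \<partial>\<nu>)"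
  proof (rule integral_mono)
    fix z
    have "(snd z - truncate_at \<beta> (g (fst z)))\<^sup>2
      = ((truncate_at \<beta> (snd z) - truncate_at \<beta> (g (fst z))) + (snd z - truncate_at \<beta> (snd z)))\<^sup>2" by simp
    also have "\<dots> \<le> (1 + \<epsilon>) * (truncate_at \<beta> (snd z) - truncate_at \<beta> (g (fst z)))\<^sup>2 + (1 + 1 / \<epsilon>) * (snd z
        - truncate_at \<beta> (snd z))\<^sup>2"
      by (rule square_add_le_weighted) fact
    finally show "(snd z - truncate_at \<beta> (g (fst z)))\<^sup>2
       \<le> (1 + \<epsilon>) * truncated_loss \<beta> g z + (1 + 1 / \<epsilon>) * (snd z - truncate_at \<beta> (snd z))\<^sup>2"
      by (simp add: truncated_loss_def power2_commute)
  qed (use i1 i2 i3 in auto)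
  also have "\<dots> = (1 + \<epsilon>) * (\<integral>z. truncated_loss \<beta> g z \<partial>\<nu>) + (1 + 1 / \<epsilon>) * tail \<beta>"
    using i2 i3 by (simp add: tail_def)
  finally show ?thesis .
qed

lemma prob_space_sample: "prob_space (sample n)"
  by (intro prob_space_PiM) (rule prob_space_axioms)

lemma sample_measurable:
  assumes g: "(\<lambda>(D, x). g D x) \<in> borel_measurable (Pi\<^sub>M {..<n} (\<lambda>_. borel) \<Otimes>\<^sub>M borel)"
    and F: "F \<in> measurable N (sample n)" and G: "G \<in> measurable N borel"
  shows "(\<lambda>x. g (F x) (G x)) \<in> borel_measurable N"
proof -
  have sets_P: "sets (sample n) = sets (Pi\<^sub>M {..<n} (\<lambda>_. borel))" by (intro sets_PiM_cong sets_law refl)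
  have "F \<in> measurable N (Pi\<^sub>M {..<n} (\<lambda>_. borel))" using F unfolding measurable_cong_sets[OF refl sets_P] .
  from measurable_compose[OF measurable_Pair[OF this G] g] show ?thesis by simp
qed

lemma AE_sample_in_cube: "AE D in sample n. \<forall>i<n. fst (D i) \<in> cbox 0 1"
proof -
  have "AE D in sample n. fst (D i) \<in> cbox 0 1" if "i < n" for i
    using that in_cube prob_space_axioms by (intro AE_PiM_component) auto
  then have "AE D in sample n. \<forall>i\<in>{..<n}. fst (D i) \<in> cbox 0 1"
    by (subst AE_finite_all) auto
  then show ?thesis unfolding Ball_def lessThan_iff .
qed

text \<open>
  Truncation at \<open>\<beta>\<close> is a contraction, so the truncated empirical loss is at most the untruncated training error,
  which is bounded by the sample mean of a fixed integrable function \<open>\<phi>\<close>. That the sample lies in the cube holds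
  almost surely.
\<close>

lemma expected_truncated_loss_le:
  fixes est :: "(nat \<Rightarrow> (real ^ 'p) \<times> real) \<Rightarrow> real ^ 'p \<Rightarrow> real"
  assumes \<beta>: "\<beta> > 0" and \<epsilon>: "0 < \<epsilon>" "\<epsilon> \<le> 1" and n: "n \<ge> 1"
    and est: "\<And>D. est D \<in> span_class K (cells r)"
    and meas: "(\<lambda>(D, x). est D x) \<in> borel_measurable (Pi\<^sub>M {..<n} (\<lambda>_. borel) \<Otimes>\<^sub>M borel)"
    and \<phi>: "integrable \<nu> \<phi>"
    and training: "\<And>D. (\<And>i. i < n \<Longrightarrow> fst (D i) \<in> cbox 0 1) \<Longrightarrow>
       (\<Sum>i<n. (snd (D i) - est D (fst (D i)))\<^sup>2) / n \<le> (\<Sum>i<n. \<phi> (D i)) / n"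
  shows "(\<integral>D. (\<integral>z. truncated_loss \<beta> (est D) z \<partial>\<nu>) \<partial>sample n)
      \<le> (1 + \<epsilon>) * (\<integral>z. \<phi> z \<partial>\<nu>) + net_penalty CARD('p) r K n \<epsilon> \<beta> / n"
proof -
  let ?P = "sample n"
  interpret P: prob_space ?P by (rule prob_space_sample)
  note est_m = sample_measurable[OF meas]
  have loss_m: "(\<lambda>(D, z). truncated_loss \<beta> (est D) z) \<in> borel_measurable (?P \<Otimes>\<^sub>M \<nu>)"
  proof -
    have [measurable]: "(\<lambda>x. est (fst x) (fst (snd x))) \<in> borel_measurable (?P \<Otimes>\<^sub>M \<nu>)"
      by (rule est_m) measurable
    show ?thesis unfolding truncated_loss_def case_prod_beta by measurable
  qed
  have "(\<integral>D. (\<integral>z. truncated_loss \<beta> (est D) z \<partial>\<nu>) \<partial>?P)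
      \<le> (1 + \<epsilon>) * (\<integral>D. (\<Sum>i<n. truncated_loss \<beta> (est D) (D i)) / n \<partial>?P)
        + net_penalty CARD('p) r K n \<epsilon> \<beta> / n"
  proof (rule expected_risk_le_empirical[where b="4 * \<beta>\<^sup>2"])
    show "0 \<le> truncated_loss \<beta> (est D) z \<and> truncated_loss \<beta> (est D) z \<le> 4 * \<beta>\<^sup>2" for D z
      using truncated_loss_bounds[of \<beta> "est D" z] \<beta> by simp
    show "(\<Sum>\<sigma>\<in>Pow {..<n}. \<Sum>i<n. truncated_loss \<beta> (est (\<lambda>j\<in>{..<n}. W (j \<in> \<sigma>, j))) (W (i \<notin> \<sigma>, i))
          - (1 + \<epsilon>) * truncated_loss \<beta> (est (\<lambda>j\<in>{..<n}. W (j \<in> \<sigma>, j))) (W (i \<in> \<sigma>, i)))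
        \<le> 2 ^ n * net_penalty CARD('p) r K n \<epsilon> \<beta>" for W
      by (rule swapped_loss_le) (use \<beta> \<epsilon> n est in auto)
  qed (use prob_space_axioms n loss_m in auto)
  also have "(\<integral>D. (\<Sum>i<n. truncated_loss \<beta> (est D) (D i)) / n \<partial>?P) \<le> (\<integral>D. (\<Sum>i<n. \<phi> (D i)) / n \<partial>?P)"
  proof (rule integral_mono_AE)
    have lm: "(\<lambda>D. truncated_loss \<beta> (est D) (D i)) \<in> borel_measurable ?P" if "i < n" for i
    proof -
      have "(\<lambda>D. (D, D i)) \<in> measurable ?P (?P \<Otimes>\<^sub>M \<nu>)"
        using that by (intro measurable_Pair measurable_component_singleton measurable_ident_sets) auto
      from measurable_compose[OF this loss_m] show ?thesis by simp
    qed
    have li: "integrable ?P (\<lambda>D. truncated_loss \<beta> (est D) (D i))" if "i < n" for i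
      by (intro P.integrable_const_bound[where B="4 * \<beta>\<^sup>2"] AE_I2 lm[OF that])
        (simp add: abs_truncated_loss_le less_imp_le[OF \<beta>])
    show "integrable ?P (\<lambda>D. (\<Sum>i<n. truncated_loss \<beta> (est D) (D i)) / n)"
      by (intro integrable_divide Bochner_Integration.integrable_sum li) auto
    show "integrable ?P (\<lambda>D. (\<Sum>i<n. \<phi> (D i)) / n)"
      by (rule integral_sample_mean(1)) (use prob_space_axioms \<phi> n in auto)
    show "AE D in ?P. (\<Sum>i<n. truncated_loss \<beta> (est D) (D i)) / n \<le> (\<Sum>i<n. \<phi> (D i)) / n"
      using AE_sample_in_cube[of n]
    proof eventually_elim
      case (elim D)
      have "(\<Sum>i<n. truncated_loss \<beta> (est D) (D i)) \<le> (\<Sum>i<n. (snd (D i) - est D (fst (D i)))\<^sup>2)"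
      proof (rule sum_mono)
        fix i
        show "truncated_loss \<beta> (est D) (D i) \<le> (snd (D i) - est D (fst (D i)))\<^sup>2"
          unfolding truncated_loss_def abs_le_square_iff[symmetric]
          using truncate_at_Lipschitz[of \<beta> "est D (fst (D i))" "snd (D i)"] \<beta> by (simp add: abs_minus_commute)
      qed
      then have "(\<Sum>i<n. truncated_loss \<beta> (est D) (D i)) / n \<le> (\<Sum>i<n. (snd (D i) - est D (fst (D i)))\<^sup>2) / n"
        by (rule divide_right_mono) simp
      also have "\<dots> \<le> (\<Sum>i<n. \<phi> (D i)) / n" by (rule training) (use elim in auto)
      finally show ?case .
    qed
  qed
  also have "(\<integral>D. (\<Sum>i<n. \<phi> (D i)) / n \<partial>?P) = (\<integral>z. \<phi> z \<partial>\<nu>)"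
    by (rule integral_sample_mean(2)) (use prob_space_axioms \<phi> n in auto)
  finally show ?thesis using \<epsilon> by simp
qed

lemma expected_estimation_error_le:
  fixes est :: "(nat \<Rightarrow> (real ^ 'p) \<times> real) \<Rightarrow> real ^ 'p \<Rightarrow> real"
  assumes \<beta>: "\<beta> > 0" and \<epsilon>: "0 < \<epsilon>" "\<epsilon> \<le> 1" and n: "n \<ge> 1"
    and est: "\<And>D. est D \<in> span_class K (cells r)"
    and meas: "(\<lambda>(D, x). est D x) \<in> borel_measurable (Pi\<^sub>M {..<n} (\<lambda>_. borel) \<Otimes>\<^sub>M borel)"
    and \<phi>: "integrable \<nu> \<phi>"
    and training: "\<And>D. (\<And>i. i < n \<Longrightarrow> fst (D i) \<in> cbox 0 1) \<Longrightarrow>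
       (\<Sum>i<n. (snd (D i) - est D (fst (D i)))\<^sup>2) / n \<le> (\<Sum>i<n. \<phi> (D i)) / n"
  shows "(\<integral>\<^sup>+D. (\<integral>\<^sup>+x. ennreal ((truncate_at \<beta> (est D x) - m x)\<^sup>2) \<partial>distr \<nu> borel fst) \<partial>sample n)
    \<le> ennreal ((1 + \<epsilon>) * ((1 + \<epsilon>) * (\<integral>z. \<phi> z \<partial>\<nu>)
        + net_penalty CARD('p) r K n \<epsilon> \<beta> / n)
        + (1 + 1 / \<epsilon>) * tail \<beta> - noise)"
proof -
  let ?P = "sample n"
  interpret P: prob_space ?P by (rule prob_space_sample)
  note est_m = sample_measurable[OF meas]
  have estD [measurable]: "est D \<in> borel_measurable borel" if "D \<in> space ?P" for D
    by (rule est_m) (use that in auto)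
  have [measurable]: "(\<lambda>x. est (fst x) (fst (snd x))) \<in> borel_measurable (?P \<Otimes>\<^sub>M \<nu>)"
    by (rule est_m) measurable
  define err where "err D = (\<integral>z. (truncate_at \<beta> (est D (fst z)) - m (fst z))\<^sup>2 \<partial>\<nu>)" for D
  define loss where "loss D = (\<integral>z. truncated_loss \<beta> (est D) z \<partial>\<nu>)" for D
  have err_m: "err \<in> borel_measurable ?P"
  proof -
    have "(\<lambda>(D, z). (truncate_at \<beta> (est D (fst z)) - m (fst z))\<^sup>2) \<in> borel_measurable (?P \<Otimes>\<^sub>M \<nu>)"
      unfolding case_prod_beta by measurable
    then show ?thesis unfolding err_def[abs_def] by (rule borel_measurable_lebesgue_integral)
  qed
  have loss_m: "loss \<in> borel_measurable ?P"
  proof -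
    have "(\<lambda>(D, z). truncated_loss \<beta> (est D) z) \<in> borel_measurable (?P \<Otimes>\<^sub>M \<nu>)"
      unfolding truncated_loss_def case_prod_beta by measurable
    then show ?thesis unfolding loss_def[abs_def] by (rule borel_measurable_lebesgue_integral)
  qed
  have err_nn: "err D \<ge> 0" for D unfolding err_def by simp
  have tr_L2: "integrable \<nu> (\<lambda>z. (truncate_at \<beta> (est D (fst z)))\<^sup>2)" if D: "D \<in> space ?P" for D
  proof (rule integrable_const_bound[where B="\<beta>\<^sup>2"])
    have "(truncate_at \<beta> x)\<^sup>2 \<le> \<beta>\<^sup>2" for x
      using truncate_at_bounds[of \<beta> x] \<beta> by (simp add: abs_le_square_iff[symmetric])
    then show "AE z in \<nu>. norm ((truncate_at \<beta> (est D (fst z)))\<^sup>2) \<le> \<beta>\<^sup>2" by simp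
  qed (use estD[OF D] in measurable)
  have inner: "(\<integral>\<^sup>+x. ennreal ((truncate_at \<beta> (est D x) - m x)\<^sup>2) \<partial>distr \<nu> borel fst) = ennreal (err D)"
    if D: "D \<in> space ?P" for D
  proof -
    note [measurable] = estD[OF D]
    have "(\<integral>\<^sup>+x. ennreal ((truncate_at \<beta> (est D x) - m x)\<^sup>2) \<partial>distr \<nu> borel fst)
       = (\<integral>\<^sup>+z. ennreal ((truncate_at \<beta> (est D (fst z)) - m (fst z))\<^sup>2) \<partial>\<nu>)"
      by (rule nn_integral_distr) measurable
    also have "\<dots> = ennreal (err D)"
      unfolding err_def using tr_L2[OF D] m_L2
      by (intro nn_integral_eq_integral integrable_square_diff) auto
    finally show ?thesis .
  qed
  have le: "noise + err D \<le> (1 + \<epsilon>) * loss D + (1 + 1 / \<epsilon>) * tail \<beta>" if D: "D \<in> space ?P" for D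
    unfolding err_def loss_def by (rule truncated_risk_le) (use estD[OF D] \<beta> \<epsilon> in auto)
  have loss_int: "integrable ?P loss"
  proof (rule P.integrable_const_bound[where B="4 * \<beta>\<^sup>2"])
    have "\<bar>loss D\<bar> \<le> 4 * \<beta>\<^sup>2" if D: "D \<in> space ?P" for D
    proof -
      note [measurable] = estD[OF D]
      have "loss D \<le> 4 * \<beta>\<^sup>2" unfolding loss_def
      proof (rule integral_le_const)
        show "integrable \<nu> (truncated_loss \<beta> (est D))"
          using truncated_loss_bounds[of \<beta> "est D"] \<beta>
          by (intro integrable_const_bound[where B="4 * \<beta>\<^sup>2"]) (auto simp: truncated_loss_def[abs_def])
      qed (intro AE_I2 truncated_loss_bounds less_imp_le[OF \<beta>])
      moreover have "loss D \<ge> 0" unfolding loss_def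
        by (intro Bochner_Integration.integral_nonneg truncated_loss_bounds(1) less_imp_le[OF \<beta>])
      ultimately show ?thesis by simp
    qed
    then show "AE D in ?P. norm (loss D) \<le> 4 * \<beta>\<^sup>2" by (intro AE_I2) simp
  qed (rule loss_m)
  have err_int: "integrable ?P err"
  proof (rule Bochner_Integration.integrable_bound)
    show "integrable ?P (\<lambda>D. (1 + \<epsilon>) * loss D + ((1 + 1 / \<epsilon>) * tail \<beta> - noise))" using loss_int by auto
    show "AE D in ?P. norm (err D) \<le> norm ((1 + \<epsilon>) * loss D + ((1 + 1 / \<epsilon>) * tail \<beta> - noise))"
      using le err_nn by (intro AE_I2) (smt (verit) real_norm_def)
  qed (rule err_m)
  have "(\<integral>\<^sup>+D. (\<integral>\<^sup>+x. ennreal ((truncate_at \<beta> (est D x) - m x)\<^sup>2) \<partial>distr \<nu> borel fst) \<partial>?P)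
     = (\<integral>\<^sup>+D. ennreal (err D) \<partial>?P)"
    by (intro nn_integral_cong inner)
  also have "\<dots> = ennreal (\<integral>D. err D \<partial>?P)"
    using err_int err_nn by (intro nn_integral_eq_integral) auto
  also have "\<dots> \<le> ennreal ((1 + \<epsilon>) * ((1 + \<epsilon>) * (\<integral>z. \<phi> z \<partial>\<nu>)
        + net_penalty CARD('p) r K n \<epsilon> \<beta> / n)
        + (1 + 1 / \<epsilon>) * tail \<beta> - noise)"
  proof (rule ennreal_leI)
    have "(\<integral>D. err D \<partial>?P) \<le> (\<integral>D. (1 + \<epsilon>) * loss D + ((1 + 1 / \<epsilon>) * tail \<beta> - noise) \<partial>?P)"
      using le loss_int err_int by (intro integral_mono) (auto simp: algebra_simps)
    also have "\<dots> = (1 + \<epsilon>) * (\<integral>D. loss D \<partial>?P) + ((1 + 1 / \<epsilon>) * tail \<beta> - noise)"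
      using loss_int by (simp add: P.prob_space)
    also have "(\<integral>D. loss D \<partial>?P) \<le> (1 + \<epsilon>) * (\<integral>z. \<phi> z \<partial>\<nu>)
        + net_penalty CARD('p) r K n \<epsilon> \<beta> / n"
      unfolding loss_def by (rule expected_truncated_loss_le) fact+
    finally show "(\<integral>D. err D \<partial>?P) \<le> (1 + \<epsilon>) * ((1 + \<epsilon>) * (\<integral>z. \<phi> z \<partial>\<nu>)
        + net_penalty CARD('p) r K n \<epsilon> \<beta> / n)
        + (1 + 1 / \<epsilon>) * tail \<beta> - noise" using \<epsilon> by simp
  qed
  finally show ?thesis .
qed

lemma tail_vanishes:
  assumes "filterlim \<beta> at_top sequentially"
  shows "(\<lambda>n. tail (\<beta> n)) \<longlonglongrightarrow> 0"
proof -
  \<comment> \<open>for negative \<open>\<beta>\<close> the truncated value is \<open>- \<beta>\<close>, and the difference is not dominated by the response\<close>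
  define \<beta>' where "\<beta>' n = max 0 (\<beta> n)" for n
  have lim: "(\<lambda>n. tail (\<beta>' n)) \<longlonglongrightarrow> (\<integral>z. 0 \<partial>\<nu>)"
    unfolding tail_def
  proof (rule integral_dominated_convergence)
    show "integrable \<nu> (\<lambda>z. (snd z)\<^sup>2)" by (rule response_L2)
    show "AE z in \<nu>. (\<lambda>n. (snd z - truncate_at (\<beta>' n) (snd z))\<^sup>2) \<longlonglongrightarrow> 0"
    proof (rule AE_I2)
      fix z :: "(real ^ 'p) \<times> real"
      have "\<forall>\<^sub>F n in sequentially. \<bar>snd z\<bar> \<le> \<beta> n" using assms by (simp add: filterlim_at_top)
      then have "\<forall>\<^sub>F n in sequentially. (snd z - truncate_at (\<beta>' n) (snd z))\<^sup>2 = 0"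
        by eventually_elim (auto simp: truncate_at_def \<beta>'_def)
      then show "(\<lambda>n. (snd z - truncate_at (\<beta>' n) (snd z))\<^sup>2) \<longlonglongrightarrow> 0" by (rule tendsto_eventually)
    qed
    show "AE z in \<nu>. norm ((snd z - truncate_at (\<beta>' n) (snd z))\<^sup>2) \<le> (snd z)\<^sup>2" for n
    proof (rule AE_I2)
      fix z :: "(real ^ 'p) \<times> real"
      have "\<bar>snd z - truncate_at (\<beta>' n) (snd z)\<bar> \<le> \<bar>snd z\<bar>"
        by (auto simp: truncate_at_def \<beta>'_def)
      then show "norm ((snd z - truncate_at (\<beta>' n) (snd z))\<^sup>2) \<le> (snd z)\<^sup>2"
        by (simp add: abs_le_square_iff)
    qed
  qed measurable
  have "\<forall>\<^sub>F n in sequentially. tail (\<beta>' n) = tail (\<beta> n)"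
    using filterlim_at_top[THEN iffD1, OF assms, rule_format, of 0] by eventually_elim (simp add: \<beta>'_def)
  from Lim_transform_eventually[OF lim this] show ?thesis by simp
qed

lemma integrable_square_step:
  fixes c :: "nat \<Rightarrow> real" and f :: "real ^ 'p \<Rightarrow> real"
  assumes A: "\<And>l. l < K \<Longrightarrow> A l \<in> unit_halfspaces" and f: "\<And>x. f x = (\<Sum>l<K::nat. c l * indicator (A l) x)"
  shows "f \<in> borel_measurable borel" "integrable \<nu> (\<lambda>z. (f (fst z))\<^sup>2)"
proof -
  have f': "f = (\<lambda>x. \<Sum>l<K. c l * indicator (A l) x)" by (rule ext) (rule f)
  show m: "f \<in> borel_measurable borel"
    unfolding f' by (intro borel_measurable_sum borel_measurable_times borel_measurable_const borel_measurable_indicator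
        unit_halfspace_borel A) simp
  have fV: "\<bar>f x\<bar> \<le> (\<Sum>l<K. \<bar>c l\<bar>)" for x
    unfolding f by (intro order_trans[OF sum_abs] sum_mono) (auto simp: abs_mult indicator_def)
  show "integrable \<nu> (\<lambda>z. (f (fst z))\<^sup>2)"
  proof (rule integrable_const_bound[where B="(\<Sum>l<K. \<bar>c l\<bar>)\<^sup>2"])
    have "(f x)\<^sup>2 \<le> (\<Sum>l<K. \<bar>c l\<bar>)\<^sup>2" for x
      using power_mono[OF fV[of x], of 2] by simp
    then show "AE z in \<nu>. norm ((f (fst z))\<^sup>2) \<le> (\<Sum>l<K. \<bar>c l\<bar>)\<^sup>2" by simp
  qed (use m in measurable)
qed

text \<open>
  Here \<open>a\<close> stands for the bound on the expected training error per observation.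
\<close>

definition risk_bound where
  "risk_bound \<epsilon> n K r \<beta> a = (1 + \<epsilon>) * ((1 + \<epsilon>) * a
        + net_penalty CARD('p) r K n \<epsilon> \<beta> / n)
        + (1 + 1 / \<epsilon>) * tail \<beta> - noise"

text \<open>
  If at least \<open>N0\<close> trees start from the full coordinate set, the greedy bound applies. Otherwise the training
  error is still at most the mean square of the responses, at the price of the second summand.
\<close>

lemma boost_risk_le:
  fixes t n k K :: nat and c :: "nat \<Rightarrow> real" and s :: "nat \<Rightarrow> nat \<Rightarrow> 'p set" and f :: "real ^ 'p \<Rightarrow> real"
  assumes \<beta>: "\<beta> > 0" and \<epsilon>: "0 < \<epsilon>" "\<epsilon> \<le> 1" and n: "n \<ge> 2" and t: "t \<ge> 2" and N0: "N0 \<ge> 1"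
    and sel: "\<And>j. optimal_split_rule (sel j)" and coef: "least_squares_rule coef"
    and meas: "(\<lambda>(D, x). boost_estimator sel coef t n D s k x) \<in> borel_measurable (Pi\<^sub>M {..<n} (\<lambda>_. borel) \<Otimes>\<^sub>M borel)"
    and A: "\<And>l. l < K \<Longrightarrow> A l \<in> unit_halfspaces" and f: "\<And>x. f x = (\<Sum>l<K. c l * indicator (A l) x)"
    and V: "V = (\<Sum>l<K. \<bar>c l\<bar>)"
  shows "(\<integral>\<^sup>+D. (\<integral>\<^sup>+x. ennreal ((truncate_at \<beta> (boost_estimator sel coef t n D s k x) - m x)\<^sup>2)
      \<partial>distr \<nu> borel fst) \<partial>sample n)
    \<le> ennreal (risk_bound \<epsilon> n (k * t) (t - 1) \<beta> (noise + (\<integral>z. (f (fst z) - m (fst z))\<^sup>2 \<partial>\<nu>) + 4 * V\<^sup>2 / N0))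
      + ennreal ((1 + \<epsilon>)\<^sup>2 * (\<integral>z. (snd z)\<^sup>2 \<partial>\<nu>)) * (if card {j\<in>{1..k}. s j 1 = UNIV} < N0 then 1 else 0)"
    (is "?L \<le> ennreal ?a + ennreal ?c * _")
proof -
  note step = integrable_square_step[where A=A and f=f and c=c and K=K, OF A f]
  note [measurable] = step(1)
  have est: "boost_estimator sel coef t n D s k \<in> span_class (k * t) (cells (t - 1))" for D
    by (rule boost_estimator_in_span_class) (use t in simp)
  have bound: "?L \<le> ennreal (risk_bound \<epsilon> n (k * t) (t - 1) \<beta> (\<integral>z. \<phi> z \<partial>\<nu>))"
    if "integrable \<nu> \<phi>" "\<And>D. (\<And>i. i < n \<Longrightarrow> fst (D i) \<in> cbox 0 1) \<Longrightarrow>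
       training_error sel coef t n D s k / n \<le> (\<Sum>i<n. \<phi> (D i)) / n" for \<phi>
    unfolding risk_bound_def
    by (rule expected_estimation_error_le) (use \<beta> \<epsilon> n est meas that in \<open>auto simp: training_error_def\<close>)
  show ?thesis
  proof (cases "card {j\<in>{1..k}. s j 1 = UNIV} < N0")
    case False
    define \<phi> where "\<phi> z = (snd z - f (fst z))\<^sup>2 + 4 * V\<^sup>2 / N0" for z
    have yf: "integrable \<nu> (\<lambda>z. (snd z - f (fst z))\<^sup>2)"
      by (rule integrable_square_diff) (use response_L2 step in auto)
    have "?L \<le> ennreal (risk_bound \<epsilon> n (k * t) (t - 1) \<beta> (\<integral>z. \<phi> z \<partial>\<nu>))"
    proof (rule bound)
      show "integrable \<nu> \<phi>" unfolding \<phi>_def using yf by simp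
      fix D :: "nat \<Rightarrow> (real ^ 'p) \<times> real" assume cube: "\<And>i. i < n \<Longrightarrow> fst (D i) \<in> cbox 0 1"
      define d where "d = (\<Sum>i<n. (snd (D i) - f (fst (D i)))\<^sup>2)"
      define T where "T = training_error sel coef t n D s k"
      have *: "real (card {j\<in>{1..k}. s j 1 = UNIV}) * (T - d) \<le> 4 * V\<^sup>2 * n"
        unfolding T_def d_def by (rule boosting_training_error[OF sel coef t n cube A f V])
      have "N0 * (T - d) \<le> 4 * V\<^sup>2 * n"
      proof (cases "T - d \<ge> 0")
        case True
        then have "N0 * (T - d) \<le> real (card {j\<in>{1..k}. s j 1 = UNIV}) * (T - d)"
          using False by (intro mult_right_mono) auto
        with * show ?thesis by linarith
      next
        case False
        then have "N0 * (T - d) \<le> 0" by (simp add: mult_nonneg_nonpos)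
        also have "\<dots> \<le> 4 * V\<^sup>2 * n" by simp
        finally show ?thesis .
      qed
      then have "T \<le> d + n * (4 * V\<^sup>2 / N0)" using N0 by (simp add: field_simps)
      also have "\<dots> = (\<Sum>i<n. \<phi> (D i))" by (simp add: \<phi>_def d_def sum.distrib)
      finally show "T / n \<le> (\<Sum>i<n. \<phi> (D i)) / n" by (rule divide_right_mono) simp
    qed
    also have "(\<integral>z. \<phi> z \<partial>\<nu>) = noise + (\<integral>z. (f (fst z) - m (fst z))\<^sup>2 \<partial>\<nu>) + 4 * V\<^sup>2 / N0"
      unfolding \<phi>_def using yf risk_decomposition[OF step] by (simp add: prob_space)
    finally show ?thesis using False by simp
  next
    case True
    have "?L \<le> ennreal (risk_bound \<epsilon> n (k * t) (t - 1) \<beta> (\<integral>z. (snd z)\<^sup>2 \<partial>\<nu>))"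
      by (rule bound[OF response_L2]) (intro divide_right_mono training_error_le_initial coef, simp)
    also have "\<dots> \<le> ennreal (?a + ?c)"
    proof (rule ennreal_leI)
      have "0 \<le> (1 + \<epsilon>) * ((1 + \<epsilon>) * (noise + (\<integral>z. (f (fst z) - m (fst z))\<^sup>2 \<partial>\<nu>) + 4 * V\<^sup>2 / N0))"
        unfolding noise_def using \<epsilon> by (intro mult_nonneg_nonneg add_nonneg_nonneg) auto
      then show "risk_bound \<epsilon> n (k * t) (t - 1) \<beta> (\<integral>z. (snd z)\<^sup>2 \<partial>\<nu>) \<le> ?a + ?c"
        unfolding risk_bound_def by (simp add: algebra_simps power2_eq_square)
    qed
    also have "\<dots> \<le> ennreal ?a + ennreal ?c"
    proof (cases "?a \<ge> 0")
      case True
      then show ?thesis using \<epsilon> by (simp add: ennreal_plus)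
    next
      case False
      then have "ennreal (?a + ?c) \<le> ennreal ?c" by (intro ennreal_leI) simp
      then show ?thesis by (simp add: add_increasing)
    qed
    finally show ?thesis using True by simp
  qed
qed

lemma ensemble_risk_le:
  fixes t n k K B :: nat and c :: "nat \<Rightarrow> real" and s :: "nat \<Rightarrow> nat \<Rightarrow> nat \<Rightarrow> 'p set" and f :: "real ^ 'p \<Rightarrow> real"
  assumes B: "B \<ge> 1" and \<beta>: "\<beta> > 0" and \<epsilon>: "0 < \<epsilon>" "\<epsilon> \<le> 1" and n: "n \<ge> 2" and t: "t \<ge> 2" and N0: "N0 \<ge> 1"
    and sel: "\<And>b j. optimal_split_rule (sel b j)" and coef: "\<And>b. least_squares_rule (coef b)"
    and meas: "\<And>b. b \<in> {1..B} \<Longrightarrow>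
       (\<lambda>(D, x). boost_estimator (sel b) (coef b) t n D (s b) k x) \<in> borel_measurable (Pi\<^sub>M {..<n} (\<lambda>_. borel) \<Otimes>\<^sub>M borel)"
    and A: "\<And>l. l < K \<Longrightarrow> A l \<in> unit_halfspaces" and f: "\<And>x. f x = (\<Sum>l<K. c l * indicator (A l) x)"
    and V: "V = (\<Sum>l<K. \<bar>c l\<bar>)"
  shows "(\<integral>\<^sup>+D. (\<integral>\<^sup>+x. ennreal (\<bar>ensemble_estimator sel coef t n D s k B \<beta> x - m x\<bar>\<^sup>2) \<partial>distr \<nu> borel fst) \<partial>sample n)
    \<le> ennreal (risk_bound \<epsilon> n (k * t) (t - 1) \<beta> (noise + (\<integral>z. (f (fst z) - m (fst z))\<^sup>2 \<partial>\<nu>) + 4 * V\<^sup>2 / N0))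
      + ennreal ((1 + \<epsilon>)\<^sup>2 * (\<integral>z. (snd z)\<^sup>2 \<partial>\<nu>)) * (if \<exists>b\<in>{1..B}. card {j\<in>{1..k}. s b j 1 = UNIV} < N0 then 1 else 0)"
    (is "?L \<le> ?bound")
proof -
  let ?P = "sample n"
  let ?\<mu> = "distr \<nu> borel fst"
  interpret \<mu>: prob_space ?\<mu> by (rule prob_space_distr) measurable
  define g where "g b D x = truncate_at \<beta> (boost_estimator (sel b) (coef b) t n D (s b) k x)" for b D x
  have sets_P: "sets (?P \<Otimes>\<^sub>M ?\<mu>) = sets (Pi\<^sub>M {..<n} (\<lambda>_. borel) \<Otimes>\<^sub>M borel)"
    by (intro sets_pair_measure_cong sets_PiM_cong sets_law refl) simp
  have gm: "(\<lambda>(D, x). ennreal ((g b D x - m x)\<^sup>2)) \<in> borel_measurable (?P \<Otimes>\<^sub>M ?\<mu>)" if "b \<in> {1..B}" for b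
  proof -
    have [measurable]: "(\<lambda>z. boost_estimator (sel b) (coef b) t n (fst z) (s b) k (snd z)) \<in> borel_measurable (?P \<Otimes>\<^sub>M ?\<mu>)"
      using meas[OF that] unfolding measurable_cong_sets[OF sets_P refl] case_prod_beta .
    show ?thesis unfolding g_def case_prod_beta by measurable
  qed
  have gx: "(\<lambda>x. ennreal ((g b D x - m x)\<^sup>2)) \<in> borel_measurable ?\<mu>" if "b \<in> {1..B}" "D \<in> space ?P" for b D
    using measurable_Pair2[OF gm[OF that(1)] that(2)] by simp
  have gD: "(\<lambda>D. \<integral>\<^sup>+x. ennreal ((g b D x - m x)\<^sup>2) \<partial>?\<mu>) \<in> borel_measurable ?P" if "b \<in> {1..B}" for b
    by (rule \<mu>.borel_measurable_nn_integral[OF gm[OF that]])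
  have pt: "ennreal (\<bar>ensemble_estimator sel coef t n D s k B \<beta> x - m x\<bar>\<^sup>2) \<le> (\<Sum>b=1..B. ennreal ((g b D x
      - m x)\<^sup>2)) * ennreal (1 / B)" for D x
  proof -
    have "\<bar>ensemble_estimator sel coef t n D s k B \<beta> x - m x\<bar>\<^sup>2 \<le> (\<Sum>b=1..B. (g b D x - m x)\<^sup>2) * (1 / B)"
      using mean_square_le[OF B, of "\<lambda>b. g b D x" "m x"] by (simp add: ensemble_estimator_def g_def)
    then have "ennreal (\<bar>ensemble_estimator sel coef t n D s k B \<beta> x - m x\<bar>\<^sup>2) \<le> ennreal ((\<Sum>b=1..B. (g b D x
        - m x)\<^sup>2) * (1 / B))"
      by (rule ennreal_leI)
    also have "\<dots> = (\<Sum>b=1..B. ennreal ((g b D x - m x)\<^sup>2)) * ennreal (1 / B)"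
      by (subst ennreal_mult'') (auto simp: sum_ennreal)
    finally show ?thesis .
  qed
  have "?L \<le> (\<integral>\<^sup>+D. (\<integral>\<^sup>+x. (\<Sum>b=1..B. ennreal ((g b D x - m x)\<^sup>2)) * ennreal (1 / B) \<partial>?\<mu>) \<partial>?P)"
    by (intro nn_integral_mono pt)
  also have "\<dots> = (\<integral>\<^sup>+D. (\<Sum>b=1..B. \<integral>\<^sup>+x. ennreal ((g b D x - m x)\<^sup>2) \<partial>?\<mu>) * ennreal (1 / B) \<partial>?P)"
  proof (rule nn_integral_cong)
    fix D assume D: "D \<in> space ?P"
    have "(\<integral>\<^sup>+x. (\<Sum>b=1..B. ennreal ((g b D x - m x)\<^sup>2)) * ennreal (1 / B) \<partial>?\<mu>)
      = (\<integral>\<^sup>+x. (\<Sum>b=1..B. ennreal ((g b D x - m x)\<^sup>2)) \<partial>?\<mu>) * ennreal (1 / B)"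
      by (rule nn_integral_multc) (intro borel_measurable_sum gx D)
    also have "(\<integral>\<^sup>+x. (\<Sum>b=1..B. ennreal ((g b D x - m x)\<^sup>2)) \<partial>?\<mu>) = (\<Sum>b=1..B. \<integral>\<^sup>+x. ennreal ((g b D x - m x)\<^sup>2) \<partial>?\<mu>)"
      by (rule nn_integral_sum) (rule gx[OF _ D])
    finally show "(\<integral>\<^sup>+x. (\<Sum>b=1..B. ennreal ((g b D x - m x)\<^sup>2)) * ennreal (1 / B) \<partial>?\<mu>)
      = (\<Sum>b=1..B. \<integral>\<^sup>+x. ennreal ((g b D x - m x)\<^sup>2) \<partial>?\<mu>) * ennreal (1 / B)" .
  qed
  also have "\<dots> = (\<Sum>b=1..B. \<integral>\<^sup>+D. (\<integral>\<^sup>+x. ennreal ((g b D x - m x)\<^sup>2) \<partial>?\<mu>) \<partial>?P) * ennreal (1 / B)"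
  proof -
    have "(\<integral>\<^sup>+D. (\<Sum>b=1..B. \<integral>\<^sup>+x. ennreal ((g b D x - m x)\<^sup>2) \<partial>?\<mu>) \<partial>?P)
      = (\<Sum>b=1..B. \<integral>\<^sup>+D. (\<integral>\<^sup>+x. ennreal ((g b D x - m x)\<^sup>2) \<partial>?\<mu>) \<partial>?P)"
      by (rule nn_integral_sum) (rule gD)
    then show ?thesis by (subst nn_integral_multc) (intro borel_measurable_sum gD, simp_all only:)
  qed
  also have "\<dots> \<le> (\<Sum>b=1..B. ?bound) * ennreal (1 / B)"
  proof (intro mult_right_mono sum_mono)
    fix b assume b: "b \<in> {1..B}"
    have "(\<integral>\<^sup>+D. (\<integral>\<^sup>+x. ennreal ((g b D x - m x)\<^sup>2) \<partial>?\<mu>) \<partial>?P)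
      \<le> ennreal (risk_bound \<epsilon> n (k * t) (t - 1) \<beta> (noise + (\<integral>z. (f (fst z) - m (fst z))\<^sup>2 \<partial>\<nu>) + 4 * V\<^sup>2 / N0))
      + ennreal ((1 + \<epsilon>)\<^sup>2 * (\<integral>z. (snd z)\<^sup>2 \<partial>\<nu>)) * (if card {j\<in>{1..k}. s b j 1 = UNIV} < N0 then 1 else 0)"
      unfolding g_def by (rule boost_risk_le[OF \<beta> \<epsilon> n t N0 sel coef meas[OF b] A f V])
    also have "\<dots> \<le> ?bound" using b by (intro add_left_mono mult_left_mono) auto
    finally show "(\<integral>\<^sup>+D. (\<integral>\<^sup>+x. ennreal ((g b D x - m x)\<^sup>2) \<partial>?\<mu>) \<partial>?P) \<le> ?bound" .
  qed simp
  also have "\<dots> = ?bound * (ennreal B * ennreal (1 / B))" by (simp add: mult_ac ennreal_of_nat_eq_real_of_nat)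
  also have "ennreal B * ennreal (1 / B) = 1" using B by (simp add: ennreal_mult[symmetric])
  finally show ?thesis by simp
qed

end


section \<open>Averaging over the seeds, and asymptotics\<close>

lemma split_layer_cong:
  assumes "\<And>\<tau>. \<tau> < t \<Longrightarrow> S \<tau> = S' \<tau>"
  shows "split_layer sel t n D S cur later = split_layer sel t n D S' cur later"
  by (induction cur arbitrary: later) (auto simp: Let_def assms)

lemma odt_estimator_cong:
  assumes "\<And>\<tau>. \<tau> < t \<Longrightarrow> S \<tau> = S' \<tau>"
  shows "odt_estimator sel t n D S = odt_estimator sel t n D S'"
proof -
  have "(\<lambda>layer. split_layer sel t n D S layer []) = (\<lambda>layer. split_layer sel t n D S' layer [])"
    by (rule ext) (rule split_layer_cong[OF assms])
  then have "odt_leaves sel t n D S = odt_leaves sel t n D S'" by (simp add: odt_leaves_def)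
  then show ?thesis by (simp add: odt_estimator_def fun_eq_iff)
qed

lemma boost_estimator_cong:
  assumes "\<And>j \<tau>. j \<in> {1..k} \<Longrightarrow> \<tau> < t \<Longrightarrow> s j \<tau> = s' j \<tau>"
  shows "boost_estimator sel coef t n D s k = boost_estimator sel coef t n D s' k"
proof -
  have "boost_trees sel coef t n D s i = boost_trees sel coef t n D s' i" if "i \<le> k" for i
    using that
  proof (induction i)
    case (Suc i)
    have "odt_estimator (sel (Suc i)) t n R (s (Suc i)) = odt_estimator (sel (Suc i)) t n R (s' (Suc i))" for R
      by (rule odt_estimator_cong) (use Suc.prems assms in auto)
    then show ?case using Suc by (simp add: Let_def)
  qed simp
  then show ?thesis by (simp add: boost_estimator_def)
qed

text \<open>
  Markov's inequality for \<open>2\<^sup>-\<^sup>N\<close>, \<open>N\<close> the number of full sets: its expectation factorizes by independence.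
\<close>

lemma (in prob_space) few_full_seeds:
  fixes R :: "'i \<Rightarrow> 'a \<Rightarrow> 'b set"
  assumes J: "finite J" and indep: "indep_vars (\<lambda>_. count_space UNIV) R J"
    and q: "\<And>j. j \<in> J \<Longrightarrow> measure M {w\<in>space M. R j w = UNIV} = q"
  shows "measure M {w\<in>space M. card {j\<in>J. R j w = UNIV} < N0} \<le> 2 ^ N0 * (1 - q / 2) ^ card J"
proof -
  define h :: "'b set \<Rightarrow> real" where "h S = (if S = UNIV then 1 / 2 else 1)" for S
  have Rm [measurable]: "R j \<in> measurable M (count_space UNIV)" if "j \<in> J" for j
    using indep that by (auto simp: indep_vars_def)
  have ev: "{w\<in>space M. R j w = UNIV} \<in> events" if "j \<in> J" for j
    using measurable_sets[OF Rm[OF that], of "{UNIV}"] by (simp add: vimage_def Int_def conj_commute)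
  have hR: "indep_vars (\<lambda>_. borel) (\<lambda>j w. h (R j w)) J"
    by (rule indep_vars_compose2[OF indep]) simp
  have hm: "(\<lambda>w. h (R j w)) \<in> borel_measurable M" if "j \<in> J" for j
    by (rule measurable_compose[OF Rm[OF that]]) simp
  have hint: "integrable M (\<lambda>w. h (R j w))" if "j \<in> J" for j
    using hm[OF that] by (intro integrable_const_bound[where B=1]) (auto simp: h_def)
  have Eh: "(\<integral>w. h (R j w) \<partial>M) = 1 - q / 2" if j: "j \<in> J" for j
  proof -
    define E where "E = {w\<in>space M. R j w = UNIV}"
    have E: "E \<in> events" "prob E = q" using ev[OF j] q[OF j] by (auto simp: E_def)
    have "(\<integral>w. h (R j w) \<partial>M) = (\<integral>w. 1 - indicator E w / 2 \<partial>M)"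
      by (intro Bochner_Integration.integral_cong) (auto simp: h_def indicator_def E_def)
    also have "\<dots> = (\<integral>w. 1 \<partial>M) - (\<integral>w. indicator E w / 2 \<partial>M)"
      by (rule Bochner_Integration.integral_diff) (use E in \<open>auto simp: emeasure_eq_measure\<close>)
    also have "\<dots> = 1 - q / 2" using E by (simp add: prob_space)
    finally show ?thesis .
  qed
  have pr: "(\<Prod>j\<in>J. h (R j w)) = (1 / 2) ^ card {j\<in>J. R j w = UNIV}" for w
    unfolding h_def by (subst prod.inter_filter[symmetric]) (rule J, rule prod_constant)
  have "measure M {w\<in>space M. card {j\<in>J. R j w = UNIV} < N0}
      = (\<integral>w. indicator {w\<in>space M. card {j\<in>J. R j w = UNIV} < N0} w \<partial>M)"
    by simp (rule arg_cong[where f=prob], auto)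
  also have "\<dots> \<le> (\<integral>w. 2 ^ N0 * (\<Prod>j\<in>J. h (R j w)) \<partial>M)"
  proof (rule integral_mono)
    have cm: "(\<lambda>w. \<Prod>j\<in>J. h (R j w)) \<in> borel_measurable M" by (intro borel_measurable_prod hm)
    show "integrable M (\<lambda>w. 2 ^ N0 * (\<Prod>j\<in>J. h (R j w)))"
      by (intro integrable_mult_right integrable_const_bound[where B=1] AE_I2 cm)
        (unfold pr, simp add: power_le_one)
    have "{w\<in>space M. card {j\<in>J. R j w = UNIV} < N0}
       = {w\<in>space M. (\<Prod>j\<in>J. h (R j w)) > (1 / 2) ^ N0}"
      unfolding pr by (auto simp: power_strict_decreasing_iff)
    also have "\<dots> \<in> events" using cm by measurable
    finally show "integrable M (indicator {w\<in>space M. card {j\<in>J. R j w = UNIV} < N0} :: 'a \<Rightarrow> real)"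
      by (simp add: emeasure_eq_measure)
    fix w
    have "1 \<le> 2 ^ N0 * (1 / 2 :: real) ^ card {j\<in>J. R j w = UNIV}"
      if "card {j\<in>J. R j w = UNIV} < N0"
      using that by (simp add: power_divide power_increasing)
    then show "indicator {w\<in>space M. card {j\<in>J. R j w = UNIV} < N0} w
       \<le> 2 ^ N0 * (\<Prod>j\<in>J. h (R j w))"
      unfolding pr by (auto simp: indicator_def)
  qed
  also have "\<dots> = 2 ^ N0 * (\<Prod>j\<in>J. \<integral>w. h (R j w) \<partial>M)"
    using indep_vars_lebesgue_integral[OF J hR hint] by simp
  also have "\<dots> = 2 ^ N0 * (1 - q / 2) ^ card J" using Eh by simp
  finally show ?thesis .
qed

text \<open>
  Restricting the measure to an event independent of \<open>U\<close> only scales the law of \<open>U\<close>.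
\<close>

lemma (in prob_space) nn_integral_indep_event:
  assumes U: "U \<in> measurable M N" and E: "E \<in> events"
    and indep: "\<And>A. A \<in> sets N \<Longrightarrow> prob ((U -` A \<inter> space M) \<inter> E) = prob (U -` A \<inter> space M) * prob E"
    and g: "g \<in> borel_measurable N"
  shows "(\<integral>\<^sup>+w. indicator E w * g (U w) \<partial>M) = ennreal (prob E) * (\<integral>\<^sup>+d. g d \<partial>distr M N U)"
proof -
  let ?D = "density M (indicator E)"
  have UD: "U \<in> measurable ?D N" using U by simp
  have eq: "distr ?D N U = scale_measure (ennreal (prob E)) (distr M N U)"
  proof (rule measure_eqI)
    fix A assume "A \<in> sets (distr ?D N U)"
    then have A: "A \<in> sets N" by simp
    have "emeasure (distr ?D N U) A = emeasure ?D (U -` A \<inter> space M)"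
      using A UD by (simp add: emeasure_distr)
    also have "\<dots> = emeasure M (E \<inter> (U -` A \<inter> space M))"
    proof -
      have B: "U -` A \<inter> space M \<in> events" using A U by (rule measurable_sets[rotated])
      have "emeasure ?D (U -` A \<inter> space M) = (\<integral>\<^sup>+w. indicator E w * indicator (U -` A \<inter> space M) w \<partial>M)"
        by (rule emeasure_density) (use E B in auto)
      also have "\<dots> = (\<integral>\<^sup>+w. indicator (E \<inter> (U -` A \<inter> space M)) w \<partial>M)"
        by (intro nn_integral_cong) (auto simp: indicator_def)
      also have "\<dots> = emeasure M (E \<inter> (U -` A \<inter> space M))"
        by (rule nn_integral_indicator) (use E B in auto)
      finally show ?thesis .
    qed
    also have "\<dots> = ennreal (prob E) * emeasure M (U -` A \<inter> space M)"
      using indep[OF A] by (simp add: emeasure_eq_measure ennreal_mult Int_commute mult.commute)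
    finally show "emeasure (distr ?D N U) A = emeasure (scale_measure (ennreal (prob E)) (distr M N U)) A"
      using A U by (simp add: emeasure_distr)
  qed simp
  have "(\<integral>\<^sup>+w. indicator E w * g (U w) \<partial>M) = (\<integral>\<^sup>+w. g (U w) \<partial>?D)"
    using E measurable_compose[OF U g] by (subst nn_integral_density) auto
  also have "\<dots> = (\<integral>\<^sup>+d. g d \<partial>distr ?D N U)" by (rule nn_integral_distr[symmetric]) (use UD g in auto)
  also have "\<dots> = ennreal (prob E) * (\<integral>\<^sup>+d. g d \<partial>distr M N U)"
    unfolding eq by (rule nn_integral_scale_measure) (use g in simp)
  finally show ?thesis .
qed

text \<open>
  The second argument takes finitely many values almost surely, so \<open>F\<close> only has to be measurable in the first
  one.
\<close>

lemma (in prob_space) nn_integral_average_finite: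
  fixes V :: "'a \<Rightarrow> 'v"
  assumes U: "U \<in> measurable M N" and fin: "finite VS"
    and V: "\<And>v. v \<in> VS \<Longrightarrow> {w\<in>space M. V w = v} \<in> events" and AE_V: "AE w in M. V w \<in> VS"
    and indep: "\<And>A v. A \<in> sets N \<Longrightarrow> v \<in> VS \<Longrightarrow>
        prob ((U -` A \<inter> space M) \<inter> {w\<in>space M. V w = v}) = prob (U -` A \<inter> space M) * prob {w\<in>space M. V w = v}"
    and F: "\<And>v. v \<in> VS \<Longrightarrow> (\<lambda>d. F d v) \<in> borel_measurable N"
    and bound: "\<And>v. v \<in> VS \<Longrightarrow> (\<integral>\<^sup>+d. F d v \<partial>distr M N U) \<le> a + c * indicator Bad v"
    and bad: "measure M {w\<in>space M. V w \<in> Bad} \<le> r" and Bad: "{w\<in>space M. V w \<in> Bad} \<in> events"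
  shows "(\<integral>\<^sup>+w. F (U w) (V w) \<partial>M) \<le> a + c * ennreal r"
proof -
  define E where "E v = {w\<in>space M. V w = v}" for v
  have "(\<integral>\<^sup>+w. F (U w) (V w) \<partial>M) = (\<integral>\<^sup>+w. (\<Sum>v\<in>VS. indicator (E v) w * F (U w) v) \<partial>M)"
  proof (rule nn_integral_cong_AE)
    show "AE w in M. F (U w) (V w) = (\<Sum>v\<in>VS. indicator (E v) w * F (U w) v)"
      using AE_V AE_space
    proof eventually_elim
      case (elim w)
      have "(\<Sum>v\<in>VS. indicator (E v) w * F (U w) v) = (\<Sum>v\<in>VS. if v = V w then F (U w) v else 0)"
        using elim by (intro sum.cong) (auto simp: E_def indicator_def)
      also have "\<dots> = F (U w) (V w)" using elim fin by simp
      finally show ?case by simp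
    qed
  qed
  also have "\<dots> = (\<Sum>v\<in>VS. \<integral>\<^sup>+w. indicator (E v) w * F (U w) v \<partial>M)"
    by (rule nn_integral_sum) (use V measurable_compose[OF U F] in \<open>auto simp: E_def\<close>)
  also have "\<dots> = (\<Sum>v\<in>VS. ennreal (prob (E v)) * (\<integral>\<^sup>+d. F d v \<partial>distr M N U))"
    using V indep F by (intro sum.cong refl nn_integral_indep_event U) (auto simp: E_def)
  also have "\<dots> \<le> (\<Sum>v\<in>VS. ennreal (prob (E v)) * (a + c * indicator Bad v))"
    by (intro sum_mono mult_left_mono bound) auto
  also have "\<dots> = (\<Sum>v\<in>VS. ennreal (prob (E v))) * a + c * (\<Sum>v\<in>VS. ennreal (prob (E v)) * indicator Bad v)"
    unfolding sum_distrib_right sum_distrib_left sum.distrib[symmetric]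
    by (intro sum.cong refl) (simp only: distrib_left mult_ac)
  also have "\<dots> \<le> 1 * a + c * ennreal r"
  proof (intro add_mono mult_mono mult_left_mono)
    have disj: "disjoint_family_on E T" for T by (auto simp: disjoint_family_on_def E_def)
    have part: "(\<Sum>v\<in>T. ennreal (prob (E v))) = ennreal (prob (\<Union>v\<in>T. E v))" if "T \<subseteq> VS" for T
    proof -
      have "finite T" using that fin finite_subset by blast
      then have "prob (\<Union>v\<in>T. E v) = (\<Sum>v\<in>T. prob (E v))"
      proof (rule finite_measure_finite_Union)
        show "E ` T \<subseteq> events" using V \<open>T \<subseteq> VS\<close> by (auto simp: E_def)
      qed (rule disj)
      then show ?thesis by (simp add: sum_ennreal)
    qed
    show "(\<Sum>v\<in>VS. ennreal (prob (E v))) \<le> 1" unfolding part[OF subset_refl] by (simp add: prob_le_1)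
    have "(\<Sum>v\<in>VS. ennreal (prob (E v)) * indicator Bad v) = (\<Sum>v\<in>VS \<inter> Bad. ennreal (prob (E v)))"
      using fin by (intro sum.mono_neutral_cong_right) (auto simp: indicator_def)
    also have "\<dots> = ennreal (prob (\<Union>v\<in>VS \<inter> Bad. E v))" by (rule part) auto
    also have "\<dots> \<le> ennreal (measure M {w\<in>space M. V w \<in> Bad})"
      by (intro ennreal_leI finite_measure_mono Bad) (auto simp: E_def)
    also have "\<dots> \<le> ennreal r" using bad by (rule ennreal_leI)
    finally show "(\<Sum>v\<in>VS. ennreal (prob (E v)) * indicator Bad v) \<le> ennreal r" .
  qed auto
  finally show ?thesis by simp
qed

lemma ln_cover_bound_le:
  assumes "n \<ge> 2" "k \<ge> 1"
  shows "ln (real (cover_bound p r (k * t) n)) \<le> real (t * r * (3 * p + 4) + 4 * t + 4) * (real k * ln (real n))"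
proof -
  have n: "real n \<ge> 2" using assms(1) by simp
  define l where "l = ln (real n)"
  have l: "l \<ge> ln 2" "l > 0" using n by (auto simp: l_def)
  have mono: "ln (real a) \<le> ln (real b)" if "a \<le> b" "a > 0" for a b :: nat
    using that by (subst ln_le_cancel_iff) auto
  have "2 * n + 1 \<le> n ^ 3"
  proof -
    have "2 * n + 1 \<le> 4 * n" using assms(1) by simp
    also have "4 * n \<le> n * n * n" using mult_le_mono[OF mult_le_mono[OF assms(1) assms(1)] le_refl[of n]] by simp
    finally show ?thesis by (simp add: power3_eq_cube)
  qed
  then have "ln (real (2 * n + 1)) \<le> ln (real (n ^ 3))" by (rule mono) simp
  then have l1: "ln (real (2 * n + 1)) \<le> 3 * l" using n by (simp add: l_def ln_realpow)
  have "2 * n * (n + 1) + 1 \<le> n ^ 4"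
  proof -
    have "n * n * 4 \<le> n * n * (n * n)" using mult_le_mono[OF assms(1) assms(1)] by (intro mult_le_mono2) simp
    moreover have "2 * n + 1 \<le> n * n * 2"
    proof -
      have "2 * n + 1 \<le> 4 * n" using assms(1) by simp
      also have "4 * n \<le> n * n * 2" using assms(1) by simp
      finally show ?thesis .
    qed
    moreover have "2 * n * (n + 1) + 1 = n * n * 2 + (2 * n + 1)" by (simp add: algebra_simps)
    ultimately have "2 * n * (n + 1) + 1 \<le> n * n * (n * n)" by linarith
    then show ?thesis by (simp add: power4_eq_xxxx mult.assoc)
  qed
  then have "ln (real (2 * n * (n + 1) + 1)) \<le> ln (real (n ^ 4))" by (rule mono) simp
  then have l2: "ln (real (2 * n * (n + 1) + 1)) \<le> 4 * l" using n by (simp add: l_def ln_realpow)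
  have "ln (real (cover_bound p r (k * t) n))
     = real (k * t) * (real r * (ln 2 + real (p + 1) * ln (real (2 * n + 1)))) + real (k * t
         + 1) * ln (real (2 * n * (n + 1) + 1))"
  proof -
    have *: "ln (((2 * A ^ q) ^ r) ^ K * B ^ K') = real K * (real r * (ln 2 + real q * ln A)) + real K' * ln B"
      if "A > 0" "B > 0" for A B :: real and q K K' :: nat
      using that by (simp add: ln_mult ln_realpow distrib_left)
    have eq: "real (cover_bound p r K n) = ((2 * real (2 * n + 1) ^ (p + 1)) ^ r) ^ K * real (2 * n * (n + 1)
        + 1) ^ (K + 1)" for K
      unfolding cover_bound_def by (simp only: of_nat_mult of_nat_power of_nat_numeral)
    show ?thesis unfolding eq by (rule *; unfold of_nat_0_less_iff; simp)
  qed
  also have "\<dots> \<le> real (k * t) * (real r * (l + real (p + 1) * (3 * l))) + real (k * t + 1) * (4 * l)"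
    using l l1 l2 by (intro add_mono mult_left_mono) auto
  also have "\<dots> = real (k * t * r * (3 * p + 4) + 4 * (k * t + 1)) * l"
    by (simp add: algebra_simps)
  also have "\<dots> \<le> real (k * (t * r * (3 * p + 4) + 4 * t + 4)) * l"
    using l assms(2) by (intro mult_right_mono) (auto simp: algebra_simps simp flip: of_nat_mult of_nat_add)
  finally show ?thesis by (simp add: l_def mult_ac)
qed

text \<open>
  The numerator is of order \<open>\<beta>\<^sup>2 k ln n\<close>, that is, of order \<open>k ln\<^sup>3 n\<close>, which is \<open>o(n)\<close>.
\<close>

lemma complexity_term_vanishes:
  fixes k :: "nat \<Rightarrow> nat" and \<beta> :: "nat \<Rightarrow> real"
  assumes \<beta>: "same_order \<beta> (\<lambda>n. ln (real n))" and k: "filterlim k at_top sequentially"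
    and kn: "(\<lambda>n. real (k n)) \<in> o(\<lambda>n. real n / ln (real n) ^ 4)" and \<epsilon>: "\<epsilon> > 0"
  shows "(\<lambda>n. net_penalty p r (k n * t) n \<epsilon> (\<beta> n) / n) \<longlonglongrightarrow> 0"
proof -
  obtain c1 c2 where c: "c1 > 0" "c2 > 0" "\<forall>\<^sub>F n in sequentially. c1 \<le> \<beta> n / ln (real n) \<and> \<beta> n / ln (real n) \<le> c2"
    using \<beta> unfolding same_order_def by blast
  define Q where "Q = real (t * r * (3 * p + 4) + 4 * t + 4)"
  define Z where "Z = 24 * c2\<^sup>2 / \<epsilon> * Q + 24 * c2\<^sup>2"
  have Q: "Q \<ge> 0" by (simp add: Q_def)
  have lim: "(\<lambda>n. real (k n) / (real n / ln (real n) ^ 4)) \<longlonglongrightarrow> 0" using kn by (rule smalloD_tendsto)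
  have "(\<lambda>n. Z * (real (k n) / (real n / ln (real n) ^ 4))) \<longlonglongrightarrow> 0"
    by (rule tendsto_mult_right_zero[OF lim])
  moreover have "\<forall>\<^sub>F n in sequentially. norm ((24 * (\<beta> n)\<^sup>2 / \<epsilon> * ln (real (cover_bound p r (k n * t) n))
      + 24 * (\<beta> n)\<^sup>2) / n)
      \<le> Z * (real (k n) / (real n / ln (real n) ^ 4))"
    using c(3) eventually_ge_at_top[of 3] filterlim_at_top[THEN iffD1, OF k, rule_format, of 1]
  proof eventually_elim
    case (elim n)
    define l where "l = ln (real n)"
    have l: "l \<ge> 1"
    proof -
      have "exp 1 \<le> real n" using exp_le elim(2) by linarith
      then show ?thesis using elim(2) by (simp add: l_def ln_ge_iff)
    qed
    have b: "0 \<le> \<beta> n" "\<beta> n \<le> c2 * l"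
    proof -
      have "c1 * l \<le> \<beta> n" "\<beta> n \<le> c2 * l" using elim(1) l by (simp_all add: l_def[symmetric] field_simps)
      moreover have "0 \<le> c1 * l" using c(1) l by simp
      ultimately show "0 \<le> \<beta> n" "\<beta> n \<le> c2 * l" by linarith+
    qed
    have b2: "(\<beta> n)\<^sup>2 \<le> c2\<^sup>2 * l\<^sup>2" using power_mono[OF b(2,1), of 2] by (simp add: power_mult_distrib)
    define L where "L = ln (real (cover_bound p r (k n * t) n))"
    have L: "L \<le> Q * (real (k n) * l)" unfolding L_def Q_def l_def by (rule ln_cover_bound_le) (use elim in auto)
    have "cover_bound p r (k n * t) n \<ge> 1" by (simp add: cover_bound_def Suc_le_eq)
    then have L0: "L \<ge> 0" unfolding L_def by (intro ln_ge_zero) simp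
    have kn1: "real (k n) \<ge> 1" using elim(3) by simp
    have k3: "l\<^sup>2 * (real (k n) * l) \<le> real (k n) * l ^ 4"
    proof -
      have "l ^ 3 \<le> l ^ 4" using l by (intro power_increasing) auto
      then have "real (k n) * l ^ 3 \<le> real (k n) * l ^ 4" by (intro mult_left_mono) auto
      then show ?thesis by (simp add: power2_eq_square power3_eq_cube mult_ac)
    qed
    have k2: "l\<^sup>2 \<le> real (k n) * l ^ 4"
    proof -
      have "l\<^sup>2 \<le> l ^ 4" using l by (intro power_increasing) auto
      also have "\<dots> \<le> real (k n) * l ^ 4" using kn1 l by (simp add: mult_le_cancel_right1)
      finally show ?thesis .
    qed
    have "24 * (\<beta> n)\<^sup>2 / \<epsilon> * L + 24 * (\<beta> n)\<^sup>2 \<le> 24 * (c2\<^sup>2 * l\<^sup>2) / \<epsilon> * (Q * (real (k n) * l)) + 24 * (c2\<^sup>2 * l\<^sup>2)"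
      using b2 L L0 \<epsilon> by (intro add_mono mult_mono divide_right_mono mult_left_mono) auto
    also have "\<dots> = 24 * c2\<^sup>2 / \<epsilon> * Q * (l\<^sup>2 * (real (k n) * l)) + 24 * c2\<^sup>2 * l\<^sup>2" by (simp add: mult_ac)
    also have "\<dots> \<le> 24 * c2\<^sup>2 / \<epsilon> * Q * (real (k n) * l ^ 4) + 24 * c2\<^sup>2 * (real (k n) * l ^ 4)"
      using k3 k2 Q \<epsilon> by (intro add_mono mult_left_mono) auto
    also have "\<dots> = Z * (real (k n) * l ^ 4)" by (simp add: Z_def algebra_simps)
    finally have "(24 * (\<beta> n)\<^sup>2 / \<epsilon> * L + 24 * (\<beta> n)\<^sup>2) / n \<le> Z * (real (k n) * l ^ 4) / n"
      by (rule divide_right_mono) simp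
    moreover have "(24 * (\<beta> n)\<^sup>2 / \<epsilon> * L + 24 * (\<beta> n)\<^sup>2) / n \<ge> 0" using L0 \<epsilon> by simp
    ultimately show ?case by (simp add: L_def[symmetric] l_def[symmetric])
  qed
  ultimately show ?thesis unfolding net_penalty_def by (rule Lim_null_comparison[rotated])
qed

lemma same_order_ln_at_top:
  assumes "same_order \<beta> (\<lambda>n. ln (real n))" shows "filterlim \<beta> at_top sequentially"
proof -
  obtain c1 c2 where c: "c1 > 0" "\<forall>\<^sub>F n in sequentially. c1 \<le> \<beta> n / ln (real n) \<and> \<beta> n / ln (real n) \<le> c2"
    using assms unfolding same_order_def by blast
  have "filterlim (\<lambda>n. c1 * ln (real n)) at_top sequentially"
    by (intro filterlim_tendsto_pos_mult_at_top[OF tendsto_const c(1)] filterlim_compose[OF ln_at_top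
        filterlim_real_sequentially])
  moreover have "\<forall>\<^sub>F n in sequentially. c1 * ln (real n) \<le> \<beta> n"
    using c(2) eventually_ge_at_top[of 2] by eventually_elim (simp add: field_simps)
  ultimately show ?thesis by (rule filterlim_at_top_mono)
qed


section \<open>From the probability space to the law of the data\<close>

lemma regression_law_distr:
  fixes X :: "'w \<Rightarrow> real ^ 'p" and Y :: "'w \<Rightarrow> real"
  assumes M: "prob_space M" and X [measurable]: "X \<in> borel_measurable M" and Y [measurable]: "Y \<in> borel_measurable M"
    and cube: "AE w in M. X w \<in> cbox 0 1" and m: "regression_function M X Y m"
    and Y2: "integrable M (\<lambda>w. (Y w)\<^sup>2)" and m2: "integrable M (\<lambda>w. (m (X w))\<^sup>2)"
  shows "regression_law (distr M borel (\<lambda>w. (X w, Y w))) m"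
proof -
  interpret prob_space M by fact
  let ?\<nu> = "distr M borel (\<lambda>w. (X w, Y w))"
  have [measurable]: "m \<in> borel_measurable borel" using m by (simp add: regression_function_def)
  have XY: "(\<lambda>w. (X w, Y w)) \<in> measurable M borel" by (rule borel_measurable_Pair) measurable
  have fst_m [measurable]: "fst \<in> measurable (borel :: ((real ^ 'p) \<times> real) measure) borel"
    and snd_m [measurable]: "snd \<in> measurable (borel :: ((real ^ 'p) \<times> real) measure) borel"
    by (intro borel_measurable_continuous_onI continuous_intros)+
  show ?thesis
  proof (intro regression_law.intro regression_law_axioms.intro)
    show "prob_space ?\<nu>" by (rule prob_space_distr[OF XY])
    show "sets ?\<nu> = sets borel" by simp
    show "m \<in> borel_measurable borel" by measurable
    show "AE z in ?\<nu>. fst z \<in> cbox 0 1"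
      by (subst AE_distr_iff[OF XY]) (use cube in auto)
    show "integrable ?\<nu> (\<lambda>z. (snd z)\<^sup>2)" by (subst integrable_distr_eq[OF XY]) (use Y2 in auto)
    show "integrable ?\<nu> (\<lambda>z. (m (fst z))\<^sup>2)" by (subst integrable_distr_eq[OF XY]) (use m2 in auto)
    fix g :: "real ^ 'p \<Rightarrow> real" assume g [measurable]: "g \<in> borel_measurable borel"
    assume "integrable ?\<nu> (\<lambda>z. (g (fst z))\<^sup>2)"
    then have g2: "integrable M (\<lambda>w. (g (X w))\<^sup>2)" by (subst (asm) integrable_distr_eq[OF XY]) auto
    let ?F = "vimage_algebra (space M) X borel"
    have sub: "subalgebra M ?F"
      unfolding subalgebra_def using X by (auto simp: sets_vimage_algebra2 intro: measurable_sets)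
    interpret F: finite_measure_subalgebra M ?F by unfold_locales (rule sub)
    have gF: "(\<lambda>w. g (X w)) \<in> borel_measurable ?F"
      by (rule measurable_compose[OF _ g]) (rule measurable_vimage_algebra1, simp)
    have gY: "integrable M (\<lambda>w. g (X w) * Y w)" and gm: "integrable M (\<lambda>w. g (X w) * m (X w))"
      by (rule integrable_mult_of_squares; use g2 Y2 m2 in measurable)+
    have "(\<integral>w. g (X w) * Y w \<partial>M) = (\<integral>w. g (X w) * real_cond_exp M ?F Y w \<partial>M)"
      by (rule F.real_cond_exp_intg(2)[symmetric]) (use gY gF in auto)
    also have "\<dots> = (\<integral>w. g (X w) * m (X w) \<partial>M)"
    proof (rule integral_cong_AE)
      show "AE w in M. g (X w) * real_cond_exp M ?F Y w = g (X w) * m (X w)"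
        using m unfolding regression_function_def by auto
    qed measurable
    finally have "(\<integral>w. g (X w) * Y w - g (X w) * m (X w) \<partial>M) = 0"
      using gY gm by simp
    moreover have "(\<lambda>w. g (X w) * Y w - g (X w) * m (X w)) = (\<lambda>w. (Y w - m (X w)) * g (X w))"
      by (auto simp: algebra_simps)
    ultimately have "(\<integral>w. (Y w - m (X w)) * g (X w) \<partial>M) = 0" by simp
    moreover have "(\<lambda>z. (snd z - m (fst z)) * g (fst z)) \<in> borel_measurable borel" by measurable
    ultimately show "(\<integral>z. (snd z - m (fst z)) * g (fst z) \<partial>?\<nu>) = 0"
      by (simp only: integral_distr[OF XY] fst_conv snd_conv)
  qed
qed

text \<open>
  The given probabilities of the nonempty sets already sum up to \<open>1\<close>: for each size they sum up to \<open>1 / p\<close>.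
\<close>

lemma (in prob_space) seeds_nonempty:
  fixes R :: "'a \<Rightarrow> 'p::finite set"
  assumes R [measurable]: "R \<in> measurable M (count_space UNIV)"
    and R_prob: "\<And>S. S \<noteq> {} \<Longrightarrow> prob {w \<in> space M. R w = S} = 1 / (real CARD('p) * real (CARD('p) choose card S))"
  shows "AE w in M. R w \<noteq> {}"
proof -
  let ?p = "CARD('p)"
  have ev: "{w \<in> space M. R w = S} \<in> events" for S by measurable
  define h where "h S = 1 / (real ?p * real (?p choose card S))" for S :: "'p set"
  have img: "card ` (UNIV - {{} :: 'p set}) \<subseteq> {1..?p}"
    by (auto simp: Suc_le_eq card_gt_0_iff intro!: card_mono)
  have "sum h (UNIV - {{}}) = (\<Sum>j\<in>{1..?p}. sum h {S. S \<in> UNIV - {{}} \<and> card S = j})"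
    by (rule sum.group[OF _ _ img, symmetric]) auto
  also have "\<dots> = (\<Sum>j\<in>{1..?p}. 1 / real ?p)"
  proof (rule sum.cong)
    fix j assume j: "j \<in> {1..?p}"
    have "{S. S \<in> UNIV - {{} :: 'p set} \<and> card S = j} = {S. S \<subseteq> UNIV \<and> card S = j}" using j by auto
    then have "card {S. S \<in> UNIV - {{} :: 'p set} \<and> card S = j} = ?p choose j"
      using n_subsets[of "UNIV :: 'p set" j] by simp
    moreover have "?p choose j > 0" using j by (simp add: zero_less_binomial)
    moreover have "sum h {S. S \<in> UNIV - {{} :: 'p set} \<and> card S = j}
       = (\<Sum>S\<in>{S. S \<in> UNIV - {{} :: 'p set} \<and> card S = j}. 1 / (real ?p * real (?p choose j)))"
      by (intro sum.cong) (auto simp: h_def)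
    ultimately show "sum h {S. S \<in> UNIV - {{} :: 'p set} \<and> card S = j} = 1 / real ?p"
      by simp
  qed simp
  also have "\<dots> = 1" by simp
  finally have "(\<Sum>S\<in>UNIV - {{}}. prob {w \<in> space M. R w = S}) = 1" using R_prob by (simp add: h_def)
  also have "(\<Sum>S\<in>UNIV - {{}}. prob {w \<in> space M. R w = S}) = prob (\<Union>S\<in>UNIV - {{}}. {w \<in> space M. R w = S})"
    using ev by (intro finite_measure_finite_Union[symmetric]) (auto simp: disjoint_family_on_def)
  also have "(\<Union>S\<in>UNIV - {{}}. {w \<in> space M. R w = S}) = {w \<in> space M. R w \<noteq> {}}" by auto
  finally have "prob {w \<in> space M. R w \<noteq> {}} = 1" .
  moreover have "{w \<in> space M. R w \<noteq> {}} \<in> events" by measurable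
  ultimately show ?thesis by (simp add: prob_Collect_eq_1)
qed


text \<open>
  The estimator reads only the seeds with indices in \<open>{1..B} \<times> {1..k} \<times> {..<t}\<close>, a random vector with finitely
  many values. The bound for fixed seeds is averaged over these values, the data being independent of them; the
  bad event is that one of the \<open>B\<close> ensemble members has too few trees starting from the full coordinate set.
\<close>

lemma seed_average_le:
  fixes M :: "'w measure" and X :: "'w \<Rightarrow> real ^ 'p" and Y :: "'w \<Rightarrow> real"
    and Xs :: "nat \<Rightarrow> 'w \<Rightarrow> real ^ 'p" and Ys :: "nat \<Rightarrow> 'w \<Rightarrow> real"
    and \<S> :: "nat \<Rightarrow> nat \<Rightarrow> nat \<Rightarrow> 'w \<Rightarrow> 'p set"
    and F :: "(nat \<Rightarrow> (real ^ 'p) \<times> real) \<Rightarrow> (nat \<Rightarrow> nat \<Rightarrow> nat \<Rightarrow> 'p set) \<Rightarrow> ennreal"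
  assumes M: "prob_space M"
    and iid: "iid_copies M (\<lambda>i w. (Xs i w, Ys i w)) (\<lambda>w. (X w, Y w))"
    and seeds: "iid_seeds M (\<lambda>(b, j, \<tau>). \<S> b j \<tau>)"
    and independent: "independent_elements M
           (\<Pi>\<^sub>M i\<in>UNIV. borel) (\<lambda>w i. (Xs i w, Ys i w))
           (\<Pi>\<^sub>M q\<in>UNIV. count_space UNIV) (\<lambda>w (b, j, \<tau>). \<S> b j \<tau> w)"
    and n: "n \<ge> 1" and t: "t \<ge> 2"
    and F_cong: "\<And>D s s'. (\<And>b j \<tau>. b \<in> {1..B} \<Longrightarrow> j \<in> {1..k} \<Longrightarrow> \<tau> < t \<Longrightarrow> s b j \<tau> = s' b j \<tau>) \<Longrightarrow> F D s = F D s'"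
    and F_meas: "\<And>s. (\<And>b j \<tau>. s b j \<tau> \<noteq> {}) \<Longrightarrow> (\<lambda>D. F D s) \<in> borel_measurable (Pi\<^sub>M {..<n} (\<lambda>_. borel))"
    and bound: "\<And>s. (\<And>b j \<tau>. s b j \<tau> \<noteq> {}) \<Longrightarrow>
        (\<integral>\<^sup>+D. F D s \<partial>Pi\<^sub>M {..<n} (\<lambda>_. distr M borel (\<lambda>w. (X w, Y w))))
          \<le> a + c * (if \<exists>b\<in>{1..B}. card {j\<in>{1..k}. s b j 1 = UNIV} < N0 then 1 else 0)"
  shows "(\<integral>\<^sup>+w. F (\<lambda>i\<in>{..<n}. (Xs i w, Ys i w)) (\<lambda>b j \<tau>. \<S> b j \<tau> w) \<partial>M)
    \<le> a + c * ennreal (real B * (2 ^ N0 * (1 - 1 / (2 * real CARD('p))) ^ k))"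
proof -
  interpret prob_space M by fact
  define R where "R = (\<lambda>(b, j, \<tau>). \<S> b j \<tau>)"
  define idx where "idx = {1..B} \<times> {1..k} \<times> {..<t}"
  define U where "U w = (\<lambda>i\<in>{..<n}. (Xs i w, Ys i w))" for w
  define V where "V w = (\<lambda>q\<in>idx. R q w)" for w
  define VS where "VS = idx \<rightarrow>\<^sub>E (UNIV - {{} :: 'p set})"
  define sd where "sd v b j \<tau> = (if (b, j, \<tau>) \<in> idx then v (b, j, \<tau>) else UNIV)"
    for v :: "nat \<times> nat \<times> nat \<Rightarrow> 'p set" and b j \<tau>
  define Bad where "Bad = {v. \<exists>b\<in>{1..B}. card {j\<in>{1..k}. sd v b j 1 = UNIV} < N0}"
  let ?N = "Pi\<^sub>M {..<n} (\<lambda>_. borel) :: (nat \<Rightarrow> (real ^ 'p) \<times> real) measure"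
  have fin_idx: "finite idx" by (simp add: idx_def)
  have indepR: "indep_vars (\<lambda>_. count_space UNIV) R UNIV"
    and R_prob: "\<And>q S. S \<noteq> {} \<Longrightarrow> measure M {w \<in> space M. R q w = S} = 1 / (real CARD('p) * real (CARD('p) choose card S))"
    using seeds unfolding iid_seeds_def R_def[symmetric] by blast+
  have Rm [measurable]: "R q \<in> measurable M (count_space UNIV)" for q
    using indepR unfolding indep_vars_def by blast
  have evR: "{w \<in> space M. R q w = S} \<in> events" for q S by measurable
  have V_iff: "V w = v \<longleftrightarrow> (\<forall>q\<in>idx. R q w = v q)" if "v \<in> extensional idx" for v w
    using that by (auto simp: V_def extensional_def fun_eq_iff)
  have evV: "{w\<in>space M. V w = v} \<in> events" for v
  proof (cases "v \<in> extensional idx")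
    case True
    have "{w\<in>space M. \<forall>q\<in>idx. R q w = v q} \<in> events"
      by (intro sets.sets_Collect_finite_All evR fin_idx)
    then show ?thesis using V_iff[OF True] by simp
  next
    case False
    then have empty: "{w\<in>space M. V w = v} = {}" by (auto simp: V_def)
    show ?thesis unfolding empty by (rule sets.empty_sets)
  qed
  have evQ: "{w\<in>space M. Q (V w)} \<in> events" for Q
  proof -
    have "{w\<in>space M. Q (V w)} = (\<Union>v\<in>{v \<in> idx \<rightarrow>\<^sub>E UNIV. Q v}. {w\<in>space M. V w = v})"
      by (auto simp: V_def)
    also have "\<dots> \<in> events" using fin_idx evV by (intro sets.finite_UN finite_subset[OF _ finite_PiE[of idx "\<lambda>_.
        UNIV"]]) auto
    finally show ?thesis .
  qed
  have Zm: "(\<lambda>w. (Xs i w, Ys i w)) \<in> measurable M borel" for i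
    using iid unfolding iid_copies_def by (auto simp: indep_vars_def)
  have law: "distr M ?N U = Pi\<^sub>M {..<n} (\<lambda>_. distr M borel (\<lambda>w. (X w, Y w)))"
  proof -
    have "indep_vars (\<lambda>_. borel) (\<lambda>i w. (Xs i w, Ys i w)) {..<n}"
      using iid unfolding iid_copies_def by (auto intro: indep_vars_subset)
    then have "distr M ?N (\<lambda>w. \<lambda>i\<in>{..<n}. (Xs i w, Ys i w)) = Pi\<^sub>M {..<n} (\<lambda>i. distr M borel (\<lambda>w. (Xs i w, Ys i w)))"
      using n by (subst (asm) indep_vars_iff_distr_eq_PiM) (auto intro: Zm simp: lessThan_empty_iff)
    also have "(\<lambda>i. distr M borel (\<lambda>w. (Xs i w, Ys i w))) = (\<lambda>_. distr M borel (\<lambda>w. (X w, Y w)))"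
      using iid unfolding iid_copies_def by auto
    finally show ?thesis unfolding U_def[abs_def] .
  qed
  have Um: "U \<in> measurable M ?N"
    unfolding U_def[abs_def] by (intro measurable_restrict Zm)
  have "(\<integral>\<^sup>+w. F (\<lambda>i\<in>{..<n}. (Xs i w, Ys i w)) (\<lambda>b j \<tau>. \<S> b j \<tau> w) \<partial>M) = (\<integral>\<^sup>+w. F (U w) (sd (V w)) \<partial>M)"
    unfolding U_def by (intro nn_integral_cong F_cong) (auto simp: sd_def V_def R_def idx_def)
  also have "\<dots> \<le> a + c * ennreal (real B * (2 ^ N0 * (1 - 1 / (2 * real CARD('p))) ^ k))"
  proof (rule nn_integral_average_finite[where F="\<lambda>D v. F D (sd v)" and VS=VS and Bad=Bad and V=V, OF Um])
    show "finite VS" unfolding VS_def by (intro finite_PiE fin_idx) auto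
    show "{w\<in>space M. V w = v} \<in> events" for v by (rule evV)
    show "AE w in M. V w \<in> VS"
    proof -
      have "AE w in M. R q w \<noteq> {}" for q by (rule seeds_nonempty[OF Rm R_prob])
      then have "AE w in M. \<forall>q\<in>idx. R q w \<noteq> {}" using fin_idx by (subst AE_finite_all) auto
      then show ?thesis by eventually_elim (auto simp: V_def VS_def)
    qed
    have sd_ne: "sd v b j \<tau> \<noteq> {}" if "v \<in> VS" for v b j \<tau>
      using that by (auto simp: sd_def VS_def PiE_iff)
    show "(\<lambda>D. F D (sd v)) \<in> borel_measurable ?N" if "v \<in> VS" for v
      by (rule F_meas) (rule sd_ne[OF that])
    show "(\<integral>\<^sup>+D. F D (sd v) \<partial>distr M ?N U) \<le> a + c * indicator Bad v" if "v \<in> VS" for v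
      unfolding law using bound[of "sd v", OF sd_ne[OF that]] by (auto simp: Bad_def indicator_def split: if_splits)
    show "{w \<in> space M. V w \<in> Bad} \<in> events" by (rule evQ[of "\<lambda>v. v \<in> Bad"])
    show "prob {w \<in> space M. V w \<in> Bad} \<le> real B * (2 ^ N0 * (1 - 1 / (2 * real CARD('p))) ^ k)"
    proof -
      define E where "E b = {w\<in>space M. card {j\<in>{1..k}. sd (V w) b j 1 = UNIV} < N0}" for b
      have Eb: "prob (E b) \<le> 2 ^ N0 * (1 - 1 / (2 * real CARD('p))) ^ k" if b: "b \<in> {1..B}" for b
      proof -
        \<comment> \<open>the seeds of the first splits\<close>
        define J where "J = {b} \<times> {1..k} \<times> {1::nat}"
        have "{q\<in>J. R q w = UNIV} = (\<lambda>j. (b, j, 1)) ` {j\<in>{1..k}. sd (V w) b j 1 = UNIV}" for w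
          using b t by (auto simp: J_def sd_def V_def idx_def)
        then have card_eq: "card {q\<in>J. R q w = UNIV} = card {j\<in>{1..k}. sd (V w) b j 1 = UNIV}" for w
          by (simp add: card_image inj_on_def)
        have "prob {w\<in>space M. card {q\<in>J. R q w = UNIV} < N0} \<le> 2 ^ N0 * (1 - 1 / real CARD('p) / 2) ^ card J"
        proof (rule few_full_seeds)
          show "indep_vars (\<lambda>_. count_space UNIV) R J" by (rule indep_vars_subset[OF indepR]) simp
          show "prob {w\<in>space M. R q w = UNIV} = 1 / real CARD('p)" for q
            using R_prob[of UNIV q] by simp
        qed (simp add: J_def)
        moreover have "card J = k" by (simp add: J_def card_cartesian_product)
        ultimately show ?thesis unfolding card_eq E_def by (simp add: mult.commute)
      qed
      have "prob {w \<in> space M. V w \<in> Bad} = prob (\<Union>b\<in>{1..B}. E b)"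
        by (rule arg_cong[where f=prob]) (auto simp: Bad_def E_def)
      also have "\<dots> \<le> (\<Sum>b\<in>{1..B}. prob (E b))"
      proof (rule finite_measure_subadditive_finite)
        have "E b \<in> events" for b
          unfolding E_def by (rule evQ[of "\<lambda>v. card {j\<in>{1..k}. sd v b j 1 = UNIV} < N0"])
        then show "E ` {1..B} \<subseteq> events" by blast
      qed simp
      also have "\<dots> \<le> (\<Sum>b\<in>{1..B}. 2 ^ N0 * (1 - 1 / (2 * real CARD('p))) ^ k)"
        by (rule sum_mono) (rule Eb)
      finally show ?thesis by simp
    qed
    show "prob (U -` A \<inter> space M \<inter> {w \<in> space M. V w = v}) = prob (U -` A \<inter> space M) * prob {w \<in> space M. V w = v}"
      if A: "A \<in> sets ?N" and v: "v \<in> VS" for A v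
    proof -
      let ?PX = "\<Pi>\<^sub>M i\<in>(UNIV :: nat set). (borel :: ((real ^ 'p) \<times> real) measure)"
      let ?PS = "\<Pi>\<^sub>M q\<in>(UNIV :: (nat \<times> nat \<times> nat) set). (count_space UNIV :: 'p set measure)"
      let ?UU = "\<lambda>w i. (Xs i w, Ys i w)"
      let ?SS = "\<lambda>w q. R q w"
      have SS: "(\<lambda>w (b, j, \<tau>). \<S> b j \<tau> w) = ?SS" by (auto simp: R_def fun_eq_iff)
      have ind: "indep_set (sets (vimage_algebra (space M) ?UU ?PX)) (sets (vimage_algebra (space M) ?SS ?PS))"
        using independent unfolding independent_elements_def SS by blast
      have "(\<lambda>D. restrict D {..<n}) -` A \<inter> space ?PX \<in> sets ?PX"
        by (rule measurable_sets[OF _ A]) (intro measurable_restrict_subset, simp)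
      from in_vimage_algebra[OF this, of ?UU "space M"]
      have a: "U -` A \<inter> space M \<in> sets (vimage_algebra (space M) ?UU ?PX)"
        by (simp add: vimage_def Int_def U_def[abs_def] space_PiM restrict_def cong: conj_cong)
      have "{f \<in> space ?PS. \<forall>q\<in>idx. f q = v q} \<in> sets ?PS"
        by (intro sets.sets_Collect_finite_All fin_idx) measurable
      from in_vimage_algebra[OF this, of ?SS "space M"]
      have "{w \<in> space M. \<forall>q\<in>idx. R q w = v q} \<in> sets (vimage_algebra (space M) ?SS ?PS)"
        by (simp add: vimage_def Int_def space_PiM conj_commute)
      moreover have "v \<in> extensional idx" using v by (auto simp: VS_def PiE_def)
      ultimately have b: "{w \<in> space M. V w = v} \<in> sets (vimage_algebra (space M) ?SS ?PS)"
        using V_iff by simp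
      show ?thesis by (rule indep_setD[OF ind a b])
    qed
  qed
  finally show ?thesis .
qed


lemma choose_tolerance:
  fixes e S2 :: real
  assumes "e > 0" "S2 \<ge> 0"
  obtains \<epsilon> where "0 < \<epsilon>" "\<epsilon> \<le> 1" "(1 + \<epsilon>)\<^sup>2 * (S2 + 2 * \<epsilon>) - S2 \<le> e"
proof -
  define \<epsilon> where "\<epsilon> = min 1 (e / (3 * S2 + 8))"
  have pos: "3 * S2 + 8 > 0" using assms by simp
  have \<epsilon>: "0 < \<epsilon>" "\<epsilon> \<le> 1" "\<epsilon> \<le> e / (3 * S2 + 8)" using assms pos by (auto simp: \<epsilon>_def)
  have "\<epsilon>\<^sup>2 \<le> \<epsilon>" using \<epsilon> by (simp add: power2_eq_square mult_left_le)
  then have sq: "(1 + \<epsilon>)\<^sup>2 \<le> 1 + 3 * \<epsilon>" by (simp add: power2_sum)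
  have "(1 + \<epsilon>)\<^sup>2 * (S2 + 2 * \<epsilon>) = (1 + \<epsilon>)\<^sup>2 * S2 + (1 + \<epsilon>)\<^sup>2 * (2 * \<epsilon>)" by (simp add: distrib_left)
  also have "\<dots> \<le> (1 + 3 * \<epsilon>) * S2 + 4 * (2 * \<epsilon>)"
    using sq \<epsilon> assms by (intro add_mono mult_right_mono) auto
  also have "\<dots> - S2 = \<epsilon> * (3 * S2 + 8)" by (simp add: algebra_simps)
  also have "\<dots> \<le> e" using \<epsilon>(3) pos by (simp add: field_simps)
  finally have "(1 + \<epsilon>)\<^sup>2 * (S2 + 2 * \<epsilon>) - S2 \<le> e" by simp
  with \<epsilon> that show thesis by blast
qed


section \<open>Consistency\<close>

theorem theorem5p1:
  fixes M :: "'w measure"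
    and X :: "'w \<Rightarrow> real ^ 'p" and Y :: "'w \<Rightarrow> real" and m :: "real ^ 'p \<Rightarrow> real"
    and Xs :: "nat \<Rightarrow> 'w \<Rightarrow> real ^ 'p" and Ys :: "nat \<Rightarrow> 'w \<Rightarrow> real"
    and \<S> :: "nat \<Rightarrow> nat \<Rightarrow> nat \<Rightarrow> 'w \<Rightarrow> 'p set"
    and sel :: "nat \<Rightarrow> nat \<Rightarrow> 'p split_rule" and coef :: "nat \<Rightarrow> 'p coeff_rule"
    and t B :: nat and k :: "nat \<Rightarrow> nat" and \<beta> :: "nat \<Rightarrow> real" and c :: real
  assumes "prob_space M"
    and "X \<in> borel_measurable M" and "Y \<in> borel_measurable M"
    and "AE w in M. X w \<in> cbox 0 1"
    and "regression_function M X Y m"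
    and "iid_copies M (\<lambda>i w. (Xs i w, Ys i w)) (\<lambda>w. (X w, Y w))"
    and "iid_seeds M (\<lambda>(b, j, \<tau>). \<S> b j \<tau>)"
    and "independent_elements M
           (\<Pi>\<^sub>M i\<in>UNIV. borel) (\<lambda>w i. (Xs i w, Ys i w))
           (\<Pi>\<^sub>M q\<in>UNIV. count_space UNIV) (\<lambda>w (b, j, \<tau>). \<S> b j \<tau> w)"
    and "\<And>b j. optimal_split_rule (sel b j)" and "\<And>b. least_squares_rule (coef b)"
    \<comment> \<open>for each outcome of the seeds the estimator is a measurable function of the data and of \<open>x\<close>\<close>
    and "\<And>n b s. b \<in> {1..B} \<Longrightarrow> (\<And>j \<tau>. s j \<tau> \<noteq> {}) \<Longrightarrow>
           (\<lambda>(D, x). boost_estimator (sel b) (coef b) t n D s (k n) x)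
             \<in> borel_measurable ((\<Pi>\<^sub>M i\<in>{..<n}. borel) \<Otimes>\<^sub>M borel)"
    and "t \<ge> 2" and "B \<ge> 1"
    and "c > 0" and "integrable M (\<lambda>w. exp (c * (Y w)\<^sup>2))"
    and "integrable M (\<lambda>w. (m (X w))\<^sup>2)"
    and "same_order \<beta> (\<lambda>n. ln (real n))"
    and "filterlim k at_top sequentially"
    and "(\<lambda>n. real (k n)) \<in> o(\<lambda>n. real n / ln (real n) ^ 4)"
  shows "(\<lambda>n. \<integral>\<^sup>+ w. (\<integral>\<^sup>+ x. ennreal (\<bar>ensemble_estimator sel coef t n (\<lambda>i\<in>{..<n}. (Xs i w, Ys i w))
              (\<lambda>b j \<tau>. \<S> b j \<tau> w) (k n) B (\<beta> n) x - m x\<bar>\<^sup>2) \<partial>distr M borel X) \<partial>M)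
           \<longlonglongrightarrow> 0"
proof -
  interpret prob_space M by fact
  define \<nu> where "\<nu> = distr M borel (\<lambda>w. (X w, Y w))"
  have XY: "(\<lambda>w. (X w, Y w)) \<in> measurable M borel"
    using assms(2,3) by (rule borel_measurable_Pair)
  have fst_m: "fst \<in> measurable (borel :: ((real ^ 'p) \<times> real) measure) borel"
    by (intro borel_measurable_continuous_onI continuous_intros)
  have Y2: "integrable M (\<lambda>w. (Y w)\<^sup>2)"
  proof (rule Bochner_Integration.integrable_bound[OF integrable_divide[OF assms(15), of c]])
    show "AE w in M. norm ((Y w)\<^sup>2) \<le> norm (exp (c * (Y w)\<^sup>2) / c)"
    proof (rule AE_I2)
      fix w
      have "c * (Y w)\<^sup>2 \<le> exp (c * (Y w)\<^sup>2)" using exp_ge_add_one_self[of "c * (Y w)\<^sup>2"] by linarith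
      then show "norm ((Y w)\<^sup>2) \<le> norm (exp (c * (Y w)\<^sup>2) / c)" using assms(14) by (simp add: field_simps)
    qed
  qed (use assms(3) in measurable)
  interpret R: regression_law \<nu> m
    unfolding \<nu>_def by (rule regression_law_distr[OF assms(1-5) Y2 assms(16)])
  have \<mu>: "distr M borel X = distr \<nu> borel fst"
    unfolding \<nu>_def by (subst distr_distr[OF fst_m XY]) (simp add: o_def)
  interpret \<mu>: prob_space "distr M borel X" by (rule prob_space_distr) (rule assms(2))
  have m_m: "m \<in> borel_measurable borel" by (rule R.m_measurable)
  define \<Phi> where "\<Phi> n D s = (\<integral>\<^sup>+x. ennreal (\<bar>ensemble_estimator sel coef t n D s (k n) B (\<beta> n) x - m x\<bar>\<^sup>2)
      \<partial>distr M borel X)"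
    for n D s
  define y2 where "y2 = (\<integral>z. (snd z)\<^sup>2 \<partial>\<nu>)"
  have noise0: "R.noise \<ge> 0" unfolding R.noise_def by simp
  define \<rho> where "\<rho> = 1 - 1 / (2 * real CARD('p))"
  have "CARD('p) \<ge> 1" by (simp add: Suc_le_eq)
  then have "real CARD('p) \<ge> real 1" by (simp only: of_nat_le_iff)
  moreover have "1 / (2 * x) \<le> 1 / 2" if "x \<ge> real 1" for x :: real using that by (simp add: field_simps)
  ultimately have "1 / (2 * real CARD('p)) \<le> 1 / 2" by blast
  moreover have "1 / (2 * real CARD('p)) > 0" by simp
  ultimately have \<rho>: "0 \<le> \<rho>" "\<rho> < 1" unfolding \<rho>_def by linarith+
  have \<Phi>_bound: "(\<integral>\<^sup>+w. \<Phi> n (\<lambda>i\<in>{..<n}. (Xs i w, Ys i w)) (\<lambda>b j \<tau>. \<S> b j \<tau> w) \<partial>M)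
      \<le> ennreal (R.risk_bound \<epsilon> n (k n * t) (t - 1) (\<beta> n)
            (R.noise + (\<integral>z. (f (fst z) - m (fst z))\<^sup>2 \<partial>\<nu>) + 4 * V\<^sup>2 / N0))
        + ennreal ((1 + \<epsilon>)\<^sup>2 * y2) * ennreal (real B * (2 ^ N0 * \<rho> ^ k n))"
    if n: "n \<ge> 2" and \<beta>n: "\<beta> n > 0" and \<epsilon>: "0 < \<epsilon>" "\<epsilon> \<le> 1" and N0: "N0 \<ge> 1"
      and A: "\<And>l. l < K \<Longrightarrow> A l \<in> unit_halfspaces" and f: "\<And>x. f x = (\<Sum>l<K::nat. a l * indicator (A l) x)"
      and V: "V = (\<Sum>l<K. \<bar>a l\<bar>)" for n \<epsilon> N0 K A a V f
    unfolding \<rho>_def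
  proof (rule seed_average_le[OF assms(1,6,7,8) _ assms(12)])
    show "1 \<le> n" using n by simp
    show "\<Phi> n D s = \<Phi> n D s'"
      if same: "\<And>b j \<tau>. b \<in> {1..B} \<Longrightarrow> j \<in> {1..k n} \<Longrightarrow> \<tau> < t \<Longrightarrow> s b j \<tau> = s' b j \<tau>" for D s s'
    proof -
      have "boost_estimator (sel b) (coef b) t n D (s b) (k n) = boost_estimator (sel b) (coef b) t n D (s' b) (k n)"
        if "b \<in> {1..B}" for b
        by (rule boost_estimator_cong) (rule same[OF that])
      then have "ensemble_estimator sel coef t n D s (k n) B (\<beta> n) x
          = ensemble_estimator sel coef t n D s' (k n) B (\<beta> n) x" for x
        by (simp add: ensemble_estimator_def)
      then show ?thesis by (simp add: \<Phi>_def)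
    qed
    show "(\<lambda>D. \<Phi> n D s) \<in> borel_measurable (Pi\<^sub>M {..<n} (\<lambda>_. borel))" if s: "\<And>b j \<tau>. s b j \<tau> \<noteq> {}" for s
    proof -
      let ?Q = "Pi\<^sub>M {..<n} (\<lambda>_. borel) \<Otimes>\<^sub>M distr M borel X"
      have sets_Q: "sets ?Q = sets (Pi\<^sub>M {..<n} (\<lambda>_. borel) \<Otimes>\<^sub>M borel)"
        by (intro sets_pair_measure_cong refl) simp
      have est: "(\<lambda>z. boost_estimator (sel b) (coef b) t n (fst z) (s b) (k n) (snd z)) \<in> borel_measurable ?Q"
        if "b \<in> {1..B}" for b
        using assms(11)[OF that, of "s b" n] s unfolding measurable_cong_sets[OF sets_Q refl] case_prod_beta by simp
      have ens: "(\<lambda>z. ensemble_estimator sel coef t n (fst z) s (k n) B (\<beta> n) (snd z)) \<in> borel_measurable ?Q"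
        unfolding ensemble_estimator_def
        by (intro borel_measurable_divide borel_measurable_sum borel_measurable_const measurable_compose[OF est
            measurable_truncate_at])
      have mq: "(\<lambda>z. m (snd z)) \<in> borel_measurable ?Q"
        by (rule measurable_compose[OF measurable_snd]) (use m_m in simp)
      have "(\<lambda>(D, x). ennreal (\<bar>ensemble_estimator sel coef t n D s (k n) B (\<beta> n) x - m x\<bar>\<^sup>2)) \<in> borel_measurable ?Q"
        unfolding case_prod_beta using ens mq by measurable
      then show ?thesis unfolding \<Phi>_def by (rule \<mu>.borel_measurable_nn_integral)
    qed
    show "(\<integral>\<^sup>+D. \<Phi> n D s \<partial>Pi\<^sub>M {..<n} (\<lambda>_. distr M borel (\<lambda>w. (X w, Y w))))
        \<le> ennreal (R.risk_bound \<epsilon> n (k n * t) (t - 1) (\<beta> n)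
            (R.noise + (\<integral>z. (f (fst z) - m (fst z))\<^sup>2 \<partial>\<nu>) + 4 * V\<^sup>2 / N0))
          + ennreal ((1 + \<epsilon>)\<^sup>2 * y2) * (if \<exists>b\<in>{1..B}. card {j\<in>{1..k n}. s b j 1 = UNIV} < N0 then 1 else 0)"
      if s: "\<And>b j \<tau>. s b j \<tau> \<noteq> {}" for s
      unfolding \<Phi>_def \<mu> \<nu>_def[symmetric] y2_def
      by (rule R.ensemble_risk_le[OF assms(13) \<beta>n \<epsilon> n assms(12) N0 assms(9) assms(10) assms(11)[OF _ s] A f V])
  qed
  have \<beta>_top: "filterlim \<beta> at_top sequentially" by (rule same_order_ln_at_top[OF assms(17)])
  show ?thesis
    unfolding \<Phi>_def[symmetric]
  proof (rule order_tendstoI)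
    fix e :: ennreal assume "e > 0"
    then obtain e0 where e0: "0 < e0" "e0 < e" using dense by blast
    then obtain e1 where e1: "e0 = ennreal e1" "e1 > 0" by (cases e0) (auto simp: ennreal_less_zero_iff)
    obtain \<epsilon> where \<epsilon>: "0 < \<epsilon>" "\<epsilon> \<le> 1" and tol: "(1 + \<epsilon>)\<^sup>2 * (R.noise + 2 * \<epsilon>) - R.noise \<le> e1 / 2"
      using choose_tolerance[of "e1 / 2" R.noise] e1 noise0 by auto
    have cube: "AE x in distr M borel X. x \<in> cbox 0 1" using assms(2,4) by (subst AE_distr_iff) auto
    have "L2_step_closure (distr M borel X) m"
    proof (rule step_functions_dense[OF _ _ cube compact_cbox m_m])
      have "(\<integral>\<^sup>+x. ennreal ((m x)\<^sup>2) \<partial>distr M borel X) = (\<integral>\<^sup>+w. ennreal ((m (X w))\<^sup>2) \<partial>M)"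
        using assms(2) m_m by (intro nn_integral_distr) auto
      also have "\<dots> = ennreal (\<integral>w. (m (X w))\<^sup>2 \<partial>M)" by (rule nn_integral_eq_integral[OF assms(16)]) simp
      finally show "(\<integral>\<^sup>+x. ennreal ((m x)\<^sup>2) \<partial>distr M borel X) < \<infinity>" by simp
    qed (use \<mu>.prob_space_axioms in auto)
    then obtain f where f: "f \<in> step_functions" and close: "(\<integral>\<^sup>+x. ennreal ((m x - f x)\<^sup>2) \<partial>distr M borel X) < ennreal \<epsilon>"
      using \<epsilon>(1) unfolding L2_step_closure_def by blast
    obtain K where "f \<in> span_class K unit_halfspaces" using f unfolding step_functions_def by blast
    then obtain a A where A: "\<And>l. l < K \<Longrightarrow> A l \<in> unit_halfspaces" and f_eq': "f = (\<lambda>x. \<Sum>l<K. a l * indicator (A l) x)"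
      unfolding span_class_def by blast
    have f_eq: "f x = (\<Sum>l<K. a l * indicator (A l) x)" for x by (simp only: f_eq')
    define V where "V = (\<Sum>l<K. \<bar>a l\<bar>)"
    define d where "d = (\<integral>z. (f (fst z) - m (fst z))\<^sup>2 \<partial>\<nu>)"
    have d: "d \<le> \<epsilon>"
    proof -
      note step = R.integrable_square_step[where A=A and f=f and c=a and K=K, OF A f_eq]
      have m_fst: "(\<lambda>z. m (fst z)) \<in> borel_measurable \<nu>" "(\<lambda>z. f (fst z)) \<in> borel_measurable \<nu>"
        using m_m step(1) R.fst_snd_measurable(1) by (auto intro: measurable_compose)
      have "integrable \<nu> (\<lambda>z. (f (fst z) - m (fst z))\<^sup>2)"
        by (rule R.integrable_square_diff) (use m_fst step R.m_L2 in auto)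
      then have "ennreal d = (\<integral>\<^sup>+z. ennreal ((f (fst z) - m (fst z))\<^sup>2) \<partial>\<nu>)"
        unfolding d_def by (intro nn_integral_eq_integral[symmetric]) auto
      also have "\<dots> = (\<integral>\<^sup>+x. ennreal ((m x - f x)\<^sup>2) \<partial>distr M borel X)"
        unfolding \<mu> using m_m step(1) R.fst_snd_measurable(1) by (subst nn_integral_distr) (auto simp: power2_commute)
      finally have "ennreal d < ennreal \<epsilon>" using close by simp
      then show ?thesis using \<epsilon>(1) by (simp add: ennreal_less_iff d_def)
    qed
    \<comment> \<open>the number of trees after which the optimization error for this \<open>f\<close> is below \<open>\<epsilon>\<close>\<close>
    obtain N1 :: nat where N1: "real N1 > 4 * V\<^sup>2 / \<epsilon>" using reals_Archimedean2 by blast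
    define N0 where "N0 = Suc N1"
    have N0: "N0 \<ge> 1" "4 * V\<^sup>2 / N0 \<le> \<epsilon>"
    proof -
      have "4 * V\<^sup>2 < real N1 * \<epsilon>" using N1 \<epsilon>(1) by (simp add: field_simps)
      also have "\<dots> \<le> real N0 * \<epsilon>" using \<epsilon>(1) by (simp add: N0_def)
      finally show "4 * V\<^sup>2 / N0 \<le> \<epsilon>" by (simp add: N0_def field_simps)
    qed (simp add: N0_def)
    define \<delta> where "\<delta> n = net_penalty CARD('p) (t - 1) (k n * t) n \<epsilon> (\<beta> n) / n" for n
    define rest where "rest n = (1 + \<epsilon>) * \<delta> n + (1 + 1 / \<epsilon>) * R.tail (\<beta> n)
      + (1 + \<epsilon>)\<^sup>2 * y2 * (real B * (2 ^ N0 * \<rho> ^ k n))" for n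
    have \<delta>_lim: "\<delta> \<longlonglongrightarrow> 0"
      unfolding \<delta>_def[abs_def] by (rule complexity_term_vanishes[OF assms(17,18,19) \<epsilon>(1)])
    have tail_lim: "(\<lambda>n. R.tail (\<beta> n)) \<longlonglongrightarrow> 0" by (rule R.tail_vanishes[OF \<beta>_top])
    have \<rho>_lim: "(\<lambda>n. \<rho> ^ k n) \<longlonglongrightarrow> 0"
      using filterlim_compose[OF LIMSEQ_power_zero assms(18), of \<rho>] \<rho> by simp
    have "rest \<longlonglongrightarrow> (1 + \<epsilon>) * 0 + (1 + 1 / \<epsilon>) * 0 + (1 + \<epsilon>)\<^sup>2 * y2 * (real B * (2 ^ N0 * 0))"
      unfolding rest_def[abs_def] by (intro tendsto_intros \<delta>_lim tail_lim \<rho>_lim)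
    then have "\<forall>\<^sub>F n in sequentially. rest n < e1 / 2"
      using e1(2) by (intro order_tendstoD(2)) auto
    moreover have "\<forall>\<^sub>F n in sequentially. \<beta> n > 0" using \<beta>_top by (simp add: filterlim_at_top_dense)
    ultimately show "\<forall>\<^sub>F n in sequentially. (\<integral>\<^sup>+w. \<Phi> n (\<lambda>i\<in>{..<n}. (Xs i w, Ys i w)) (\<lambda>b j \<tau>. \<S> b j \<tau> w) \<partial>M) < e"
      using eventually_ge_at_top[of 2]
    proof eventually_elim
      case (elim n)
      let ?r = "R.risk_bound \<epsilon> n (k n * t) (t - 1) (\<beta> n) (R.noise + d + 4 * V\<^sup>2 / N0)"
      let ?q = "(1 + \<epsilon>)\<^sup>2 * y2 * (real B * (2 ^ N0 * \<rho> ^ k n))"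
      have y20: "y2 \<ge> 0" unfolding y2_def by simp
      have q0: "?q \<ge> 0" using y20 \<rho> by simp
      have "?r = (1 + \<epsilon>)\<^sup>2 * (R.noise + d + 4 * V\<^sup>2 / N0) - R.noise + ((1 + \<epsilon>) * \<delta> n + (1 + 1 / \<epsilon>) * R.tail (\<beta> n))"
        unfolding R.risk_bound_def \<delta>_def[symmetric] by (simp add: power2_eq_square algebra_simps)
      also have "\<dots> \<le> (1 + \<epsilon>)\<^sup>2 * (R.noise + 2 * \<epsilon>) - R.noise + ((1 + \<epsilon>) * \<delta> n + (1 + 1 / \<epsilon>) * R.tail (\<beta> n))"
      proof -
        have "R.noise + d + 4 * V\<^sup>2 / N0 \<le> R.noise + 2 * \<epsilon>" using d N0(2) by linarith
        then have "(1 + \<epsilon>)\<^sup>2 * (R.noise + d + 4 * V\<^sup>2 / N0) \<le> (1 + \<epsilon>)\<^sup>2 * (R.noise + 2 * \<epsilon>)"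
          by (rule mult_left_mono) simp
        then show ?thesis by linarith
      qed
      finally have r: "?r \<le> e1 / 2 + ((1 + \<epsilon>) * \<delta> n + (1 + 1 / \<epsilon>) * R.tail (\<beta> n))" using tol by linarith
      have "(\<integral>\<^sup>+w. \<Phi> n (\<lambda>i\<in>{..<n}. (Xs i w, Ys i w)) (\<lambda>b j \<tau>. \<S> b j \<tau> w) \<partial>M)
         \<le> ennreal ?r + ennreal ((1 + \<epsilon>)\<^sup>2 * y2) * ennreal (real B * (2 ^ N0 * \<rho> ^ k n))"
        unfolding d_def by (rule \<Phi>_bound) (use elim \<epsilon> N0 A f_eq V_def in auto)
      also have "\<dots> = ennreal ?r + ennreal ?q" using y20 \<rho> by (subst ennreal_mult[symmetric]) auto
      also have "\<dots> \<le> ennreal e1"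
      proof (cases "?r \<ge> 0")
        case True
        then have "ennreal ?r + ennreal ?q = ennreal (?r + ?q)" using q0 by (simp add: ennreal_plus)
        also have "\<dots> \<le> ennreal e1" using r elim(1) unfolding rest_def by (intro ennreal_leI) linarith
        finally show ?thesis .
      next
        case False
        have "?q \<le> e1"
        proof -
          have "\<delta> n \<ge> 0" unfolding \<delta>_def using net_penalty_nonneg[OF \<epsilon>(1)] by simp
          moreover have "R.tail (\<beta> n) \<ge> 0" unfolding R.tail_def by simp
          ultimately have "0 \<le> (1 + \<epsilon>) * \<delta> n + (1 + 1 / \<epsilon>) * R.tail (\<beta> n)" using \<epsilon> by simp
          then show ?thesis using elim(1) e1(2) unfolding rest_def by linarith
        qed
        then show ?thesis using False by (simp add: ennreal_neg ennreal_leI)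
      qed
      also have "\<dots> < e" using e0 e1 by simp
      finally show ?case .
    qed
  qed simp
qed

end
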